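(* Let $d\ge2$ and $\alpha\in(0,d)$. There exists a constant $Q_0=Q_0(\alpha,d)>0$ such that, for every $\delta>0$, $m\ge\omega_d\delta^d$ and $Q>0$ with $$\frac{Q}{m^{\frac{d-1+\alpha}{2d}}}\le Q_0\,\frac{\delta^d}{m},$$ both problems $$\min\left\{\mathcal F_{\alpha,Q}(E):\ |E|=m,\ E\in\mathcal K_\delta\right\}\qquad\text{and}\qquad\min\left\{\mathcal G_{\alpha,Q}(E):\ |E|=m,\ E\in\mathcal K_\delta\right\}$$ have a solution.
   Context: $|E|$ is Lebesgue measure in $\mathbb R^d$ and $\omega_d$ is the volume of the unit ball. $P(E)$ is the perimeter of $E$ in $\mathbb R^d$ in the sense of De Giorgi (equal to $\mathcal H^{d-1}(\partial E)$ when $E$ has smooth boundary). For a Borel set $A\subset\mathbb R^d$, $$\mathcal I_\alpha(A)=\inf\left\{\int_{\mathbb R^d\times\mathbb R^d}\frac{d\mu(x)\,d\mu(y)}{|x-y|^\alpha}:\ \mu \text{ non-negative Borel measure on }\mathbb R^d,\ \mu(A)=1\right\}\in[0,+\infty].$$ $\mathcal F_{\alpha,Q}(E)=P(E)+Q^2\mathcal I_\alpha(E)$ and $\mathcal G_{\alpha,Q}(E)=P(E)+Q^2\mathcal I_\alpha(\partial E)$, with values in $[0,+\infty]$. A set $E$ satisfies the $\delta$-ball condition if for every $x\in\partial E$ there are a ball of radius $\delta$ contained in $E$ and tangent to $\partial E$ at $x$ (an open ball $B_\delta(y)\subset E$ with $|x-y|=\delta$), and a ball of radius $\delta$ contained in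 $E^c=\mathbb R^d\setminus E$ and tangent to $\partial E$ at $x$ (an open ball $B_\delta(z)\subset E^c$ with $|x-z|=\delta$). $\mathcal K_\delta$ is the class of all closed subsets of $\mathbb R^d$ satisfying the $\delta$-ball condition. *)

theory Defs
  imports "HOL-Analysis.Analysis"
begin

text \<open>The ambient space \<open>\<real>\<^sup>d\<close> is a type \<open>'a::euclidean_space\<close> with \<open>DIM('a) = d\<close>.\<close>

definition C1_compact_support :: "('a::euclidean_space \<Rightarrow> 'a) \<Rightarrow> bool" where
  "C1_compact_support T \<longleftrightarrow>
     (\<exists>T' :: 'a \<Rightarrow> 'a \<Rightarrow>\<^sub>L 'a.
        (\<forall>x. (T has_derivative blinfun_apply (T' x)) (at x)) \<and> continuous_on UNIV T') \<and>
     compact (closure {x. T x \<noteq> 0})"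

definition divergence :: "('a::euclidean_space \<Rightarrow> 'a) \<Rightarrow> 'a \<Rightarrow> real" where
  "divergence T x = (\<Sum>b\<in>Basis. frechet_derivative T (at x) b \<bullet> b)"

text \<open>De Giorgi perimeter. The truncation of negative reals to \<open>0\<close> by \<open>ennreal\<close> does not change
  the supremum, since \<open>T = (\<lambda>_. 0)\<close> is admissible.\<close>

definition perimeter :: "'a::euclidean_space set \<Rightarrow> ennreal" where
  "perimeter E =
     (SUP T \<in> {T :: 'a \<Rightarrow> 'a. C1_compact_support T \<and> (\<forall>x. norm (T x) \<le> 1)}.
        ennreal (set_lebesgue_integral lebesgue E (divergence T)))"

text \<open>The quotient is taken in \<open>ennreal\<close>, where \<open>1 / 0 = \<infinity>\<close>: the kernel is \<open>\<infinity>\<close> on the diagonal,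
  so that for instance point masses have infinite energy. (With real division it would be \<open>0\<close>.)
  The double integral is an iterated one because \<open>\<mu>\<close> is not assumed to be sigma-finite, which
  the product measure would need.\<close>

definition riesz_energy :: "real \<Rightarrow> 'a::euclidean_space measure \<Rightarrow> ennreal" where
  "riesz_energy \<alpha> \<mu> = (\<integral>\<^sup>+x. (\<integral>\<^sup>+y. 1 / ennreal (norm (x - y) powr \<alpha>) \<partial>\<mu>) \<partial>\<mu>)"

definition I_riesz :: "real \<Rightarrow> 'a::euclidean_space set \<Rightarrow> ennreal" where
  "I_riesz \<alpha> A = (INF \<mu> \<in> {\<mu> :: 'a measure. sets \<mu> = sets borel \<and> emeasure \<mu> A = 1}.
                    riesz_energy \<alpha> \<mu>)"

definition F_energy :: "real \<Rightarrow> real \<Rightarrow> 'a::euclidean_space set \<Rightarrow> ennreal" where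
  "F_energy \<alpha> Q E = perimeter E + ennreal (Q\<^sup>2) * I_riesz \<alpha> E"

definition G_energy :: "real \<Rightarrow> real \<Rightarrow> 'a::euclidean_space set \<Rightarrow> ennreal" where
  "G_energy \<alpha> Q E = perimeter E + ennreal (Q\<^sup>2) * I_riesz \<alpha> (frontier E)"

definition ball_condition :: "real \<Rightarrow> 'a::euclidean_space set \<Rightarrow> bool" where
  "ball_condition \<delta> E \<longleftrightarrow>
     (\<forall>x\<in>frontier E. (\<exists>y. ball y \<delta> \<subseteq> E \<and> dist x y = \<delta>) \<and>
                     (\<exists>z. ball z \<delta> \<subseteq> - E \<and> dist x z = \<delta>))"

definition K_class :: "real \<Rightarrow> 'a::euclidean_space set set" where
  "K_class \<delta> = {E. closed E \<and> ball_condition \<delta> E}"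

end

(* The isoperimetric inequality is proved in its sharp form for sets satisfying the ball condition:
   mollify the indicator of E, apply the Brunn-Minkowski inequality to the superlevel sets of the
   mollification and integrate over the levels. If a hyperplane separates E into two pieces, each
   piece contains a ball of radius delta, and by strict concavity the two pieces have more perimeter
   than the ball of volume m, by an amount that exceeds the Riesz energy of that ball when the charge
   is small. So a competitor below the ball meets every hyperplane between two of its points, which
   bounds its width, since it contains at most m / |B_delta| disjoint balls of radius delta.
   A minimizing sequence can then be translated into a fixed ball. The distance functions converge
   along a subsequence, the ball condition passes to the limit, the volume converges because the
   boundaries are negligible, and perimeter and Riesz energy are lower semicontinuous.

   If the sphere has infinite Riesz energy, so that the ball is no competitor for the functional with
   boundary charge, then so does the boundary of every admissible set, as it is locally a Lipschitz
   graph and can be mapped to the sphere by a map with Lipschitz inverse. *)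
theory Submission
  imports Defs "HOL-Probability.Probability"
begin

section \<open>The Brunn-Minkowski inequality\<close>

text \<open>Parts of a set repel each other, so a minimizing sequence could lose compactness by
  letting them drift apart; the bound on the charge exists to forbid this. Let r be the radius of
  the ball of volume m and w the volume of the unit ball. A split costs at least d w (1 - 2^(-1/d))
  \<delta>^(d-1) in additional perimeter, while the ball pays at most Q^2 C r^(-\<alpha>) for its
  charge, with C taken from the unit ball or the unit sphere. The hypothesis on Q bounds Q^2
  r^(-\<alpha>) by a constant times \<delta>^(d-1) (\<delta>/r)^(d+1), and the last factor is at
  most 1 because m is at least the volume of a ball of radius \<delta>. This fixes
  \<open>Q\<^sub>0\<close>. In the comparison the leading terms d w r^(d-1) have to cancel exactly,
  since r may be much larger than \<delta>; a weaker isoperimetric constant would leave a deficit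
  that the gain from a split cannot cover. Mollification makes a perimeter defined by test fields
  accessible: the normalised gradient of the mollified indicator is, once mollified itself, an
  admissible field.\<close>

definition msum :: "'a::plus set \<Rightarrow> 'a set \<Rightarrow> 'a set" where
  "msum A B = {x + y |x y. x \<in> A \<and> y \<in> B}"

lemma msum_mono: "A \<subseteq> A' \<Longrightarrow> B \<subseteq> B' \<Longrightarrow> msum A B \<subseteq> msum A' B'"
  unfolding msum_def by blast

lemma msum_UN: "msum A B = (\<Union>x\<in>A. \<Union>y\<in>B. {x + y})"
  unfolding msum_def by blast

lemma msum_commute: "msum A B = msum B (A :: 'a::ab_semigroup_add set)"
  unfolding msum_def by (auto simp: add.commute) (metis add.commute)+

lemma compact_msum:
  "compact A \<Longrightarrow> compact B \<Longrightarrow> compact (msum A (B :: 'a::real_normed_vector set))"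
  unfolding msum_def by (rule compact_sums)

text \<open>Superadditivity of the geometric mean, by the arithmetic-geometric mean inequality for
  the ratios \<open>u i / (u i + v i)\<close> and \<open>v i / (u i + v i)\<close>: their two
  arithmetic means add up to 1. For side lengths this is the Brunn-Minkowski inequality for two
  boxes.\<close>

lemma root_prod_add_le:
  fixes u v :: "'i \<Rightarrow> real"
  assumes "finite S" "S \<noteq> {}" and u: "\<And>i. i \<in> S \<Longrightarrow> u i > 0" and v: "\<And>i. i \<in> S \<Longrightarrow> v i > 0"
  shows "root (card S) (prod u S) + root (card S) (prod v S) \<le> root (card S) (\<Prod>i\<in>S. u i + v i)"
proof -
  let ?n = "card S" and ?P = "\<Prod>i\<in>S. u i + v i"
  have n: "?n > 0" using assms by (simp add: card_gt_0_iff)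
  have P: "?P > 0" using u v by (intro prod_pos) (simp add: add_pos_pos)
  have main: "root ?n (prod w S) / root ?n ?P \<le> (\<Sum>i\<in>S. w i / (u i + v i)) / ?n"
    if w: "\<And>i. i \<in> S \<Longrightarrow> w i > 0" for w
  proof -
    have pos: "w i / (u i + v i) > 0" if "i \<in> S" for i
      using u[OF that] v[OF that] w[OF that] by simp
    have "root ?n (prod w S) / root ?n ?P = root ?n (\<Prod>i\<in>S. w i / (u i + v i))"
      by (simp add: prod_dividef real_root_divide)
    also have "\<dots> = (\<Prod>i\<in>S. w i / (u i + v i)) powr (1 / ?n)"
      using n pos by (intro root_powr_inverse prod_nonneg) (auto intro: less_imp_le)
    also have "\<dots> \<le> (\<Sum>i\<in>S. w i / (u i + v i) / ?n)"
      using assms(1,2) pos by (intro arith_geom_mean) (auto intro: less_imp_le)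
    finally show ?thesis by (simp add: sum_divide_distrib)
  qed
  have "(root ?n (prod u S) + root ?n (prod v S)) / root ?n ?P
        \<le> (\<Sum>i\<in>S. u i / (u i + v i)) / ?n + (\<Sum>i\<in>S. v i / (u i + v i)) / ?n"
    using main[of u] main[of v] u v by (simp add: add_divide_distrib)
  also have "\<dots> = (\<Sum>i\<in>S. u i / (u i + v i) + v i / (u i + v i)) / ?n"
    by (simp add: sum.distrib add_divide_distrib)
  also have "(\<Sum>i\<in>S. u i / (u i + v i) + v i / (u i + v i)) = (\<Sum>i\<in>S. 1)"
  proof (rule sum.cong[OF refl])
    fix i assume "i \<in> S"
    then have "u i + v i \<noteq> 0" using u[of i] v[of i] by simp
    then show "u i / (u i + v i) + v i / (u i + v i) = 1"
      by (simp add: add_divide_distrib[symmetric])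
  qed
  finally show ?thesis using n P by (simp add: divide_le_eq)
qed

text \<open>Degenerate boxes are excluded so that each member has positive volume. A hyperplane
  separating two members then leaves volume on both sides, and the ratio of the cut lies strictly
  between 0 and 1.\<close>

definition box_family :: "'a::euclidean_space set set \<Rightarrow> bool" where
  "box_family F \<longleftrightarrow> finite F \<and> F \<noteq> {} \<and> (\<forall>K\<in>F. (\<exists>a b. K = cbox a b) \<and> interior K \<noteq> {}) \<and>
     pairwise (\<lambda>A B. interior A \<inter> interior B = {}) F"

lemma box_family_compact: "box_family F \<Longrightarrow> compact (\<Union>F)"
  unfolding box_family_def by (intro compact_Union) auto

lemma box_family_pos:
  assumes "box_family F" shows "measure lebesgue (\<Union>F) > 0"
proof -
  obtain K where K: "K \<in> F" using assms by (auto simp: box_family_def)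
  then obtain a b where ab: "K = cbox a b" "interior K \<noteq> {}"
    using assms unfolding box_family_def by blast
  then have "box a b \<noteq> {}" by simp
  then have "0 < measure lebesgue K"
    using ab by (simp add: content_pos_lt_eq box_ne_empty)
  also have "\<dots> \<le> measure lebesgue (\<Union>F)"
    using K ab box_family_compact[OF assms] by (intro measure_mono_fmeasurable) (auto intro: lmeasurable_compact)
  finally show ?thesis .
qed

text \<open>Disjoint open boxes have disjoint projections to some axis. Which of the two comes first
  is not known, so the conclusion renames them.\<close>

lemma box_family_separated:
  assumes "box_family F" "A \<in> F" "B \<in> F" "A \<noteq> B"
  obtains A' B' b s where "A' \<in> F" "B' \<in> F" "b \<in> Basis" "A' \<subseteq> {x. x \<bullet> b \<le> s}" "B' \<subseteq> {x. x \<bullet> b \<ge> s}"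
proof -
  obtain a b where A: "A = cbox a b" "box a b \<noteq> {}"
    using assms(1,2) unfolding box_family_def by (metis interior_cbox)
  obtain c e where B: "B = cbox c e" "box c e \<noteq> {}"
    using assms(1,3) unfolding box_family_def by (metis interior_cbox)
  have "box a b \<inter> box c e = {}"
    using assms A(1) B(1) unfolding box_family_def pairwise_def by (metis interior_cbox)
  then obtain i where i: "i \<in> Basis" "b \<bullet> i \<le> a \<bullet> i \<or> e \<bullet> i \<le> c \<bullet> i \<or> b \<bullet> i \<le> c \<bullet> i \<or> e \<bullet> i \<le> a \<bullet> i"
    unfolding disjoint_interval by blast
  then consider "b \<bullet> i \<le> c \<bullet> i" | "e \<bullet> i \<le> a \<bullet> i"
    using A(2) B(2) by (force simp: box_ne_empty)
  then show ?thesis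
  proof cases
    case 1
    show ?thesis
      by (rule that[of A B i "b \<bullet> i"]) (use assms A B 1 i in \<open>force simp: mem_box\<close>)+
  next
    case 2
    show ?thesis
      by (rule that[of B A i "e \<bullet> i"]) (use assms A B 2 i in \<open>force simp: mem_box\<close>)+
  qed
qed

text \<open>\<open>H\<close> stands for a half-space bounded by a coordinate hyperplane; what
  matters is that it cuts boxes into boxes. Pieces without interior are negligible and are dropped,
  so the count cannot grow, and it falls as soon as one box of \<open>F\<close> lies on the wrong
  side. This strict decrease drives the induction over the number of boxes.\<close>

lemma box_family_restrict:
  assumes F: "box_family F" and H: "\<And>a b. \<exists>a' b'. cbox a b \<inter> H = cbox a' b'"
    and clH: "closed H" and pos: "measure lebesgue (\<Union>F \<inter> H) > 0"
  obtains F' where "box_family F'" "card F' \<le> card F"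
    "(\<exists>K\<in>F. interior (K \<inter> H) = {}) \<Longrightarrow> card F' < card F" "\<Union>F' \<subseteq> \<Union>F \<inter> H"
    "measure lebesgue (\<Union>F') = measure lebesgue (\<Union>F \<inter> H)"
proof -
  define F0 where "F0 = {K \<in> F. interior (K \<inter> H) \<noteq> {}}"
  define F' where "F' = (\<lambda>K. K \<inter> H) ` F0"
  have finF: "finite F" and box: "\<And>K. K \<in> F \<Longrightarrow> \<exists>a b. K = cbox a b"
    using F by (auto simp: box_family_def)
  have fin: "finite F0" unfolding F0_def using finF by simp
  have box': "\<exists>a b. K \<inter> H = cbox a b" if "K \<in> F" for K
    using box[OF that] H by metis
  have neg: "negligible (\<Union>{K \<inter> H |K. K \<in> F \<and> interior (K \<inter> H) = {}})"
  proof (rule negligible_Union)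
    show "finite {K \<inter> H |K. K \<in> F \<and> interior (K \<inter> H) = {}}" using finF by auto
    fix T assume "T \<in> {K \<inter> H |K. K \<in> F \<and> interior (K \<inter> H) = {}}"
    then obtain K where K: "T = K \<inter> H" "K \<in> F" "interior (K \<inter> H) = {}" by blast
    then obtain a b where "T = cbox a b" using box' by blast
    then show "negligible T" using K by (auto simp: negligible_interval)
  qed
  have sub: "\<Union>F' \<subseteq> \<Union>F \<inter> H" unfolding F'_def F0_def by auto
  have meq: "measure lebesgue (\<Union>F') = measure lebesgue (\<Union>F \<inter> H)"
  proof (rule measure_negligible_symdiff[symmetric])
    show "\<Union>F' \<in> lmeasurable"
    proof (intro lmeasurable_compact compact_Union)
      show "finite F'" unfolding F'_def using fin by simp
      fix K assume "K \<in> F'"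
      then show "compact K" unfolding F'_def F0_def using box' by (metis (no_types, lifting) compact_cbox image_iff mem_Collect_eq)
    qed
    have "\<Union>F' - \<Union>F \<inter> H \<union> (\<Union>F \<inter> H - \<Union>F') \<subseteq> \<Union>{K \<inter> H |K. K \<in> F \<and> interior (K \<inter> H) = {}}"
    proof
      fix x assume "x \<in> \<Union>F' - \<Union>F \<inter> H \<union> (\<Union>F \<inter> H - \<Union>F')"
      then have "x \<in> H" "x \<notin> \<Union>F'" "\<exists>K\<in>F. x \<in> K" using sub by auto
      then obtain K where K: "K \<in> F" "x \<in> K \<inter> H" "x \<notin> \<Union>F'" by blast
      then have "interior (K \<inter> H) = {}" unfolding F'_def F0_def by blast
      then show "x \<in> \<Union>{K \<inter> H |K. K \<in> F \<and> interior (K \<inter> H) = {}}" using K by blast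
    qed
    then show "negligible (\<Union>F' - \<Union>F \<inter> H \<union> (\<Union>F \<inter> H - \<Union>F'))"
      using neg negligible_subset by blast
  qed
  have "F' \<noteq> {}" using pos meq by auto
  moreover have "finite F'" unfolding F'_def using fin by simp
  moreover have "pairwise (\<lambda>A B. interior A \<inter> interior B = {}) F'"
  proof (rule pairwiseI)
    fix A B assume "A \<in> F'" "B \<in> F'" "A \<noteq> B"
    then obtain K L where KL: "A = K \<inter> H" "B = L \<inter> H" "K \<in> F" "L \<in> F" "K \<noteq> L"
      unfolding F'_def F0_def by blast
    then have "interior K \<inter> interior L = {}" using F by (auto simp: box_family_def pairwise_def)
    then show "interior A \<inter> interior B = {}" using KL by auto
  qed
  moreover have "\<forall>K\<in>F'. (\<exists>a b. K = cbox a b) \<and> interior K \<noteq> {}"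
    unfolding F'_def F0_def using box' by blast
  ultimately have 1: "box_family F'" by (simp add: box_family_def)
  have c: "card F' \<le> card F0" unfolding F'_def using fin by (rule card_image_le)
  have 2: "card F0 \<le> card F" using finF by (auto simp: F0_def intro: card_mono)
  have 3: "card F0 < card F" if "\<exists>K\<in>F. interior (K \<inter> H) = {}"
    using finF that by (intro psubset_card_mono) (auto simp: F0_def)
  show ?thesis
    by (rule that[OF 1 _ _ sub meq]) (use c 2 3 in auto)
qed

text \<open>Dominated convergence: the indicators converge off the hyperplane at height
  \<open>t\<close>, which is null.\<close>

lemma continuous_measure_halfspace:
  fixes b :: "'a::euclidean_space"
  assumes "compact S" "b \<in> Basis"
  shows "continuous_on UNIV (\<lambda>t. measure lebesgue (S \<inter> {x. x \<bullet> b \<le> t}))"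
proof -
  have meas: "S \<inter> {x. x \<bullet> b \<le> t} \<in> lmeasurable" for t
    using assms by (intro lmeasurable_compact compact_Int_closed closed_halfspace_component_le)
  have eq: "measure lebesgue (S \<inter> {x. x \<bullet> b \<le> t}) = (\<integral>x. indicator (S \<inter> {x. x \<bullet> b \<le> t}) x \<partial>lebesgue)" for t
    using meas[of t] by (simp add: fmeasurable_def)
  have "(\<lambda>n. \<integral>x. indicator (S \<inter> {x. x \<bullet> b \<le> u n}) x \<partial>lebesgue) \<longlonglongrightarrow>
        (\<integral>x. indicator (S \<inter> {x. x \<bullet> b \<le> t}) x \<partial>lebesgue :: real)" if u: "u \<longlonglongrightarrow> t" for u t
  proof (rule integral_dominated_convergence[where w = "indicator S"])
    show "integrable lebesgue (indicator S :: 'a \<Rightarrow> real)"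
      using lmeasurable_compact[OF assms(1)]
      by (intro integrable_real_indicator) (auto dest: fmeasurableD fmeasurableD2 simp: less_top simp del: emeasure_completion)
    have "AE x in lebesgue. x \<bullet> b \<noteq> t"
      by (rule AE_I'[of "{x. x \<bullet> b = t}"])
        (use negligible_standard_hyperplane[OF assms(2), of t] in \<open>auto simp: negligible_iff_null_sets\<close>)
    then show "AE x in lebesgue. (\<lambda>n. indicator (S \<inter> {x. x \<bullet> b \<le> u n}) x) \<longlonglongrightarrow> (indicator (S \<inter> {x. x \<bullet> b \<le> t}) x :: real)"
    proof eventually_elim
      case (elim x)
      have "\<forall>\<^sub>F n in sequentially. x \<bullet> b \<le> u n \<longleftrightarrow> x \<bullet> b \<le> t"
      proof (cases "x \<bullet> b < t")
        case True
        then show ?thesis using order_tendstoD(1)[OF u True] by (auto elim: eventually_mono)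
      next
        case False
        then have "x \<bullet> b > t" using elim by simp
        then show ?thesis using order_tendstoD(2)[OF u] by (auto elim!: eventually_mono simp: not_le)
      qed
      then have "\<forall>\<^sub>F n in sequentially. (indicator (S \<inter> {x. x \<bullet> b \<le> u n}) x :: real) = indicator (S \<inter> {x. x \<bullet> b \<le> t}) x"
        by eventually_elim (auto simp: indicator_def)
      then show ?case by (rule tendsto_eventually)
    qed
    show "(\<lambda>x. indicator (S \<inter> {x. x \<bullet> b \<le> t}) x :: real) \<in> borel_measurable lebesgue"
      using meas[of t] by (auto simp: fmeasurable_def)
    show "(\<lambda>x. indicator (S \<inter> {x. x \<bullet> b \<le> u n}) x :: real) \<in> borel_measurable lebesgue" for n
      using meas[of "u n"] by (auto simp: fmeasurable_def)
    show "AE x in lebesgue. norm (indicator (S \<inter> {x. x \<bullet> b \<le> u n}) x :: real) \<le> indicator S x" for n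
      by (auto simp: indicator_def)
  qed
  then show ?thesis
    unfolding eq by (intro continuous_at_imp_continuous_on ballI) (auto simp: continuous_at_sequentially o_def)
qed

lemma halfspace_with_measure:
  fixes b :: "'a::euclidean_space"
  assumes "compact S" "b \<in> Basis" "0 < l" "l < measure lebesgue S"
  obtains t where "measure lebesgue (S \<inter> {x. x \<bullet> b \<le> t}) = l"
proof -
  let ?h = "\<lambda>t. measure lebesgue (S \<inter> {x. x \<bullet> b \<le> t})"
  obtain B where B: "\<And>x. x \<in> S \<Longrightarrow> norm x \<le> B"
    using compact_imp_bounded[OF assms(1)] by (auto simp: bounded_iff)
  have bd: "\<bar>x \<bullet> b\<bar> \<le> B" if "x \<in> S" for x
    using B[OF that] Basis_le_norm[OF assms(2), of x] by linarith
  \<comment> \<open>The extra 1 pushes the lower half-space strictly below \<open>S\<close>, which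
    lies between the heights \<open>-B\<close> and \<open>B\<close>.\<close>
  have "S \<inter> {x. x \<bullet> b \<le> -B - 1} = {}" "S \<inter> {x. x \<bullet> b \<le> B} = S"
    using bd by force+
  then have "?h (-B - 1) \<le> l" "l \<le> ?h B" using assms by auto
  moreover have "-B - 1 \<le> B"
  proof -
    have "S \<noteq> {}" using assms by auto
    then obtain x where "x \<in> S" by blast
    then show ?thesis using B[of x] norm_ge_zero[of x] by linarith
  qed
  ultimately have "\<exists>t. -B - 1 \<le> t \<and> t \<le> B \<and> ?h t = l"
    using continuous_measure_halfspace[OF assms(1,2)]
    by (intro IVT') (auto intro: continuous_on_subset)
  then show ?thesis using that by blast
qed

lemma measure_split_halfspace:
  fixes b :: "'a::euclidean_space"
  assumes "compact S" "b \<in> Basis"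
  shows "measure lebesgue S = measure lebesgue (S \<inter> {x. x \<bullet> b \<le> t}) + measure lebesgue (S \<inter> {x. x \<bullet> b \<ge> t})"
proof -
  have "S \<inter> {x. x \<bullet> b \<le> t} \<in> lmeasurable" "S \<inter> {x. x \<bullet> b \<ge> t} \<in> lmeasurable"
    using assms by (auto intro!: lmeasurable_compact compact_Int_closed closed_halfspace_component_le closed_halfspace_component_ge)
  moreover have "negligible (S \<inter> {x. x \<bullet> b \<le> t} \<inter> (S \<inter> {x. x \<bullet> b \<ge> t}))"
    by (rule negligible_subset[OF negligible_standard_hyperplane[OF assms(2), of t]]) auto
  moreover have "S = S \<inter> {x. x \<bullet> b \<le> t} \<union> S \<inter> {x. x \<bullet> b \<ge> t}" by auto
  ultimately show ?thesis
    using measure_Un3_negligible[of "S \<inter> {x. x \<bullet> b \<le> t}" "S \<inter> {x. x \<bullet> b \<ge> t}" "{}" S] by auto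
qed

text \<open>Base case of the induction: the sum of two boxes contains the box whose sides are the
  sums of the sides, and for such boxes the claim is the superadditivity of the geometric
  mean.\<close>

lemma box_family_singletons:
  fixes a b c e :: "'a::euclidean_space"
  assumes "box a b \<noteq> {}" "box c e \<noteq> {}"
  shows "root DIM('a) (measure lebesgue (cbox a b)) + root DIM('a) (measure lebesgue (cbox c e))
         \<le> root DIM('a) (measure lebesgue (msum (cbox a b) (cbox c e)))"
proof -
  have ab: "a \<bullet> i < b \<bullet> i" "c \<bullet> i < e \<bullet> i" if "i \<in> Basis" for i
    using assms that by (auto simp: box_ne_empty)
  have sub: "cbox (a + c) (b + e) \<subseteq> msum (cbox a b) (cbox c e)"
  proof
    fix x assume x: "x \<in> cbox (a + c) (b + e)"
    \<comment> \<open>In each coordinate this is the smallest value that stays in the first box and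
      keeps \<open>x - y\<close> below the upper corner of the second.\<close>
    define y where "y = (\<Sum>i\<in>Basis. max (a \<bullet> i) (x \<bullet> i - e \<bullet> i) *\<^sub>R i)"
    have "y \<in> cbox a b" "x - y \<in> cbox c e"
      using x ab unfolding y_def by (auto simp: mem_box inner_diff_left inner_add_left) (smt (verit) max_def)+
    then show "x \<in> msum (cbox a b) (cbox c e)"
      unfolding msum_def by (intro CollectI exI[of _ y] exI[of _ "x - y"]) auto
  qed
  have "root DIM('a) (measure lebesgue (cbox a b)) + root DIM('a) (measure lebesgue (cbox c e))
     = root DIM('a) (\<Prod>i\<in>Basis. b \<bullet> i - a \<bullet> i) + root DIM('a) (\<Prod>i\<in>Basis. e \<bullet> i - c \<bullet> i)"
    using ab by (simp add: content_cbox less_imp_le inner_diff_left del: prod.cong)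
  also have "\<dots> \<le> root DIM('a) (\<Prod>i\<in>Basis. (b \<bullet> i - a \<bullet> i) + (e \<bullet> i - c \<bullet> i))"
    using ab by (intro root_prod_add_le) auto
  also have "(\<Prod>i\<in>Basis. (b \<bullet> i - a \<bullet> i) + (e \<bullet> i - c \<bullet> i)) = measure lebesgue (cbox (a + c) (b + e))"
    using ab by (subst measure_completion) (auto simp: content_cbox inner_add_left less_imp_le add_mono algebra_simps)
  also have "root DIM('a) \<dots> \<le> root DIM('a) (measure lebesgue (msum (cbox a b) (cbox c e)))"
    using sub by (intro real_root_le_mono measure_mono_fmeasurable)
      (auto intro!: lmeasurable_compact compact_msum)
  finally show ?thesis .
qed

text \<open>Hadwiger and Ohmann: cut one family along a hyperplane that separates two of its boxes, and the
  other family along a parallel hyperplane in the same ratio of volumes.\<close>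
lemma brunn_minkowski_boxes:
  fixes F G :: "'a::euclidean_space set set"
  assumes "box_family F" "box_family G"
  shows "root DIM('a) (measure lebesgue (\<Union>F)) + root DIM('a) (measure lebesgue (\<Union>G))
         \<le> root DIM('a) (measure lebesgue (msum (\<Union>F) (\<Union>G)))"
  using assms
proof (induction "card F + card G" arbitrary: F G rule: less_induct)
  case less
  let ?n = "DIM('a)" and ?\<mu> = "measure lebesgue :: 'a set \<Rightarrow> real"
  \<comment> \<open>The cut needs two distinct boxes in \<open>F\<close>. The induction hypothesis
    is carried as an assumption so that \<open>main\<close> can also be applied with the families
    exchanged.\<close>
  have main: "root ?n (?\<mu> (\<Union>F)) + root ?n (?\<mu> (\<Union>G)) \<le> root ?n (?\<mu> (msum (\<Union>F) (\<Union>G)))"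
    if F: "box_family F" and G: "box_family G" and cF: "card F \<noteq> 1"
      and IH: "\<And>F' G'. \<lbrakk>card F' + card G' < card F + card G; box_family F'; box_family G'\<rbrakk>
        \<Longrightarrow> root ?n (?\<mu> (\<Union>F')) + root ?n (?\<mu> (\<Union>G')) \<le> root ?n (?\<mu> (msum (\<Union>F') (\<Union>G')))"
    for F G :: "'a set set"
  proof -
    have "finite F" "F \<noteq> {}" using F by (auto simp: box_family_def)
    then have "\<exists>A B. A \<in> F \<and> B \<in> F \<and> A \<noteq> B"
      using cF by (metis card_1_singleton_iff One_nat_def ex_in_conv is_singletonI' is_singleton_altdef)
    then obtain A B b s where AB: "A \<in> F" "B \<in> F" "b \<in> Basis" "A \<subseteq> {x. x \<bullet> b \<le> s}" "B \<subseteq> {x. x \<bullet> b \<ge> s}"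
      using box_family_separated[OF F] by metis
    define L where "L = (\<lambda>t. {x::'a. x \<bullet> b \<le> t})"
    define U where "U = (\<lambda>t. {x::'a. x \<bullet> b \<ge> t})"
    have cl: "closed (L t)" "closed (U t)" for t
      unfolding L_def U_def using closed_halfspace_component_le closed_halfspace_component_ge by auto
    have bx: "\<exists>a' b'. cbox a c \<inter> L t = cbox a' b'" "\<exists>a' b'. cbox a c \<inter> U t = cbox a' b'" for a c t
      unfolding L_def U_def using interval_split[OF AB(3)] by blast+
    have hyp: "interior (L t \<inter> U t) = {}" for t
    proof -
      have "negligible (L t \<inter> U t)"
        by (rule negligible_subset[OF negligible_standard_hyperplane[OF AB(3), of t]]) (auto simp: L_def U_def)
      then show ?thesis
        by (metis negligible_subset interior_subset open_interior open_not_negligible)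
    qed
    \<comment> \<open>\<open>A\<close> lies below the hyperplane and \<open>B\<close> above it, so
      each half of \<open>F\<close> loses at least one box.\<close>
    have iA: "interior (A \<inter> U s) = {}"
      using AB(4) hyp[of s] interior_mono[of "A \<inter> U s" "L s \<inter> U s"] by (auto simp: L_def)
    have iB: "interior (B \<inter> L s) = {}"
      using AB(5) hyp[of s] interior_mono[of "B \<inter> L s" "L s \<inter> U s"] by (auto simp: U_def)
    note cF' = box_family_compact[OF F] and cG' = box_family_compact[OF G]
    have posK: "?\<mu> (\<Union>F \<inter> H) > 0" if K: "K \<in> F" "K \<subseteq> H" and H: "closed H" for K H
    proof -
      have "box_family {K}" using F K by (auto simp: box_family_def)
      then have "0 < ?\<mu> K" using box_family_pos by fastforce
      also have "?\<mu> K \<le> ?\<mu> (\<Union>F \<inter> H)"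
        using K H cF' F by (intro measure_mono_fmeasurable)
          (auto intro!: lmeasurable_compact compact_Int_closed fmeasurableD simp: box_family_def)
      finally show ?thesis .
    qed
    have pL: "?\<mu> (\<Union>F \<inter> L s) > 0" using posK[OF AB(1) _ cl(1)] AB(4) by (simp add: L_def)
    have pU: "?\<mu> (\<Union>F \<inter> U s) > 0" using posK[OF AB(2) _ cl(2)] AB(5) by (simp add: U_def)
    have sumF: "?\<mu> (\<Union>F) = ?\<mu> (\<Union>F \<inter> L s) + ?\<mu> (\<Union>F \<inter> U s)"
      unfolding L_def U_def by (rule measure_split_halfspace[OF cF' AB(3)])
    define l where "l = ?\<mu> (\<Union>F \<inter> L s) / ?\<mu> (\<Union>F)"
    have l: "0 < l" "l < 1" and l1: "1 - l = ?\<mu> (\<Union>F \<inter> U s) / ?\<mu> (\<Union>F)"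
      using pL pU sumF by (auto simp: l_def field_simps)
    note posG = box_family_pos[OF G] and posF = box_family_pos[OF F]
    obtain t where t: "?\<mu> (\<Union>G \<inter> L t) = l * ?\<mu> (\<Union>G)"
      unfolding L_def using halfspace_with_measure[OF cG' AB(3), of "l * ?\<mu> (\<Union>G)"] l posG by auto
    have sumG: "?\<mu> (\<Union>G) = ?\<mu> (\<Union>G \<inter> L t) + ?\<mu> (\<Union>G \<inter> U t)"
      unfolding L_def U_def by (rule measure_split_halfspace[OF cG' AB(3)])
    then have tU: "?\<mu> (\<Union>G \<inter> U t) = (1 - l) * ?\<mu> (\<Union>G)" using t by (simp add: algebra_simps)
    obtain F1 where F1: "box_family F1" "card F1 < card F" "\<Union>F1 \<subseteq> \<Union>F \<inter> L s" "?\<mu> (\<Union>F1) = ?\<mu> (\<Union>F \<inter> L s)"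
      using box_family_restrict[OF F bx(1) cl(1) pL] AB(2) iB by metis
    obtain F2 where F2: "box_family F2" "card F2 < card F" "\<Union>F2 \<subseteq> \<Union>F \<inter> U s" "?\<mu> (\<Union>F2) = ?\<mu> (\<Union>F \<inter> U s)"
      using box_family_restrict[OF F bx(2) cl(2) pU] AB(1) iA by metis
    have pLG: "?\<mu> (\<Union>G \<inter> L t) > 0" and pUG: "?\<mu> (\<Union>G \<inter> U t) > 0"
      using t tU l posG by auto
    obtain G1 where G1: "box_family G1" "card G1 \<le> card G" "\<Union>G1 \<subseteq> \<Union>G \<inter> L t" "?\<mu> (\<Union>G1) = ?\<mu> (\<Union>G \<inter> L t)"
      using box_family_restrict[OF G bx(1) cl(1) pLG] by metis
    obtain G2 where G2: "box_family G2" "card G2 \<le> card G" "\<Union>G2 \<subseteq> \<Union>G \<inter> U t" "?\<mu> (\<Union>G2) = ?\<mu> (\<Union>G \<inter> U t)"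
      using box_family_restrict[OF G bx(2) cl(2) pUG] by metis
    define R where "R = root ?n (?\<mu> (\<Union>F)) + root ?n (?\<mu> (\<Union>G))"
    have R: "R \<ge> 0" unfolding R_def by (intro add_nonneg_nonneg real_root_ge_zero) auto
    \<comment> \<open>Both volumes are scaled by the same factor \<open>k\<close>, so
      \<open>root ?n k\<close> factors out of the induction hypothesis, and the half contributes the
      fraction \<open>k\<close> of \<open>R ^ ?n\<close>.\<close>
    have part: "?\<mu> (msum (\<Union>F') (\<Union>G')) \<ge> k * R ^ ?n"
      if F': "box_family F'" "card F' < card F" "?\<mu> (\<Union>F') = k * ?\<mu> (\<Union>F)"
        and G': "box_family G'" "card G' \<le> card G" "?\<mu> (\<Union>G') = k * ?\<mu> (\<Union>G)" and k: "k > 0" for F' G' k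
    proof -
      have "root ?n k * R = root ?n (?\<mu> (\<Union>F')) + root ?n (?\<mu> (\<Union>G'))"
        by (simp add: F' G' R_def real_root_mult algebra_simps)
      also have "\<dots> \<le> root ?n (?\<mu> (msum (\<Union>F') (\<Union>G')))"
        using F' G' by (intro IH) auto
      finally have "(root ?n k * R) ^ ?n \<le> root ?n (?\<mu> (msum (\<Union>F') (\<Union>G'))) ^ ?n"
        using k R by (intro power_mono) auto
      then show ?thesis using k by (simp add: power_mult_distrib)
    qed
    have p1: "?\<mu> (msum (\<Union>F1) (\<Union>G1)) \<ge> l * R ^ ?n"
      using F1 G1 t l posF by (intro part) (auto simp: l_def)
    have p2: "?\<mu> (msum (\<Union>F2) (\<Union>G2)) \<ge> (1 - l) * R ^ ?n"
      using F2 G2 tU l l1 posF by (intro part) auto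
    let ?M = "msum (\<Union>F) (\<Union>G)"
    have cM: "compact ?M" by (rule compact_msum[OF cF' cG'])
    \<comment> \<open>The sums of the lower halves and of the upper halves lie on opposite sides of
      the hyperplane at height \<open>s + t\<close>, so their volumes add up.\<close>
    have s1: "msum (\<Union>F1) (\<Union>G1) \<subseteq> ?M \<inter> {x. x \<bullet> b \<le> s + t}"
      using F1(3) G1(3) unfolding msum_def L_def by (fastforce simp: inner_add_left intro: add_mono)
    have s2: "msum (\<Union>F2) (\<Union>G2) \<subseteq> ?M \<inter> {x. x \<bullet> b \<ge> s + t}"
      using F2(3) G2(3) unfolding msum_def U_def by (fastforce simp: inner_add_left intro: add_mono)
    have m1: "?\<mu> (msum (\<Union>F1) (\<Union>G1)) \<le> ?\<mu> (?M \<inter> {x. x \<bullet> b \<le> s + t})"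
      using s1 cM AB(3) F1(1) G1(1) F G
      by (intro measure_mono_fmeasurable fmeasurableD lmeasurable_compact compact_msum box_family_compact
          compact_Int_closed closed_halfspace_component_le)
    have m2: "?\<mu> (msum (\<Union>F2) (\<Union>G2)) \<le> ?\<mu> (?M \<inter> {x. x \<bullet> b \<ge> s + t})"
      using s2 cM AB(3) F2(1) G2(1) F G
      by (intro measure_mono_fmeasurable fmeasurableD lmeasurable_compact compact_msum box_family_compact
          compact_Int_closed closed_halfspace_component_ge)
    have "R ^ ?n \<le> ?\<mu> ?M"
      using p1 p2 m1 m2 measure_split_halfspace[OF cM AB(3), of "s + t"] by (simp add: algebra_simps)
    then have "root ?n (R ^ ?n) \<le> root ?n (?\<mu> ?M)"
      by (intro real_root_le_mono) auto
    then show ?thesis using R by (simp add: real_root_power_cancel R_def)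
  qed
  consider "card F \<noteq> 1" | "card G \<noteq> 1" | "card F = 1" "card G = 1" by blast
  then show ?case
  proof cases
    case 1
    show ?thesis
      by (rule main[OF less.prems 1]) (use less.hyps in blast)
  next
    case 2
    have "root ?n (?\<mu> (\<Union>G)) + root ?n (?\<mu> (\<Union>F)) \<le> root ?n (?\<mu> (msum (\<Union>G) (\<Union>F)))"
      by (rule main[OF less.prems(2,1) 2]) (use less.hyps in \<open>simp add: add.commute\<close>)
    then show ?thesis by (simp add: add.commute msum_commute)
  next
    case 3
    then obtain A B where AB: "F = {A}" "G = {B}" by (metis card_1_singletonE)
    then show ?thesis
      using less.prems by (auto simp: box_family_def intro!: box_family_singletons)
  qed
qed

text \<open>An open set is a countable union of closed boxes. A finite part of the union already
  exceeds \<open>l\<close> in volume, and a division of this part into non-overlapping boxes,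
  without the degenerate ones, is the required family.\<close>

lemma box_family_inner_approx:
  fixes S :: "'a::euclidean_space set"
  assumes "open S" "S \<in> lmeasurable" "l < measure lebesgue S" "0 \<le> l"
  obtains F where "box_family F" "\<Union>F \<subseteq> S" "l < measure lebesgue (\<Union>F)"
proof -
  obtain D where D: "countable D" "D \<subseteq> Pow S" "\<And>X. X \<in> D \<Longrightarrow> \<exists>a b. X = cbox a b" "\<Union>D = S"
    using open_countable_Union_open_cbox[OF assms(1)] by metis
  have "S \<noteq> {}" using assms by auto
  then have "D \<noteq> {}" using D(4) by auto
  then obtain X :: "nat \<Rightarrow> 'a set" where X: "range X = D" using D(1) range_from_nat_into by metis
  have XD: "X i \<in> D" for i using X by blast
  let ?U = "\<lambda>n. \<Union>i\<le>n. X i"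
  have cX: "compact (X i)" for i using D(3)[OF XD] compact_cbox by metis
  have "(\<lambda>n. measure lebesgue (?U n)) \<longlonglongrightarrow> measure lebesgue (\<Union>n. ?U n)"
  proof (rule Lim_measure_incseq)
    show "range ?U \<subseteq> sets lebesgue"
      using cX by (auto intro!: sets.finite_UN lmeasurable_compact fmeasurableD)
    show "incseq ?U" by (force simp: incseq_def)
    have "(\<Union>n. ?U n) = S" using D(4) X by blast
    then show "emeasure lebesgue (\<Union>n. ?U n) \<noteq> \<infinity>" using assms(2) by (auto simp: fmeasurable_def)
  qed
  also have "(\<Union>n. ?U n) = S" using D(4) X by blast
  finally have "(\<lambda>n. measure lebesgue (?U n)) \<longlonglongrightarrow> measure lebesgue S" .
  from order_tendstoD(1)[OF this assms(3)] obtain n where n: "l < measure lebesgue (?U n)"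
    unfolding eventually_sequentially by blast
  have "\<exists>p. p division_of \<Union>(X ` {..n})"
  proof (rule elementary_unions_intervals)
    show "finite (X ` {..n})" by simp
    show "\<exists>a b. K = cbox a b" if "K \<in> X ` {..n}" for K using that D(3) XD by blast
  qed blast
  then obtain p where p: "p division_of (\<Union>i\<le>n. X i)" by auto
  define F where "F = {K \<in> p. interior K \<noteq> {}}"
  have finp: "finite p" using p by (rule division_of_finite)
  have "negligible (\<Union>{K \<in> p. interior K = {}})"
  proof (rule negligible_Union)
    show "finite {K \<in> p. interior K = {}}" using finp by simp
    fix K assume "K \<in> {K \<in> p. interior K = {}}"
    then obtain a b where "K = cbox a b" "interior K = {}" using division_ofD(4)[OF p] by blast
    then show "negligible K" by (simp add: negligible_interval)
  qed
  then have "negligible (sym_diff (\<Union>F) (?U n))"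
  proof (rule negligible_subset)
    have "\<Union>p = ?U n" using division_ofD(6)[OF p] by simp
    then show "sym_diff (\<Union>F) (?U n) \<subseteq> \<Union>{K \<in> p. interior K = {}}" unfolding F_def by blast
  qed
  moreover have "?U n \<in> lmeasurable" using cX by (intro lmeasurable_compact) (auto intro: compact_UN)
  ultimately have meq: "measure lebesgue (?U n) = measure lebesgue (\<Union>F)"
    by (intro measure_negligible_symdiff[symmetric]) (auto simp: Un_commute)
  have sub: "\<Union>F \<subseteq> S"
    using division_ofD(6)[OF p] D(2) XD by (fastforce simp: F_def)
  have "F \<noteq> {}" using n meq assms(4) by auto
  then have "box_family F"
    using finp division_ofD(4,5)[OF p] by (auto simp: box_family_def F_def pairwise_def)
  then show ?thesis using that sub n meq by simp
qed

lemma brunn_minkowski_open: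
  fixes A B :: "'a::euclidean_space set"
  assumes A: "open A" "bounded A" "A \<noteq> {}" and B: "open B" "bounded B" "B \<noteq> {}"
  shows "root DIM('a) (measure lebesgue A) + root DIM('a) (measure lebesgue B)
         \<le> root DIM('a) (measure lebesgue (msum A B))"
proof -
  let ?n = "DIM('a)" and ?\<mu> = "measure lebesgue :: 'a set \<Rightarrow> real"
  have lm: "A \<in> lmeasurable" "B \<in> lmeasurable" using A B by (auto intro: lmeasurable_open)
  have "msum A B \<in> lmeasurable"
    unfolding msum_UN using A B by (intro lmeasurable_open bounded_sums open_sums) auto
  note M = this
  have "0 < ?\<mu> A" "0 < ?\<mu> B"
    using lm open_not_negligible[OF A(1,3)] open_not_negligible[OF B(1,3)]
    by (metis negligible_iff_measure measure_nonneg less_le)+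
  note pos = this
  have *: "root ?n a + root ?n b \<le> root ?n (?\<mu> (msum A B))"
    if ab: "0 \<le> a" "a < ?\<mu> A" "0 \<le> b" "b < ?\<mu> B" for a b
  proof -
    obtain F where F: "box_family F" "\<Union>F \<subseteq> A" "a < ?\<mu> (\<Union>F)"
      using box_family_inner_approx[OF A(1) lm(1) ab(2,1)] by blast
    obtain G where G: "box_family G" "\<Union>G \<subseteq> B" "b < ?\<mu> (\<Union>G)"
      using box_family_inner_approx[OF B(1) lm(2) ab(4,3)] by blast
    have "root ?n a + root ?n b \<le> root ?n (?\<mu> (\<Union>F)) + root ?n (?\<mu> (\<Union>G))"
      using F G by (intro add_mono real_root_le_mono DIM_positive less_imp_le)
    also have "\<dots> \<le> root ?n (?\<mu> (msum (\<Union>F) (\<Union>G)))"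
      by (rule brunn_minkowski_boxes[OF F(1) G(1)])
    also have "\<dots> \<le> root ?n (?\<mu> (msum A B))"
    proof (intro real_root_le_mono measure_mono_fmeasurable msum_mono)
      show "msum (\<Union>F) (\<Union>G) \<in> sets lebesgue"
        using F G by (intro fmeasurableD lmeasurable_compact compact_msum box_family_compact)
    qed (use F G M in auto)
    finally show ?thesis .
  qed
  \<comment> \<open>The approximation by boxes requires volumes strictly below those of
    \<open>A\<close> and \<open>B\<close>; the factors \<open>1 - 1 / Suc k\<close> approach them
    from below.\<close>
  have lim: "(\<lambda>k. root ?n (?\<mu> A * (1 - 1 / Suc k)) + root ?n (?\<mu> B * (1 - 1 / Suc k)))
     \<longlonglongrightarrow> root ?n (?\<mu> A * (1 - 0)) + root ?n (?\<mu> B * (1 - 0))"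
    using LIMSEQ_inverse_real_of_nat by (intro tendsto_intros) (auto simp: inverse_eq_divide)
  show ?thesis
    by (rule LIMSEQ_le_const2[OF lim[simplified]]) (use pos * in \<open>auto intro!: exI[of _ 0] mult_nonneg_nonneg simp: field_simps\<close>)
qed

section \<open>The De Giorgi perimeter\<close>

lemma C1_compact_supportE:
  fixes T :: "'a::euclidean_space \<Rightarrow> 'a"
  assumes "C1_compact_support T"
  obtains T' R where "\<And>x. (T has_derivative blinfun_apply (T' x)) (at x)" "continuous_on UNIV T'"
    "\<And>x. norm x > R \<Longrightarrow> T x = 0" "\<And>x. norm x > R \<Longrightarrow> T' x = 0" "R > 0"
    "\<And>x. divergence T x = (\<Sum>b\<in>Basis. blinfun_apply (T' x) b \<bullet> b)"
proof -
  obtain T' :: "'a \<Rightarrow> 'a \<Rightarrow>\<^sub>L 'a" where T': "\<And>x. (T has_derivative blinfun_apply (T' x)) (at x)" "continuous_on UNIV T'"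
    and c: "compact (closure {x. T x \<noteq> 0})"
    using assms unfolding C1_compact_support_def by blast
  have "bounded {x. T x \<noteq> 0}" using c compact_closure by blast
  then obtain R where R: "R > 0" "\<And>x. T x \<noteq> 0 \<Longrightarrow> norm x \<le> R" by (auto simp: bounded_pos)
  have z: "T x = 0" if "norm x > R" for x using R(2)[of x] that by force
  have z': "T' x = 0" if "norm x > R" for x
  proof -
    have o: "open (- cball (0::'a) R)" by auto
    have "((\<lambda>_. 0) has_derivative blinfun_apply (T' x)) (at x)"
      by (rule has_derivative_transform_within_open[OF T'(1) o]) (use that z in auto)
    then have "blinfun_apply (T' x) = (\<lambda>_. 0)" using has_derivative_const has_derivative_unique by blast
    then show ?thesis by (intro blinfun_eqI) simp
  qed
  have "divergence T x = (\<Sum>b\<in>Basis. blinfun_apply (T' x) b \<bullet> b)" for x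
    unfolding divergence_def using frechet_derivative_at[OF T'(1)[of x]] by simp
  then show ?thesis using that[of T' R] T' z z' R(1) by blast
qed

lemma C1_compact_support_continuous: "C1_compact_support T \<Longrightarrow> continuous_on UNIV T"
  by (rule C1_compact_supportE) (auto intro!: continuous_at_imp_continuous_on has_derivative_continuous)

lemma divergence_bounds:
  fixes T :: "'a::euclidean_space \<Rightarrow> 'a"
  assumes "C1_compact_support T"
  obtains R M where "R > 0" "M \<ge> 0" "continuous_on UNIV (divergence T)"
    "\<And>x. norm x > R \<Longrightarrow> divergence T x = 0" "\<And>x. norm x > R \<Longrightarrow> T x = 0" "\<And>x. \<bar>divergence T x\<bar> \<le> M"
proof -
  obtain T' R where T: "\<And>x. (T has_derivative blinfun_apply (T' x)) (at x)" "continuous_on UNIV T'"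
    "\<And>x. norm x > R \<Longrightarrow> T x = 0" "\<And>x. norm x > R \<Longrightarrow> T' x = 0" "R > 0"
    "\<And>x. divergence T x = (\<Sum>b\<in>Basis. blinfun_apply (T' x) b \<bullet> b)"
    by (rule C1_compact_supportE[OF assms]) (rule that)
  have cont: "continuous_on UNIV (divergence T)"
    unfolding T(6)[abs_def] by (intro continuous_intros T(2))
  have z: "divergence T x = 0" if "norm x > R" for x using T(4,6) that by simp
  have "compact (divergence T ` cball 0 R)"
    by (intro compact_continuous_image continuous_on_subset[OF cont]) auto
  then obtain M where M: "\<And>x. x \<in> cball 0 R \<Longrightarrow> norm (divergence T x) \<le> M"
    using compact_imp_bounded bounded_iff by (metis imageI)
  have "0 \<le> M" using order_trans[OF norm_ge_zero M[of 0]] T(5) by simp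
  moreover have "\<bar>divergence T x\<bar> \<le> M" for x
    using M[of x] z[of x] \<open>0 \<le> M\<close> by (cases "norm x \<le> R") auto
  ultimately show ?thesis using that[of R M] T(3,5) cont z by blast
qed

lemma C1_compact_support_lipschitz:
  fixes T :: "'a::euclidean_space \<Rightarrow> 'a"
  assumes "C1_compact_support T"
  obtains L where "L \<ge> 0" "\<And>x y. norm (T x - T y) \<le> L * norm (x - y)"
proof -
  obtain T' R where T: "\<And>x. (T has_derivative blinfun_apply (T' x)) (at x)" "continuous_on UNIV T'"
    "\<And>x. norm x > R \<Longrightarrow> T x = 0" "\<And>x. norm x > R \<Longrightarrow> T' x = 0" "R > 0"
    "\<And>x. divergence T x = (\<Sum>b\<in>Basis. blinfun_apply (T' x) b \<bullet> b)"
    by (rule C1_compact_supportE[OF assms]) (rule that)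
  have "compact (T' ` cball 0 R)"
    by (intro compact_continuous_image continuous_on_subset[OF T(2)]) auto
  then obtain L where L: "\<And>x. x \<in> cball 0 R \<Longrightarrow> norm (T' x) \<le> L"
    using compact_imp_bounded bounded_iff by (metis imageI)
  have L0: "0 \<le> L" using order_trans[OF norm_ge_zero L[of 0]] T(5) by simp
  have "norm (T' x) \<le> L" for x
    using L[of x] T(4)[of x] L0 by (cases "norm x \<le> R") auto
  then have "norm (T x - T y) \<le> L * norm (x - y)" for x y
    using T(1) by (intro differentiable_bound[of UNIV T "\<lambda>x. blinfun_apply (T' x)"])
      (auto simp: norm_blinfun.rep_eq intro: has_derivative_at_withinI)
  then show ?thesis using that L0 by blast
qed

lemma integrable_bounded_support_vec:
  fixes f :: "'a::euclidean_space \<Rightarrow> 'b::euclidean_space"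
  assumes "f \<in> borel_measurable borel" "\<And>x. norm x > R \<Longrightarrow> f x = 0" "\<And>x. norm (f x) \<le> M"
  shows "integrable lborel f"
proof (rule Bochner_Integration.integrable_bound)
  show "integrable lborel (\<lambda>x. M * indicator (cball (0::'a) R) x)"
    using emeasure_lborel_cball_finite[of "0::'a" R] by (intro integrable_mult_right integrable_real_indicator) auto
  show "AE x in lborel. norm (f x) \<le> norm (M * indicator (cball 0 R) x)"
  proof (rule AE_I2)
    fix x
    show "norm (f x) \<le> norm (M * indicator (cball 0 R) x)"
      using assms(2)[of x] assms(3)[of x] by (cases "norm x \<le> R") (auto intro: order_trans[OF _ abs_ge_self])
  qed
qed (use assms(1) in simp)

lemma integrable_bounded_support:
  fixes f :: "'a::euclidean_space \<Rightarrow> real"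
  assumes "f \<in> borel_measurable borel" "\<And>x. norm x > R \<Longrightarrow> f x = 0" "\<And>x. \<bar>f x\<bar> \<le> M"
  shows "integrable lborel f"
  using assms by (intro integrable_bounded_support_vec[of f R M]) auto

lemma integrable_continuous_support:
  fixes f :: "'a::euclidean_space \<Rightarrow> real"
  assumes "continuous_on UNIV f" "\<And>x. norm x > R \<Longrightarrow> f x = 0"
  shows "integrable lborel f"
proof -
  have "compact (f ` cball 0 (max R 0))"
    by (intro compact_continuous_image continuous_on_subset[OF assms(1)]) auto
  then obtain M where M: "\<And>x. x \<in> cball 0 (max R 0) \<Longrightarrow> norm (f x) \<le> M"
    using compact_imp_bounded bounded_iff by (metis imageI)
  have "0 \<le> M" using order_trans[OF norm_ge_zero M[of 0]] by simp
  show ?thesis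
  proof (rule integrable_bounded_support[of f R M])
    show "\<bar>f x\<bar> \<le> M" for x using M[of x] assms(2)[of x] \<open>0 \<le> M\<close> by (cases "norm x \<le> R") auto
  qed (use assms borel_measurable_continuous_onI in auto)
qed

lemma integral_translation:
  fixes f :: "'a::euclidean_space \<Rightarrow> real"
  assumes "f \<in> borel_measurable borel"
  shows "(\<integral>x. f (a + x) \<partial>lborel) = (\<integral>x. f x \<partial>lborel)"
proof -
  have "(\<integral>x. f x \<partial>lborel) = (\<integral>x. f x \<partial>distr lborel borel ((+) a))" by (simp add: lborel_distr_plus)
  also have "\<dots> = (\<integral>x. f (a + x) \<partial>lborel)" using assms by (intro integral_distr) auto
  finally show ?thesis by simp
qed

lemma set_integral_divergence:
  assumes "E \<in> sets borel" "C1_compact_support T"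
  shows "set_lebesgue_integral lebesgue E (divergence T) = (\<integral>x. indicator E x * divergence T x \<partial>lborel)"
proof -
  obtain R M where "continuous_on UNIV (divergence T)" using divergence_bounds[OF assms(2)] by blast
  then have [measurable]: "divergence T \<in> borel_measurable borel" by (rule borel_measurable_continuous_onI)
  have "(\<lambda>x. indicator E x * divergence T x) \<in> borel_measurable lborel" using assms(1) by simp
  then show ?thesis unfolding set_lebesgue_integral_def by (simp add: integral_completion)
qed

section \<open>Bounding the perimeter through test fields\<close>

lemma perimeter_upper:
  assumes "E \<in> sets borel"
    and "\<And>T. C1_compact_support T \<Longrightarrow> (\<And>x. norm (T x) \<le> 1) \<Longrightarrow> (\<integral>x. indicator E x * divergence T x \<partial>lborel) \<le> c"
  shows "perimeter E \<le> ennreal c"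
  unfolding perimeter_def using assms by (intro SUP_least ennreal_leI) (auto simp: set_integral_divergence)

lemma perimeter_lower:
  assumes "E \<in> sets borel" "C1_compact_support T" "\<And>x. norm (T x) \<le> 1"
  shows "ennreal (\<integral>x. indicator E x * divergence T x \<partial>lborel) \<le> perimeter E"
  unfolding perimeter_def set_integral_divergence[OF assms(1,2), symmetric]
  using assms by (intro SUP_upper) auto

text \<open>Test fields are translated back. An inequality suffices: translating the members of a
  minimizing sequence must not raise their energy.\<close>

lemma perimeter_translation_le:
  fixes E :: "'a::euclidean_space set"
  assumes E: "E \<in> sets borel"
  shows "perimeter ((+) a ` E) \<le> perimeter E"
proof -
  have aE: "(+) a ` E = (\<lambda>x. x - a) -` E" by (auto simp: image_iff algebra_simps) (metis add_diff_cancel_left' diff_add_cancel add.commute)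
  have m: "(\<lambda>x. x - a) -` E \<in> sets borel"
    using measurable_sets_borel[of "\<lambda>x. x - a" borel E] E by simp
  have "ennreal (\<integral>x. indicator ((+) a ` E) x * divergence T x \<partial>lborel) \<le> perimeter E"
    if T: "C1_compact_support T" "\<And>x. norm (T x) \<le> 1" for T
  proof -
    obtain T' R where T': "\<And>x. (T has_derivative blinfun_apply (T' x)) (at x)" "continuous_on UNIV T'"
      "\<And>x. norm x > R \<Longrightarrow> T x = 0" "\<And>x. norm x > R \<Longrightarrow> T' x = 0" "R > 0"
      "\<And>x. divergence T x = (\<Sum>b\<in>Basis. blinfun_apply (T' x) b \<bullet> b)"
      by (rule C1_compact_supportE[OF T(1)]) (rule that)
    define S where "S = (\<lambda>x. T (a + x))"
    have S': "(S has_derivative blinfun_apply (T' (a + x))) (at x)" for x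
    proof -
      have "((\<lambda>x. a + x) has_derivative (\<lambda>x. x)) (at x)" by (auto intro!: derivative_eq_intros)
      from has_derivative_compose[OF this T'(1)] show ?thesis by (simp add: S_def)
    qed
    have "bounded {x. S x \<noteq> 0}"
    proof (rule boundedI)
      fix x assume "x \<in> {x. S x \<noteq> 0}"
      then have "norm (a + x) \<le> R" using T'(3)[of "a + x"] by (force simp: S_def)
      then show "norm x \<le> R + norm a" using norm_triangle_ineq4[of "a + x" a] by simp
    qed
    moreover have "continuous_on UNIV (\<lambda>x. T' (a + x))"
      by (intro continuous_on_compose2[OF T'(2)] continuous_intros) auto
    ultimately have S: "C1_compact_support S"
      unfolding C1_compact_support_def compact_closure using S' by (intro conjI exI[of _ "\<lambda>x. T' (a + x)"]) auto
    have dS: "divergence S x = divergence T (a + x)" for x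
    proof -
      have "divergence S x = (\<Sum>b\<in>Basis. blinfun_apply (T' (a + x)) b \<bullet> b)"
        unfolding divergence_def using frechet_derivative_at[OF S'[of x]] by simp
      then show ?thesis by (simp add: T'(6))
    qed
    have dm: "divergence T \<in> borel_measurable borel"
      by (rule divergence_bounds[OF T(1)]) (rule borel_measurable_continuous_onI)
    have "(\<integral>x. indicator ((+) a ` E) x * divergence T x \<partial>lborel) = (\<integral>x. indicator ((+) a ` E) (a + x) * divergence T (a + x) \<partial>lborel)"
      using m dm by (intro integral_translation[symmetric]) (simp add: aE)
    also have "\<dots> = (\<integral>x. indicator E x * divergence S x \<partial>lborel)"
      unfolding dS by (intro Bochner_Integration.integral_cong refl) (auto simp: indicator_def image_iff)
    also have "ennreal \<dots> \<le> perimeter E"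
      using E S by (rule perimeter_lower) (simp add: S_def T(2))
    finally show ?thesis .
  qed
  then show ?thesis
    unfolding perimeter_def[of "(+) a ` E"] using m by (intro SUP_least) (auto simp: set_integral_divergence aE)
qed

text \<open>The sequential form of the directional derivative, as dominated convergence requires
  it.\<close>

lemma directional_quotient:
  fixes f :: "'a::real_normed_vector \<Rightarrow> real"
  assumes "(f has_derivative f') (at x)" "h \<longlonglongrightarrow> 0" "\<And>n. h n \<noteq> (0::real)"
  shows "(\<lambda>n. (f (x + h n *\<^sub>R v) - f x) / h n) \<longlonglongrightarrow> f' v"
proof -
  have l: "((\<lambda>t::real. x + t *\<^sub>R v) has_derivative (\<lambda>t. t *\<^sub>R v)) (at 0)" by (auto intro!: derivative_eq_intros)
  have "((\<lambda>t::real. f (x + t *\<^sub>R v)) has_derivative (\<lambda>t. f' (t *\<^sub>R v))) (at 0)"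
    by (rule has_derivative_compose[OF l]) (simp add: assms(1))
  moreover have "(\<lambda>t. f' (t *\<^sub>R v)) = (*) (f' v)"
    using linear_cmul[OF has_derivative_linear[OF assms(1)], of _ v] by (auto simp: mult.commute)
  ultimately have "DERIV (\<lambda>t. f (x + t *\<^sub>R v)) 0 :> f' v" by (simp add: has_field_derivative_def)
  then have "((\<lambda>t. (f (x + t *\<^sub>R v) - f x) / t) \<longlongrightarrow> f' v) (at 0)" by (simp add: DERIV_def)
  moreover have "filterlim h (at 0) sequentially"
    using assms(2,3) by (simp add: filterlim_at)
  ultimately show ?thesis by (rule filterlim_compose)
qed

text \<open>Integration by parts via difference quotients, so that the scalar factor only needs to be
  Lipschitz.\<close>
lemma integral_divergence_by_parts:
  fixes T :: "'a::euclidean_space \<Rightarrow> 'a" and \<phi> :: "'a \<Rightarrow> real"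
  assumes T: "C1_compact_support T"
    and lip: "\<And>x y. \<bar>\<phi> x - \<phi> y\<bar> \<le> K * norm (x - y)"
    and supp: "\<And>x. norm x > R \<Longrightarrow> \<phi> x = 0"
    and g: "AE x in lborel. (\<phi> has_derivative (\<lambda>v. g x \<bullet> v)) (at x)"
    and gm: "g \<in> borel_measurable borel"
  shows "(\<integral>x. \<phi> x * divergence T x \<partial>lborel) = - (\<integral>x. T x \<bullet> g x \<partial>lborel)"
proof -
  obtain T' R1 where T': "\<And>x. (T has_derivative blinfun_apply (T' x)) (at x)" "continuous_on UNIV T'"
    "\<And>x. norm x > R1 \<Longrightarrow> T x = 0" "\<And>x. norm x > R1 \<Longrightarrow> T' x = 0" "R1 > 0"
    "\<And>x. divergence T x = (\<Sum>b\<in>Basis. blinfun_apply (T' x) b \<bullet> b)"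
    by (rule C1_compact_supportE[OF T]) (rule that)
  obtain L where L: "L \<ge> 0" "\<And>x y. norm (T x - T y) \<le> L * norm (x - y)"
    by (rule C1_compact_support_lipschitz[OF T]) (rule that)
  have c\<phi>: "continuous_on UNIV \<phi>"
  proof (rule lipschitz_on_continuous_on)
    show "(max K 0)-lipschitz_on UNIV \<phi>"
    proof (rule lipschitz_onI)
      fix x y
      have "\<bar>\<phi> x - \<phi> y\<bar> \<le> K * norm (x - y)" by (rule lip)
      also have "\<dots> \<le> max K 0 * norm (x - y)" by (intro mult_right_mono) auto
      finally show "dist (\<phi> x) (\<phi> y) \<le> max K 0 * dist x y" by (simp add: dist_real_def dist_norm)
    qed simp
  qed
  have K: "K \<ge> 0"
  proof -
    obtain b :: 'a where b: "b \<in> Basis" using nonempty_Basis by blast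
    have "0 \<le> K * norm (b - 0)" using lip[of b 0] by (meson abs_ge_zero order_trans)
    then show ?thesis using b by simp
  qed
  have cT: "continuous_on UNIV T" by (rule C1_compact_support_continuous[OF T])
  have cTb: "continuous_on UNIV (\<lambda>x. T x \<bullet> b)" for b using cT by (intro continuous_intros)
  have cTs: "continuous_on UNIV (\<lambda>x. T (x + w))" for w
    using cT by (rule continuous_on_compose2) (auto intro: continuous_intros)
  have cs: "continuous_on UNIV (\<lambda>x. f (x + w))" if "continuous_on UNIV f" for f :: "'a \<Rightarrow> real" and w
    using that by (rule continuous_on_compose2) (auto intro: continuous_intros)
  have part: "(\<integral>x. \<phi> x * (blinfun_apply (T' x) b \<bullet> b) \<partial>lborel) = - (\<integral>x. (T x \<bullet> b) * (g x \<bullet> b) \<partial>lborel)"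
    and int: "integrable lborel (\<lambda>x. \<phi> x * (blinfun_apply (T' x) b \<bullet> b))" "integrable lborel (\<lambda>x. (T x \<bullet> b) * (g x \<bullet> b))"
    if b: "b \<in> Basis" for b
  proof -
    define h where "h = (\<lambda>n. inverse (real (Suc n)))"
    have h0: "h \<longlonglongrightarrow> 0" unfolding h_def by (rule LIMSEQ_inverse_real_of_nat)
    have h: "h n > 0" "h n \<le> 1" for n by (auto simp: h_def field_simps)
    have h0': "(\<lambda>n. - h n) \<longlonglongrightarrow> 0" using tendsto_minus[OF h0] by simp
    define A where "A = (\<lambda>n x. \<phi> x * ((T (x + h n *\<^sub>R b) \<bullet> b - T x \<bullet> b) / h n))"
    define B where "B = (\<lambda>n x. (T x \<bullet> b) * ((\<phi> (x - h n *\<^sub>R b) - \<phi> x) / h n))"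
    have nb: "norm b = 1" using b by simp
    \<comment> \<open>A discrete integration by parts: translation invariance of the Lebesgue
      measure moves the shift from \<open>T\<close> to \<open>\<phi>\<close>, in the opposite
      direction.\<close>
    have AB: "(\<integral>x. A n x \<partial>lborel) = (\<integral>x. B n x \<partial>lborel)" for n
    proof -
      let ?w = "h n *\<^sub>R b"
      define u where "u = (\<lambda>x. \<phi> (x - ?w) * (T x \<bullet> b))"
      have c1: "continuous_on UNIV u"
        unfolding u_def using cs[OF c\<phi>, of "- ?w"] cT by (auto intro!: continuous_intros)
      have c2: "continuous_on UNIV (\<lambda>x. \<phi> x * (T (x + ?w) \<bullet> b))"
        using cTs[of "?w"] c\<phi> by (auto intro!: continuous_intros)
      have c3: "continuous_on UNIV (\<lambda>x. \<phi> x * (T x \<bullet> b))"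
        using cT c\<phi> by (auto intro!: continuous_intros)
      have i1: "integrable lborel u"
        by (rule integrable_continuous_support[OF c1, of R1]) (simp add: u_def T'(3))
      have i2: "integrable lborel (\<lambda>x. \<phi> x * (T (x + ?w) \<bullet> b))"
        by (rule integrable_continuous_support[OF c2, of R]) (simp add: supp)
      have i3: "integrable lborel (\<lambda>x. \<phi> x * (T x \<bullet> b))"
        by (rule integrable_continuous_support[OF c3, of R]) (simp add: supp)
      have "(\<integral>x. \<phi> x * (T (x + ?w) \<bullet> b) \<partial>lborel) = (\<integral>x. u (?w + x) \<partial>lborel)"
        by (simp add: u_def add.commute)
      also have "\<dots> = (\<integral>x. u x \<partial>lborel)" by (rule integral_translation[OF borel_measurable_continuous_onI[OF c1]])
      finally have e: "(\<integral>x. \<phi> x * (T (x + ?w) \<bullet> b) \<partial>lborel) = (\<integral>x. u x \<partial>lborel)" .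
      have "(\<integral>x. A n x \<partial>lborel) = (\<integral>x. (\<phi> x * (T (x + ?w) \<bullet> b) - \<phi> x * (T x \<bullet> b)) / h n \<partial>lborel)"
        unfolding A_def by (simp add: algebra_simps)
      also have "\<dots> = ((\<integral>x. u x \<partial>lborel) - (\<integral>x. \<phi> x * (T x \<bullet> b) \<partial>lborel)) / h n"
        using i2 i3 by (simp add: e)
      also have "\<dots> = (\<integral>x. (u x - \<phi> x * (T x \<bullet> b)) / h n \<partial>lborel)" using i1 i3 by simp
      also have "\<dots> = (\<integral>x. B n x \<partial>lborel)" unfolding B_def u_def by (simp add: algebra_simps)
      finally show ?thesis .
    qed
    have cA: "continuous_on UNIV (A n)" for n
      unfolding A_def using cTs[of "h n *\<^sub>R b"] c\<phi> cT h(1)[of n] by (auto intro!: continuous_intros)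
    have cB: "continuous_on UNIV (B n)" for n
      unfolding B_def using cs[OF c\<phi>, of "- (h n *\<^sub>R b)"] c\<phi> cT h(1)[of n] by (auto intro!: continuous_intros)
    have cd: "continuous_on UNIV (\<lambda>x. \<phi> x * (blinfun_apply (T' x) b \<bullet> b))"
      using T'(2) c\<phi> by (auto intro!: continuous_intros)
    show int1: "integrable lborel (\<lambda>x. \<phi> x * (blinfun_apply (T' x) b \<bullet> b))"
      by (rule integrable_continuous_support[OF cd, of R]) (simp add: supp)
    have cdom: "continuous_on UNIV (\<lambda>x. \<bar>\<phi> x\<bar> * L)" "continuous_on UNIV (\<lambda>x. \<bar>T x \<bullet> b\<bar> * K)"
      using c\<phi> cT by (auto intro!: continuous_intros)
    have dom: "integrable lborel (\<lambda>x. \<bar>\<phi> x\<bar> * L)" "integrable lborel (\<lambda>x. \<bar>T x \<bullet> b\<bar> * K)"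
      using integrable_continuous_support[OF cdom(1), of R] integrable_continuous_support[OF cdom(2), of R1]
      by (simp_all add: supp T'(3))
    have limA: "(\<lambda>n. \<integral>x. A n x \<partial>lborel) \<longlonglongrightarrow> (\<integral>x. \<phi> x * (blinfun_apply (T' x) b \<bullet> b) \<partial>lborel)"
    proof (rule integral_dominated_convergence[OF _ _ dom(1)])
      show "A n \<in> borel_measurable lborel" for n using borel_measurable_continuous_onI[OF cA] by simp
      show "(\<lambda>x. \<phi> x * (blinfun_apply (T' x) b \<bullet> b)) \<in> borel_measurable lborel" using borel_measurable_continuous_onI[OF cd] by simp
      show "AE x in lborel. (\<lambda>n. A n x) \<longlonglongrightarrow> \<phi> x * (blinfun_apply (T' x) b \<bullet> b)"
      proof (rule AE_I2)
        fix x
        have "((\<lambda>x. T x \<bullet> b) has_derivative (\<lambda>v. blinfun_apply (T' x) v \<bullet> b)) (at x)"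
          by (rule has_derivative_inner_left[OF T'(1)])
        from directional_quotient[OF this h0, of b] show "(\<lambda>n. A n x) \<longlonglongrightarrow> \<phi> x * (blinfun_apply (T' x) b \<bullet> b)"
          unfolding A_def using h by (intro tendsto_mult tendsto_const) (simp add: less_imp_neq[symmetric])
      qed
      show "AE x in lborel. norm (A n x) \<le> \<bar>\<phi> x\<bar> * L" for n
      proof (rule AE_I2)
        fix x
        have "\<bar>T (x + h n *\<^sub>R b) \<bullet> b - T x \<bullet> b\<bar> \<le> norm (T (x + h n *\<^sub>R b) - T x)"
          using Basis_le_norm[OF b, of "T (x + h n *\<^sub>R b) - T x"] by (simp add: inner_diff_left)
        also have "\<dots> \<le> L * h n" using L(2)[of "x + h n *\<^sub>R b" x] h(1)[of n] nb by simp
        finally have "\<bar>T (x + h n *\<^sub>R b) \<bullet> b - T x \<bullet> b\<bar> / h n \<le> L" using h(1)[of n] by (simp add: divide_le_eq)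
        from mult_left_mono[OF this, of "\<bar>\<phi> x\<bar>"] show "norm (A n x) \<le> \<bar>\<phi> x\<bar> * L"
          unfolding A_def using h(1)[of n] by (simp add: abs_mult)
      qed
    qed
    \<comment> \<open>A shift by \<open>- h n\<close> divided by \<open>+ h n\<close> produces the
      minus sign of the formula. The limit is available almost everywhere only, where
      \<open>\<phi>\<close> is differentiable.\<close>
    have limB': "AE x in lborel. (\<lambda>n. B n x) \<longlonglongrightarrow> - ((T x \<bullet> b) * (g x \<bullet> b))"
      using g
    proof eventually_elim
      case (elim x)
      have "(\<lambda>n. (\<phi> (x + (- h n) *\<^sub>R b) - \<phi> x) / (- h n)) \<longlonglongrightarrow> g x \<bullet> b"
        by (rule directional_quotient[OF elim h0']) (use h in \<open>simp add: less_imp_neq[symmetric]\<close>)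
      then have "(\<lambda>n. (T x \<bullet> b) * - ((\<phi> (x + (- h n) *\<^sub>R b) - \<phi> x) / (- h n))) \<longlonglongrightarrow> (T x \<bullet> b) * - (g x \<bullet> b)"
        by (intro tendsto_mult tendsto_const tendsto_minus)
      then show ?case unfolding B_def by simp
    qed
    have Bbd: "AE x in lborel. norm (B n x) \<le> \<bar>T x \<bullet> b\<bar> * K" for n
    proof (rule AE_I2)
      fix x
      have "\<bar>\<phi> (x - h n *\<^sub>R b) - \<phi> x\<bar> \<le> K * h n" using lip[of "x - h n *\<^sub>R b" x] h(1)[of n] nb by simp
      then have "\<bar>\<phi> (x - h n *\<^sub>R b) - \<phi> x\<bar> / h n \<le> K" using h(1)[of n] by (simp add: divide_le_eq)
      from mult_left_mono[OF this, of "\<bar>T x \<bullet> b\<bar>"] show "norm (B n x) \<le> \<bar>T x \<bullet> b\<bar> * K"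
        unfolding B_def using h(1)[of n] by (simp add: abs_mult)
    qed
    have mB: "B n \<in> borel_measurable lborel" for n using borel_measurable_continuous_onI[OF cB] by simp
    have mg: "(\<lambda>x. - ((T x \<bullet> b) * (g x \<bullet> b))) \<in> borel_measurable lborel"
      using borel_measurable_continuous_onI[OF cTb[of b]] gm by simp
    have limB: "(\<lambda>n. \<integral>x. B n x \<partial>lborel) \<longlonglongrightarrow> (\<integral>x. - ((T x \<bullet> b) * (g x \<bullet> b)) \<partial>lborel)"
      by (rule integral_dominated_convergence[OF mg mB dom(2) limB' Bbd])
    have "integrable lborel (\<lambda>x. - ((T x \<bullet> b) * (g x \<bullet> b)))"
      by (rule integrable_dominated_convergence[OF mg mB dom(2) limB' Bbd])
    then show "integrable lborel (\<lambda>x. (T x \<bullet> b) * (g x \<bullet> b))" by simp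
    show "(\<integral>x. \<phi> x * (blinfun_apply (T' x) b \<bullet> b) \<partial>lborel) = - (\<integral>x. (T x \<bullet> b) * (g x \<bullet> b) \<partial>lborel)"
      using LIMSEQ_unique[OF limA] limB unfolding AB by simp
  qed
  have "(\<integral>x. \<phi> x * divergence T x \<partial>lborel) = (\<integral>x. (\<Sum>b\<in>Basis. \<phi> x * (blinfun_apply (T' x) b \<bullet> b)) \<partial>lborel)"
    by (simp add: T'(6) sum_distrib_left)
  also have "\<dots> = (\<Sum>b\<in>Basis. \<integral>x. \<phi> x * (blinfun_apply (T' x) b \<bullet> b) \<partial>lborel)"
    using int(1) by (rule Bochner_Integration.integral_sum)
  also have "\<dots> = - (\<Sum>b\<in>Basis. \<integral>x. (T x \<bullet> b) * (g x \<bullet> b) \<partial>lborel)"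
    by (simp add: part sum_negf)
  also have "(\<Sum>b\<in>Basis. \<integral>x. (T x \<bullet> b) * (g x \<bullet> b) \<partial>lborel) = (\<integral>x. (\<Sum>b\<in>Basis. (T x \<bullet> b) * (g x \<bullet> b)) \<partial>lborel)"
    using int(2) by (rule Bochner_Integration.integral_sum[symmetric])
  also have "\<dots> = (\<integral>x. T x \<bullet> g x \<partial>lborel)" by (simp add: euclidean_inner[symmetric])
  finally show ?thesis .
qed

text \<open>The indicator of the ball is replaced by a cut-off \<open>\<phi>\<close> that falls
  linearly from 1 to 0 across a shell of width \<open>\<epsilon>\<close>. Its gradient has length
  \<open>1 / \<epsilon>\<close> on the shell, so the integral of the divergence is controlled by the
  difference quotient of the volume as a function of the radius, whose limit is the area of the
  sphere. An upper bound suffices because the ball serves as a competitor.\<close>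

lemma perimeter_cball_le:
  fixes r :: real
  assumes r: "r > 0"
  shows "perimeter (cball (0::'a::euclidean_space) r)
         \<le> ennreal (DIM('a) * measure lebesgue (ball (0::'a) 1) * r ^ (DIM('a) - 1))"
proof (rule perimeter_upper)
  fix T :: "'a \<Rightarrow> 'a" assume T: "C1_compact_support T" "\<And>x. norm (T x) \<le> 1"
  let ?d = "DIM('a)"
  define w where "w = measure lebesgue (ball (0::'a) 1)"
  have vol: "measure lborel (cball (0::'a) s) = w * s ^ ?d" if "s \<ge> 0" for s
    using that by (simp add: w_def content_ball content_cball)
  obtain R M where RM: "R > 0" "M \<ge> 0" "continuous_on UNIV (divergence T)"
    "\<And>x. norm x > R \<Longrightarrow> divergence T x = 0" "\<And>x. norm x > R \<Longrightarrow> T x = 0" "\<And>x. \<bar>divergence T x\<bar> \<le> M"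
    by (rule divergence_bounds[OF T(1)]) (rule that)
  have dm: "divergence T \<in> borel_measurable borel" using RM(3) by (rule borel_measurable_continuous_onI)
  let ?I = "\<integral>x. indicator (cball 0 r) x * divergence T x \<partial>lborel"
  \<comment> \<open>\<open>1 / \<epsilon>\<close> bounds the gradient of the cut-off and
    \<open>M\<close> the error of replacing the indicator by it. Both act on the shell only, and the
    second contribution vanishes with \<open>\<epsilon>\<close>.\<close>
  have main: "?I \<le> (1 / \<epsilon> + M) * (w * (r + \<epsilon>) ^ ?d - w * r ^ ?d)" if e: "\<epsilon> > 0" for \<epsilon>
  proof -
    define \<phi> where "\<phi> = (\<lambda>x::'a. max 0 (min 1 ((r + \<epsilon> - norm x) / \<epsilon>)))"
    define An where "An = cball (0::'a) (r + \<epsilon>) - cball 0 r"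
    define g where "g = (\<lambda>x::'a. indicator An x *\<^sub>R (- (1 / \<epsilon>) *\<^sub>R sgn x))"
    have Am: "An \<in> sets borel" by (simp add: An_def)
    have mA: "measure lborel An = w * (r + \<epsilon>) ^ ?d - w * r ^ ?d"
      unfolding An_def using e r emeasure_lborel_cball_finite[of "0::'a" "r + \<epsilon>"]
      by (subst measure_Diff) (auto simp: vol)
    have fA: "emeasure lborel An < \<infinity>"
      using emeasure_mono[of An "cball 0 (r + \<epsilon>)" lborel] emeasure_lborel_cball_finite[of "0::'a" "r + \<epsilon>"]
      by (auto simp: An_def less_top[symmetric] top_unique)
    have intA: "integrable lborel (indicator An :: 'a \<Rightarrow> real)"
      using Am fA by (intro integrable_real_indicator) auto
    have lip: "\<bar>\<phi> x - \<phi> y\<bar> \<le> (1 / \<epsilon>) * norm (x - y)" for x y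
    proof -
      have "\<bar>\<phi> x - \<phi> y\<bar> \<le> \<bar>(r + \<epsilon> - norm x) / \<epsilon> - (r + \<epsilon> - norm y) / \<epsilon>\<bar>" unfolding \<phi>_def by linarith
      also have "\<dots> = \<bar>norm y - norm x\<bar> / \<epsilon>" using e by (simp add: diff_divide_distrib[symmetric])
      also have "\<dots> \<le> norm (x - y) / \<epsilon>" using e norm_triangle_ineq3[of y x] by (intro divide_right_mono) (auto simp: norm_minus_commute)
      finally show ?thesis by simp
    qed
    have supp: "\<phi> x = 0" if "norm x > r + \<epsilon>" for x using that e by (simp add: \<phi>_def divide_neg_pos)
    have gm: "g \<in> borel_measurable borel" unfolding g_def using Am by measurable
    have AEg: "AE x in lborel. (\<phi> has_derivative (\<lambda>v. g x \<bullet> v)) (at x)"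
    proof -
      have "AE x in lborel. norm (x::'a) \<noteq> s" for s
      proof -
        have "negligible (sphere (0::'a) s)" by (rule negligible_sphere)
        then have "sphere (0::'a) s \<in> null_sets lborel"
          by (simp add: negligible_iff_null_sets null_sets_completion_iff)
        then have "AE x in lborel. x \<notin> sphere (0::'a) s" by (rule AE_not_in)
        then show ?thesis by eventually_elim simp
      qed
      then have "AE x in lborel. norm (x::'a) \<noteq> r \<and> norm x \<noteq> r + \<epsilon>" by simp
      then show ?thesis
      proof eventually_elim
        case (elim x)
        consider "norm x < r" | "norm x > r + \<epsilon>" | "r < norm x" "norm x < r + \<epsilon>" using elim by linarith
        then show ?case
        proof cases
          case 1
          have "((\<lambda>_. 1) has_derivative (\<lambda>v. g x \<bullet> v)) (at x)" using 1 by (simp add: g_def An_def)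
          then show ?thesis
            by (rule has_derivative_transform_within_open[of _ _ _ _ "ball 0 r"]) (use 1 e in \<open>auto simp: \<phi>_def\<close>)
        next
          case 2
          have o: "open (- cball (0::'a) (r + \<epsilon>))" by auto
          have "((\<lambda>_. 0) has_derivative (\<lambda>v. g x \<bullet> v)) (at x)" using 2 by (simp add: g_def An_def)
          then show ?thesis
            by (rule has_derivative_transform_within_open[OF _ o]) (use 2 supp in auto)
        next
          case 3
          have o: "open (ball (0::'a) (r + \<epsilon>) - cball 0 r)" by auto
          have x0: "x \<noteq> 0" using 3 r by auto
          have "((\<lambda>x. (r + \<epsilon> - norm x) / \<epsilon>) has_derivative (\<lambda>v. g x \<bullet> v)) (at x)"
            using 3 x0 e by (auto intro!: derivative_eq_intros has_derivative_norm simp: g_def An_def inner_commute)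
          then show ?thesis
            by (rule has_derivative_transform_within_open[OF _ o]) (use 3 e in \<open>auto simp: \<phi>_def\<close>)
        qed
      qed
    qed
    have c\<phi>: "\<phi> \<in> borel_measurable borel"
      unfolding \<phi>_def by measurable
    have i1: "integrable lborel (\<lambda>x. \<phi> x * divergence T x)"
    proof (rule integrable_bounded_support[of _ R M])
      show "\<bar>\<phi> x * divergence T x\<bar> \<le> M" for x
      proof -
        have "\<bar>\<phi> x\<bar> \<le> 1" by (auto simp: \<phi>_def)
        then have "\<bar>\<phi> x\<bar> * \<bar>divergence T x\<bar> \<le> 1 * M" using RM(6)[of x] by (intro mult_mono) auto
        then show ?thesis by (simp add: abs_mult)
      qed
    qed (use c\<phi> dm RM(4) in auto)
    have i2: "integrable lborel (\<lambda>x. indicator (cball 0 r) x * divergence T x)"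
      by (rule integrable_bounded_support[of _ R M]) (use dm RM in \<open>auto simp: indicator_def\<close>)
    have "?I - (\<integral>x. \<phi> x * divergence T x \<partial>lborel) = (\<integral>x. indicator (cball 0 r) x * divergence T x - \<phi> x * divergence T x \<partial>lborel)"
      using i1 i2 by simp
    also have "\<dots> \<le> (\<integral>x. M * indicator An x \<partial>lborel)"
    proof (rule integral_mono)
      show "integrable lborel (\<lambda>x. indicator (cball 0 r) x * divergence T x - \<phi> x * divergence T x)" using i1 i2 by simp
      show "integrable lborel (\<lambda>x. M * indicator An x)" using intA by simp
      fix x
      have 1: "\<bar>indicator (cball 0 r) x - \<phi> x\<bar> \<le> indicator An x"
      proof -
        consider "norm x \<le> r" | "norm x > r + \<epsilon>" | "r < norm x" "norm x \<le> r + \<epsilon>" by linarith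
        then show ?thesis
        proof cases
          case 1 then show ?thesis using e by (auto simp: \<phi>_def An_def indicator_def)
        next
          case 2 then show ?thesis using supp e by (auto simp: An_def indicator_def)
        next
          case 3 then show ?thesis by (auto simp: \<phi>_def An_def indicator_def)
        qed
      qed
      have "indicator (cball 0 r) x * divergence T x - \<phi> x * divergence T x = (indicator (cball 0 r) x - \<phi> x) * divergence T x"
        by (simp add: algebra_simps)
      also have "\<dots> \<le> \<bar>indicator (cball 0 r) x - \<phi> x\<bar> * \<bar>divergence T x\<bar>" by (metis abs_ge_self abs_mult)
      also have "\<dots> \<le> indicator An x * M" using 1 RM(6)[of x] by (intro mult_mono) auto
      finally show "indicator (cball 0 r) x * divergence T x - \<phi> x * divergence T x \<le> M * indicator An x" by (simp add: mult.commute)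
    qed
    also have "\<dots> = M * measure lborel An" using intA by simp
    finally have 1: "?I \<le> (\<integral>x. \<phi> x * divergence T x \<partial>lborel) + M * measure lborel An" by simp
    have "(\<integral>x. \<phi> x * divergence T x \<partial>lborel) = - (\<integral>x. T x \<bullet> g x \<partial>lborel)"
      by (rule integral_divergence_by_parts[OF T(1) lip supp AEg gm])
    also have "\<dots> = (\<integral>x. - (T x \<bullet> g x) \<partial>lborel)" by simp
    also have "\<dots> \<le> (\<integral>x. (1 / \<epsilon>) * indicator An x \<partial>lborel)"
    proof (rule integral_mono')
      show "integrable lborel (\<lambda>x. (1 / \<epsilon>) * indicator An x)" using intA by simp
      show "0 \<le> (1 / \<epsilon>) * indicator An x" for x using e by simp
      fix x
      have "- (T x \<bullet> g x) \<le> norm (T x) * norm (g x)" by (metis Cauchy_Schwarz_ineq2 abs_le_D2)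
      also have "\<dots> \<le> 1 * norm (g x)" using T(2) by (intro mult_right_mono) auto
      also have "norm (g x) \<le> (1 / \<epsilon>) * indicator An x"
        using e by (auto simp: g_def indicator_def norm_sgn)
      finally show "- (T x \<bullet> g x) \<le> (1 / \<epsilon>) * indicator An x" by simp
    qed
    also have "\<dots> = (1 / \<epsilon>) * measure lborel An" using intA by simp
    finally show ?thesis using 1 unfolding mA by (simp add: algebra_simps)
  qed
  let ?e = "\<lambda>n. inverse (real (Suc n))"
  have e0: "?e \<longlonglongrightarrow> 0" by (rule LIMSEQ_inverse_real_of_nat)
  have der: "((\<lambda>s. w * s ^ ?d) has_derivative (\<lambda>v. (w * (?d * r ^ (?d - 1))) * v)) (at r)"
    by (auto intro!: derivative_eq_intros simp: algebra_simps)
  have q: "(\<lambda>n. (w * (r + ?e n) ^ ?d - w * r ^ ?d) / ?e n) \<longlonglongrightarrow> w * (?d * r ^ (?d - 1))"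
    using directional_quotient[OF der e0, of 1] by simp
  have lim': "(\<lambda>n. (w * (r + ?e n) ^ ?d - w * r ^ ?d) / ?e n + M * (w * (r + ?e n) ^ ?d - w * r ^ ?d))
      \<longlonglongrightarrow> w * (?d * r ^ (?d - 1)) + M * (w * (r + 0) ^ ?d - w * r ^ ?d)"
    by (intro tendsto_intros q e0)
  have eq: "(1 / a + M) * X = X / a + M * X" for a X :: real by (simp add: distrib_right)
  have lim: "(\<lambda>n. (1 / ?e n + M) * (w * (r + ?e n) ^ ?d - w * r ^ ?d)) \<longlonglongrightarrow> w * (?d * r ^ (?d - 1))"
    using lim' unfolding eq by simp
  have "?I \<le> w * (?d * r ^ (?d - 1))"
    by (rule LIMSEQ_le_const[OF lim]) (use main in \<open>auto intro!: exI[of _ 0]\<close>)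
  then show "?I \<le> ?d * measure lebesgue (ball (0::'a) 1) * r ^ (?d - 1)" by (simp add: w_def mult_ac)
qed simp

section \<open>Mollification\<close>

text \<open>The positive part is squared so that the kernel is continuously differentiable with a
  quadratic Taylor remainder, all in closed form. This is the regularity on which the argument
  relies.\<close>

definition bump :: "real \<Rightarrow> 'a::euclidean_space \<Rightarrow> real" where
  "bump \<eta> z = (max 0 (\<eta>\<^sup>2 - (norm z)\<^sup>2))\<^sup>2"

text \<open>Besides \<open>\<eta>\<close> the normalising constant depends only on the space; the
  argument of type \<open>itself\<close> names that space.\<close>

definition bump_mass :: "real \<Rightarrow> 'a::euclidean_space itself \<Rightarrow> real" where
  "bump_mass \<eta> _ = (\<integral>z. bump \<eta> (z::'a) \<partial>lborel)"

definition moll :: "real \<Rightarrow> 'a::euclidean_space \<Rightarrow> real" where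
  "moll \<eta> z = bump \<eta> z / bump_mass \<eta> TYPE('a)"

text \<open>The gradient of \<open>moll\<close>: the outer square contributes one factor 2 and the
  squared norm another, hence the 4.\<close>

definition dmoll :: "real \<Rightarrow> 'a::euclidean_space \<Rightarrow> 'a" where
  "dmoll \<eta> z = - (4 * max 0 (\<eta>\<^sup>2 - (norm z)\<^sup>2) / bump_mass \<eta> TYPE('a)) *\<^sub>R z"

lemma bump_zero: "\<eta> \<ge> 0 \<Longrightarrow> norm z \<ge> \<eta> \<Longrightarrow> max 0 (\<eta>\<^sup>2 - (norm z)\<^sup>2) = 0"
  by (simp add: power_mono)

lemma continuous_bump: "continuous_on UNIV (bump \<eta>)"
  unfolding bump_def[abs_def] by (intro continuous_intros)

lemma bump_mass_pos:
  assumes "\<eta> > 0" shows "bump_mass \<eta> TYPE('a::euclidean_space) > 0"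
proof -
  have int: "integrable lborel (bump \<eta> :: 'a \<Rightarrow> real)"
    by (rule integrable_continuous_support[OF continuous_bump, of \<eta>])
      (use assms bump_zero[of \<eta>] in \<open>auto simp: bump_def\<close>)
  have "(\<integral>z. bump \<eta> (z::'a) \<partial>lborel) \<noteq> 0"
  proof
    assume "(\<integral>z. bump \<eta> (z::'a) \<partial>lborel) = 0"
    then have "AE z in lborel. bump \<eta> (z::'a) = 0"
      using int by (subst (asm) integral_nonneg_eq_0_iff_AE) (auto simp: bump_def)
    then have "AE z in lborel. z \<notin> ball (0::'a) \<eta>"
    proof eventually_elim
      case (elim z)
      have "(norm z)\<^sup>2 < \<eta>\<^sup>2" if "norm z < \<eta>" using that by (intro power_strict_mono) auto
      then show ?case using elim by (auto simp: bump_def max_def split: if_splits)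
    qed
    then have "ball (0::'a) \<eta> \<in> null_sets lborel"
      using AE_iff_null_sets[of "ball (0::'a) \<eta>" lborel] by simp
    then have "measure lborel (ball (0::'a) \<eta>) = 0" by (simp add: measure_eq_0_null_sets)
    then show False using assms content_ball_gt_0_iff[of "0::'a" \<eta>] by simp
  qed
  moreover have "(\<integral>z. bump \<eta> (z::'a) \<partial>lborel) \<ge> 0" by (intro Bochner_Integration.integral_nonneg) (simp add: bump_def)
  ultimately show ?thesis by (simp add: bump_mass_def)
qed

lemma continuous_moll: "\<eta> > 0 \<Longrightarrow> continuous_on UNIV (moll \<eta> :: 'a::euclidean_space \<Rightarrow> real)"
  unfolding moll_def[abs_def] using bump_mass_pos[of \<eta>, where 'a='a] continuous_bump by (intro continuous_intros) auto

lemma continuous_dmoll: "\<eta> > 0 \<Longrightarrow> continuous_on UNIV (dmoll \<eta> :: 'a::euclidean_space \<Rightarrow> 'a)"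
  unfolding dmoll_def[abs_def] using bump_mass_pos[of \<eta>, where 'a='a] by (intro continuous_intros) auto

lemma moll_nonneg: "\<eta> > 0 \<Longrightarrow> moll \<eta> (z::'a::euclidean_space) \<ge> 0"
  using bump_mass_pos[of \<eta>, where 'a='a] by (simp add: moll_def bump_def less_imp_le)

lemma moll_support: "\<eta> > 0 \<Longrightarrow> norm z \<ge> \<eta> \<Longrightarrow> moll \<eta> z = 0"
  using bump_zero[of \<eta> z] by (simp add: moll_def bump_def)

lemma dmoll_support: "\<eta> > 0 \<Longrightarrow> norm z \<ge> \<eta> \<Longrightarrow> dmoll \<eta> z = 0"
  using bump_zero[of \<eta> z] by (simp add: dmoll_def)

lemma moll_minus: "moll \<eta> (- z) = moll \<eta> z" "dmoll \<eta> (- z) = - dmoll \<eta> z"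
  by (simp_all add: moll_def dmoll_def bump_def)

lemma integral_moll: "\<eta> > 0 \<Longrightarrow> (\<integral>z. moll \<eta> (z::'a::euclidean_space) \<partial>lborel) = 1"
  using bump_mass_pos[of \<eta>, where 'a='a] unfolding moll_def by (simp add: bump_mass_def)

lemma integral_moll_shift:
  fixes x :: "'a::euclidean_space"
  assumes "\<eta> > 0" shows "(\<integral>y. moll \<eta> (x - y) \<partial>lborel) = 1" "integrable lborel (\<lambda>y. moll \<eta> (x - y))"
proof -
  have e: "moll \<eta> (x - y) = moll \<eta> (- x + y)" for y :: 'a
    using moll_minus(1)[of \<eta> "x - y"] by (simp add: algebra_simps)
  have m: "moll \<eta> \<in> borel_measurable (borel :: 'a measure)" by (rule borel_measurable_continuous_onI[OF continuous_moll[OF assms]])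
  show "(\<integral>y. moll \<eta> (x - y :: 'a) \<partial>lborel) = 1"
    unfolding e using integral_translation[OF m, of "- x"] integral_moll[OF assms, where 'a='a] by simp
  have "continuous_on UNIV (\<lambda>y. moll \<eta> (x - y))"
    by (intro continuous_on_compose2[OF continuous_moll[OF assms]] continuous_intros) auto
  then show "integrable lborel (\<lambda>y. moll \<eta> (x - y :: 'a))"
  proof (rule integrable_continuous_support[of _ "norm x + \<eta>"])
    fix y :: 'a assume "norm y > norm x + \<eta>"
    then have "norm (x - y) \<ge> \<eta>" using norm_triangle_ineq2[of y x] by (simp add: norm_minus_commute)
    then show "moll \<eta> (x - y) = 0" using assms by (rule moll_support[rotated])
  qed
qed

lemma dmoll_bounded:
  assumes "\<eta> > 0" obtains M where "M \<ge> 0" "\<And>z :: 'a::euclidean_space. norm (dmoll \<eta> z) \<le> M"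
proof -
  have "compact (dmoll \<eta> ` cball (0::'a) \<eta>)"
    by (intro compact_continuous_image continuous_on_subset[OF continuous_dmoll[OF assms]]) auto
  then obtain M where M: "\<And>x::'a. x \<in> cball 0 \<eta> \<Longrightarrow> norm (dmoll \<eta> x) \<le> M"
    using compact_imp_bounded bounded_iff by (metis imageI)
  have "0 \<le> M" using order_trans[OF norm_ge_zero M[of 0]] assms by simp
  then show ?thesis using that[of M] M dmoll_support[OF assms]
    by (metis less_imp_le linorder_not_le mem_cball_0 norm_zero)
qed

lemma moll_bounded:
  assumes "\<eta> > 0" obtains M where "M \<ge> 0" "\<And>z :: 'a::euclidean_space. \<bar>moll \<eta> z\<bar> \<le> M"
proof -
  have "compact (moll \<eta> ` cball (0::'a) \<eta>)"
    by (intro compact_continuous_image continuous_on_subset[OF continuous_moll[OF assms]]) auto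
  then obtain M where M: "\<And>x::'a. x \<in> cball 0 \<eta> \<Longrightarrow> norm (moll \<eta> x) \<le> M"
    using compact_imp_bounded bounded_iff by (metis imageI)
  have "0 \<le> M" using order_trans[OF norm_ge_zero M[of 0]] assms by simp
  then show ?thesis using that[of M] M moll_support[OF assms]
    by (metis abs_zero less_imp_le linorder_not_le mem_cball_0 real_norm_def)
qed

text \<open>\<open>2 * max 0 s\<close> is the derivative of the squared positive part and is
  2-Lipschitz, so the Taylor remainder is at most \<open>u\<^sup>2\<close>.\<close>

lemma square_pos_part_quadratic:
  fixes s u :: real
  shows "\<bar>(max 0 (s + u))\<^sup>2 - (max 0 s)\<^sup>2 - 2 * max 0 s * u\<bar> \<le> u\<^sup>2"
proof -
  consider "s \<ge> 0" "s + u \<ge> 0" | "s \<ge> 0" "s + u < 0" | "s < 0" "s + u \<ge> 0" | "s < 0" "s + u < 0" by linarith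
  then show ?thesis
  proof cases
    case 1 then show ?thesis by (simp add: power2_eq_square algebra_simps)
  next
    case 2
    have "s\<^sup>2 + 2 * s * u = s * (s + u) + s * u" by (simp add: power2_eq_square algebra_simps)
    moreover have "s * (s + u) \<le> 0" "s * u \<le> 0" using 2 by (auto simp: mult_nonneg_nonpos)
    moreover have "s\<^sup>2 + 2 * s * u = (s + u)\<^sup>2 - u\<^sup>2" by (simp add: power2_eq_square algebra_simps)
    ultimately have "\<bar>- s\<^sup>2 - 2 * s * u\<bar> \<le> u\<^sup>2" using zero_le_power2[of "s + u"] by linarith
    then show ?thesis using 2 by (simp add: max_def)
  next
    case 3
    then have "(s + u)\<^sup>2 \<le> u\<^sup>2" by (intro power_mono) auto
    then show ?thesis using 3 by (simp add: max_def)
  next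
    case 4 then show ?thesis by (simp add: max_def)
  qed
qed

text \<open>One constant \<open>C\<close> serves all \<open>z\<close> of a bounded set. Such a
  uniform remainder survives integration against a density, which yields both the derivative of a
  convolution and the quadratic error in the comparison of superlevel sets.\<close>

lemma moll_quadratic:
  assumes \<eta>: "\<eta> > 0"
  obtains C where "C \<ge> 0" "\<And>z v :: 'a::euclidean_space. norm z \<le> \<rho> \<Longrightarrow> norm v \<le> 1 \<Longrightarrow>
    \<bar>moll \<eta> (z + v) - moll \<eta> z - dmoll \<eta> z \<bullet> v\<bar> \<le> C * (norm v)\<^sup>2"
proof -
  let ?I = "bump_mass \<eta> TYPE('a)"
  have I: "?I > 0" by (rule bump_mass_pos[OF \<eta>])
  define C where "C = ((2 * \<bar>\<rho>\<bar> + 1)\<^sup>2 + 2 * \<eta>\<^sup>2) / ?I"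
  have "\<bar>moll \<eta> (z + v) - moll \<eta> z - dmoll \<eta> z \<bullet> v\<bar> \<le> C * (norm v)\<^sup>2" if z: "norm z \<le> \<rho>" and v: "norm v \<le> 1" for z v :: 'a
  proof -
    \<comment> \<open>A translation by \<open>v\<close> moves the argument of the positive part from
      \<open>s\<close> to \<open>s + u\<close>; the part of \<open>u\<close> that is linear in
      \<open>v\<close> produces the gradient.\<close>
    define s where "s = \<eta>\<^sup>2 - (norm z)\<^sup>2"
    define u where "u = - (2 * (z \<bullet> v) + (norm v)\<^sup>2)"
    have su: "\<eta>\<^sup>2 - (norm (z + v))\<^sup>2 = s + u"
      by (simp add: s_def u_def power2_norm_eq_inner inner_add_left inner_add_right inner_commute)
    have "\<bar>u\<bar> \<le> 2 * \<bar>z \<bullet> v\<bar> + (norm v)\<^sup>2"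
      using abs_ge_self[of "z \<bullet> v"] abs_ge_minus_self[of "z \<bullet> v"] zero_le_power2[of "norm v"] unfolding u_def by linarith
    also have "\<dots> \<le> 2 * (norm z * norm v) + norm v * norm v"
      using Cauchy_Schwarz_ineq2[of z v] by (simp add: power2_eq_square)
    also have "\<dots> \<le> 2 * (\<bar>\<rho>\<bar> * norm v) + 1 * norm v"
      using z v by (intro add_mono mult_left_mono mult_right_mono) auto
    finally have "\<bar>u\<bar> \<le> (2 * \<bar>\<rho>\<bar> + 1) * norm v" by (simp add: algebra_simps)
    then have "\<bar>u\<bar>\<^sup>2 \<le> ((2 * \<bar>\<rho>\<bar> + 1) * norm v)\<^sup>2" by (intro power_mono) auto
    then have u2: "u\<^sup>2 \<le> (2 * \<bar>\<rho>\<bar> + 1)\<^sup>2 * (norm v)\<^sup>2" by (simp add: power_mult_distrib)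
    have e: "(max 0 (s + u))\<^sup>2 - (max 0 s)\<^sup>2 + 4 * max 0 s * (z \<bullet> v)
        = ((max 0 (s + u))\<^sup>2 - (max 0 s)\<^sup>2 - 2 * max 0 s * u) - 2 * max 0 s * (norm v)\<^sup>2"
      by (simp add: u_def algebra_simps)
    have m: "0 \<le> max 0 s" "max 0 s \<le> \<eta>\<^sup>2" by (auto simp: s_def)
    have "\<bar>(max 0 (s + u))\<^sup>2 - (max 0 s)\<^sup>2 + 4 * max 0 s * (z \<bullet> v)\<bar> \<le> u\<^sup>2 + 2 * max 0 s * (norm v)\<^sup>2"
      unfolding e using square_pos_part_quadratic[of s u] m(1) abs_triangle_ineq4 by (smt (verit) mult_nonneg_nonneg zero_le_power2)
    also have "\<dots> \<le> (2 * \<bar>\<rho>\<bar> + 1)\<^sup>2 * (norm v)\<^sup>2 + 2 * \<eta>\<^sup>2 * (norm v)\<^sup>2"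
      using u2 m(2) by (intro add_mono mult_right_mono) auto
    finally have b: "\<bar>(max 0 (s + u))\<^sup>2 - (max 0 s)\<^sup>2 + 4 * max 0 s * (z \<bullet> v)\<bar> / ?I \<le> C * (norm v)\<^sup>2"
      using I by (simp add: C_def divide_right_mono algebra_simps)
    have "moll \<eta> (z + v) - moll \<eta> z - dmoll \<eta> z \<bullet> v = ((max 0 (s + u))\<^sup>2 - (max 0 s)\<^sup>2 + 4 * max 0 s * (z \<bullet> v)) / ?I"
      by (simp add: moll_def dmoll_def bump_def su s_def[symmetric] diff_divide_distrib add_divide_distrib)
    then show ?thesis using b I by simp
  qed
  moreover have "C \<ge> 0" using I by (simp add: C_def)
  ultimately show ?thesis using that by blast
qed

section \<open>Convolution with the kernel and with its gradient\<close>

definition conv :: "real \<Rightarrow> ('a::euclidean_space \<Rightarrow> real) \<Rightarrow> 'a \<Rightarrow> real" where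
  "conv \<eta> h x = (\<integral>y. h y * moll \<eta> (x - y) \<partial>lborel)"

definition gconv :: "real \<Rightarrow> ('a::euclidean_space \<Rightarrow> real) \<Rightarrow> 'a \<Rightarrow> 'a" where
  "gconv \<eta> h x = (\<integral>y. h y *\<^sub>R dmoll \<eta> (x - y) \<partial>lborel)"

text \<open>One class for two uses: the indicator of a bounded set, whose mollified gradient is
  measured, and the components of a measurable field of norm at most 1, whose mollification is the
  test field.\<close>

definition bdd_test :: "real \<Rightarrow> ('a::euclidean_space \<Rightarrow> real) \<Rightarrow> bool" where
  "bdd_test R h \<longleftrightarrow> h \<in> borel_measurable borel \<and> (\<forall>x. \<bar>h x\<bar> \<le> 1) \<and> (\<forall>x. norm x > R \<longrightarrow> h x = 0)"

lemma moll_measurable: "\<eta> > 0 \<Longrightarrow> (\<lambda>y. moll \<eta> (x - y :: 'a::euclidean_space)) \<in> borel_measurable borel"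
  by (intro borel_measurable_continuous_onI continuous_on_compose2[OF continuous_moll] continuous_intros) auto

lemma dmoll_measurable: "\<eta> > 0 \<Longrightarrow> (\<lambda>y. dmoll \<eta> (x - y :: 'a::euclidean_space)) \<in> borel_measurable borel"
  by (intro borel_measurable_continuous_onI continuous_on_compose2[OF continuous_dmoll] continuous_intros) auto

lemma conv_integrable:
  assumes \<eta>: "\<eta> > 0" and h: "bdd_test R h"
  shows "integrable lborel (\<lambda>y. h y * moll \<eta> (x - y))" "integrable lborel (\<lambda>y. h y *\<^sub>R dmoll \<eta> (x - y))" "integrable lborel h"
proof -
  have hm: "h \<in> borel_measurable borel" and h1: "\<And>x. \<bar>h x\<bar> \<le> 1" and h0: "\<And>x. norm x > R \<Longrightarrow> h x = 0"
    using h by (auto simp: bdd_test_def)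
  obtain M where M: "M \<ge> 0" "\<And>z::'a. norm (dmoll \<eta> z) \<le> M" by (rule dmoll_bounded[OF \<eta>]) (rule that)
  obtain M' where M': "M' \<ge> 0" "\<And>z::'a. \<bar>moll \<eta> z\<bar> \<le> M'" by (rule moll_bounded[OF \<eta>]) (rule that)
  show "integrable lborel (\<lambda>y. h y * moll \<eta> (x - y))"
  proof (rule integrable_bounded_support[of _ R M'])
    show "(\<lambda>y. h y * moll \<eta> (x - y)) \<in> borel_measurable borel" using hm moll_measurable[OF \<eta>] by measurable
    show "\<bar>h y * moll \<eta> (x - y)\<bar> \<le> M'" for y
      using mult_mono[OF h1[of y] M'(2)[of "x - y"]] M'(1) by (simp add: abs_mult)
  qed (simp add: h0)
  show "integrable lborel (\<lambda>y. h y *\<^sub>R dmoll \<eta> (x - y))"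
  proof (rule integrable_bounded_support_vec[of _ R M])
    show "(\<lambda>y. h y *\<^sub>R dmoll \<eta> (x - y)) \<in> borel_measurable borel" using hm dmoll_measurable[OF \<eta>] by measurable
    show "norm (h y *\<^sub>R dmoll \<eta> (x - y)) \<le> M" for y
      using mult_mono[OF h1[of y] M(2)[of "x - y"]] M(1) by simp
  qed (simp add: h0)
  show "integrable lborel h" by (rule integrable_bounded_support[OF hm h0 h1])
qed

lemma conv_quadratic:
  assumes \<eta>: "\<eta> > 0" and h: "bdd_test R h"
  obtains C where "C \<ge> 0" "\<And>x v :: 'a::euclidean_space. norm x \<le> \<rho> \<Longrightarrow> norm v \<le> 1 \<Longrightarrow>
    \<bar>conv \<eta> h (x + v) - conv \<eta> h x - gconv \<eta> h x \<bullet> v\<bar> \<le> C * (norm v)\<^sup>2"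
proof -
  have h1: "\<And>x. \<bar>h x\<bar> \<le> 1" and h0: "\<And>x. norm x > R \<Longrightarrow> h x = 0"
    using h by (auto simp: bdd_test_def)
  obtain C where C: "C \<ge> 0" "\<And>z v :: 'a. norm z \<le> \<rho> + R \<Longrightarrow> norm v \<le> 1 \<Longrightarrow>
    \<bar>moll \<eta> (z + v) - moll \<eta> z - dmoll \<eta> z \<bullet> v\<bar> \<le> C * (norm v)\<^sup>2"
    by (rule moll_quadratic[OF \<eta>]) (rule that)
  note int = conv_integrable[OF \<eta> h]
  define D where "D = C * (\<integral>y. \<bar>h y\<bar> \<partial>lborel)"
  have D: "D \<ge> 0" using C(1) by (simp add: D_def)
  have "\<bar>conv \<eta> h (x + v) - conv \<eta> h x - gconv \<eta> h x \<bullet> v\<bar> \<le> D * (norm v)\<^sup>2"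
    if x: "norm x \<le> \<rho>" and v: "norm v \<le> 1" for x v
  proof -
    define e where "e = (\<lambda>y. h y * moll \<eta> (x + v - y) - h y * moll \<eta> (x - y) - (h y *\<^sub>R dmoll \<eta> (x - y)) \<bullet> v)"
    have ie: "integrable lborel e" unfolding e_def using int by (intro Bochner_Integration.integrable_diff integrable_inner_left) auto
    have "conv \<eta> h (x + v) - conv \<eta> h x - gconv \<eta> h x \<bullet> v = (\<integral>y. e y \<partial>lborel)"
    proof -
      have i3: "integrable lborel (\<lambda>y. (h y *\<^sub>R dmoll \<eta> (x - y)) \<bullet> v)" using int(2) by (rule integrable_inner_left)
      have "gconv \<eta> h x \<bullet> v = (\<integral>y. (h y *\<^sub>R dmoll \<eta> (x - y)) \<bullet> v \<partial>lborel)"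
        unfolding gconv_def using int(2) by (intro integral_inner_left[symmetric]) auto
      moreover have "(\<integral>y. e y \<partial>lborel) = (\<integral>y. h y * moll \<eta> (x + v - y) - h y * moll \<eta> (x - y) \<partial>lborel)
          - (\<integral>y. (h y *\<^sub>R dmoll \<eta> (x - y)) \<bullet> v \<partial>lborel)"
        unfolding e_def using int i3 by (intro Bochner_Integration.integral_diff Bochner_Integration.integrable_diff)
      moreover have "(\<integral>y. h y * moll \<eta> (x + v - y) - h y * moll \<eta> (x - y) \<partial>lborel) = conv \<eta> h (x + v) - conv \<eta> h x"
        unfolding conv_def using int by (intro Bochner_Integration.integral_diff)
      ultimately show ?thesis by simp
    qed
    also have "\<bar>\<dots>\<bar> \<le> (\<integral>y. \<bar>e y\<bar> \<partial>lborel)" by (rule integral_abs_bound)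
    also have "\<dots> \<le> (\<integral>y. \<bar>h y\<bar> * (C * (norm v)\<^sup>2) \<partial>lborel)"
    proof (rule integral_mono)
      show "integrable lborel (\<lambda>y. \<bar>e y\<bar>)" using ie by simp
      show "integrable lborel (\<lambda>y. \<bar>h y\<bar> * (C * (norm v)\<^sup>2))" using int(3) by simp
      fix y
      show "\<bar>e y\<bar> \<le> \<bar>h y\<bar> * (C * (norm v)\<^sup>2)"
      proof (cases "norm y \<le> R")
        case True
        then have "norm (x - y) \<le> \<rho> + R" using x norm_triangle_ineq4[of x y] by linarith
        then have b: "\<bar>moll \<eta> ((x - y) + v) - moll \<eta> (x - y) - dmoll \<eta> (x - y) \<bullet> v\<bar> \<le> C * (norm v)\<^sup>2" using v by (rule C(2))
        have xv: "x + v - y = (x - y) + v" by simp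
        have "e y = h y * (moll \<eta> ((x - y) + v) - moll \<eta> (x - y) - dmoll \<eta> (x - y) \<bullet> v)"
          unfolding e_def xv by (simp add: right_diff_distrib)
        then show ?thesis using mult_left_mono[OF b, of "\<bar>h y\<bar>"] by (simp add: abs_mult)
      next
        case False
        then show ?thesis using h0[of y] by (simp add: e_def)
      qed
    qed
    also have "\<dots> = D * (norm v)\<^sup>2" by (simp add: D_def)
    finally show ?thesis .
  qed
  then show ?thesis using that D by blast
qed

lemma has_derivative_quadraticI:
  fixes f :: "'a::real_normed_vector \<Rightarrow> 'b::real_normed_vector"
  assumes "bounded_linear f'" "C \<ge> 0" "\<And>v. norm v \<le> 1 \<Longrightarrow> norm (f (x + v) - f x - f' v) \<le> C * (norm v)\<^sup>2"
  shows "(f has_derivative f') (at x)"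
  unfolding has_derivative_at
proof (intro conjI assms(1))
  have "((\<lambda>v::'a. C * norm v) \<longlongrightarrow> C * norm (0::'a)) (at 0)" by (intro tendsto_intros)
  then have lim: "((\<lambda>v::'a. C * norm v) \<longlongrightarrow> 0) (at 0)" by simp
  have ev: "\<forall>\<^sub>F v in at (0::'a). norm v \<le> 1"
    unfolding eventually_at by (rule exI[of _ 1]) (auto simp: dist_norm)
  show "((\<lambda>v. norm (f (x + v) - f x - f' v) / norm v) \<longlongrightarrow> 0) (at 0)"
  proof (rule tendsto_sandwich[OF _ _ tendsto_const lim])
    show "\<forall>\<^sub>F v in at 0. 0 \<le> norm (f (x + v) - f x - f' v) / norm v" by simp
    show "\<forall>\<^sub>F v in at 0. norm (f (x + v) - f x - f' v) / norm v \<le> C * norm v"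
      using ev
    proof eventually_elim
      case (elim v)
      show ?case
      proof (cases "v = 0")
        case False
        then show ?thesis using assms(3)[OF elim] by (simp add: divide_le_eq power2_eq_square)
      qed simp
    qed
  qed
qed

lemma conv_has_derivative:
  assumes \<eta>: "\<eta> > 0" and h: "bdd_test R h"
  shows "(conv \<eta> h has_derivative (\<lambda>v. gconv \<eta> h x \<bullet> v)) (at x)"
proof -
  obtain C where C: "C \<ge> 0" "\<And>x' v. norm x' \<le> norm x \<Longrightarrow> norm v \<le> 1 \<Longrightarrow>
    \<bar>conv \<eta> h (x' + v) - conv \<eta> h x' - gconv \<eta> h x' \<bullet> v\<bar> \<le> C * (norm v)\<^sup>2"
    by (rule conv_quadratic[OF \<eta> h]) (rule that)
  show ?thesis
    by (rule has_derivative_quadraticI[OF bounded_linear_inner_right C(1)]) (use C(2) in simp)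
qed

lemma continuous_gconv:
  assumes \<eta>: "\<eta> > 0" and h: "bdd_test R h"
  shows "continuous_on UNIV (gconv \<eta> h)"
proof (rule continuous_at_imp_continuous_on, intro ballI)
  fix x :: 'a
  obtain M where M: "M \<ge> 0" "\<And>z::'a. norm (dmoll \<eta> z) \<le> M" by (rule dmoll_bounded[OF \<eta>]) (rule that)
  note int = conv_integrable[OF \<eta> h]
  show "isCont (gconv \<eta> h) x"
    unfolding continuous_at_sequentially o_def
  proof (intro allI impI)
    fix u assume u: "u \<longlonglongrightarrow> x"
    show "(\<lambda>n. gconv \<eta> h (u n)) \<longlonglongrightarrow> gconv \<eta> h x"
      unfolding gconv_def
    proof (rule integral_dominated_convergence[where w = "\<lambda>y. \<bar>h y\<bar> * M"])
      show "integrable lborel (\<lambda>y. \<bar>h y\<bar> * M)" using int(3) by simp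
      show "AE y in lborel. (\<lambda>n. h y *\<^sub>R dmoll \<eta> (u n - y)) \<longlonglongrightarrow> h y *\<^sub>R dmoll \<eta> (x - y)"
      proof (rule AE_I2)
        fix y
        have "isCont (dmoll \<eta>) (x - y)" using continuous_dmoll[OF \<eta>] continuous_on_eq_continuous_at[OF open_UNIV] by blast
        then have "(\<lambda>n. dmoll \<eta> (u n - y)) \<longlonglongrightarrow> dmoll \<eta> (x - y)"
          by (rule isCont_tendsto_compose) (intro tendsto_intros u)
        then show "(\<lambda>n. h y *\<^sub>R dmoll \<eta> (u n - y)) \<longlonglongrightarrow> h y *\<^sub>R dmoll \<eta> (x - y)" by (intro tendsto_intros)
      qed
      show "AE y in lborel. norm (h y *\<^sub>R dmoll \<eta> (u n - y)) \<le> \<bar>h y\<bar> * M" for n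
        using M by (auto intro!: AE_I2 mult_left_mono)
    qed (use int in \<open>auto intro: borel_measurable_integrable\<close>)
  qed
qed

text \<open>This locality later keeps the gradients of two distant pieces from overlapping.\<close>

lemma conv_support:
  assumes \<eta>: "\<eta> > 0" and "\<And>y. norm (x - y) < \<eta> \<Longrightarrow> h y = 0"
  shows "conv \<eta> h x = 0" "gconv \<eta> h x = 0"
proof -
  have eq: "h y * moll \<eta> (x - y) = 0" "h y *\<^sub>R dmoll \<eta> (x - y) = 0" for y
    using assms(2)[of y] moll_support[OF \<eta>, of "x - y"] dmoll_support[OF \<eta>, of "x - y"]
    by (cases "norm (x - y) < \<eta>"; simp)+
  show "conv \<eta> h x = 0" "gconv \<eta> h x = 0" unfolding conv_def gconv_def eq by simp_all
qed

lemma conv_support_norm: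
  assumes \<eta>: "\<eta> > 0" and h: "bdd_test R h" and x: "norm x > R + \<eta>"
  shows "conv \<eta> h x = 0" "gconv \<eta> h x = 0"
proof -
  have "h y = 0" if "norm (x - y) < \<eta>" for y
  proof -
    have "norm y > R" using that x norm_triangle_ineq2[of x y] by linarith
    then show ?thesis using h by (simp add: bdd_test_def)
  qed
  then show "conv \<eta> h x = 0" "gconv \<eta> h x = 0" using conv_support[OF \<eta>] by blast+
qed

lemma bdd_test_indicator:
  assumes "E \<in> sets borel" "E \<subseteq> cball 0 R" shows "bdd_test R (indicator E)"
  using assms unfolding bdd_test_def by (auto simp: indicator_def)

lemma conv_indicator_bounds:
  assumes \<eta>: "\<eta> > 0" and E: "E \<in> sets borel" "E \<subseteq> cball 0 R"
  shows "0 \<le> conv \<eta> (indicator E) x" "conv \<eta> (indicator E) x \<le> 1"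
    "cball x \<eta> \<subseteq> E \<Longrightarrow> conv \<eta> (indicator E) x = 1"
proof -
  note int = conv_integrable[OF \<eta> bdd_test_indicator[OF E]]
  show "0 \<le> conv \<eta> (indicator E) x" unfolding conv_def by (intro Bochner_Integration.integral_nonneg mult_nonneg_nonneg moll_nonneg \<eta>) simp
  have "conv \<eta> (indicator E) x \<le> (\<integral>y. moll \<eta> (x - y) \<partial>lborel)"
    unfolding conv_def
  proof (rule integral_mono[OF int(1) integral_moll_shift(2)[OF \<eta>]])
    show "indicator E y * moll \<eta> (x - y) \<le> moll \<eta> (x - y)" for y using moll_nonneg[OF \<eta>, of "x - y"] by (auto simp: indicator_def)
  qed
  then show "conv \<eta> (indicator E) x \<le> 1" by (simp add: integral_moll_shift(1)[OF \<eta>])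
  assume sub: "cball x \<eta> \<subseteq> E"
  have eq: "indicator E y * moll \<eta> (x - y) = moll \<eta> (x - y)" for y
    using moll_support[OF \<eta>, of "x - y"] sub by (cases "norm (x - y) \<le> \<eta>") (auto simp: subset_iff dist_norm)
  show "conv \<eta> (indicator E) x = 1" unfolding conv_def eq by (simp add: integral_moll_shift(1)[OF \<eta>])
qed

text \<open>The test field is the mollification of the normalised gradient.\<close>
lemma integral_gconv_le_perimeter:
  fixes E :: "'a::euclidean_space set"
  assumes \<eta>: "\<eta> > 0" and E: "E \<in> sets borel" "E \<subseteq> cball 0 R"
  shows "ennreal (\<integral>x. norm (gconv \<eta> (indicator E) x) \<partial>lborel) \<le> perimeter E"
proof -
  define G where "G = gconv \<eta> (indicator E :: 'a \<Rightarrow> real)"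
  have bE: "bdd_test R (indicator E)" by (rule bdd_test_indicator[OF E])
  have cG: "continuous_on UNIV G" unfolding G_def by (rule continuous_gconv[OF \<eta> bE])
  have Gm: "G \<in> borel_measurable borel" using cG by (rule borel_measurable_continuous_onI)
  have G0: "G x = 0" if "norm x > R + \<eta>" for x unfolding G_def using conv_support_norm[OF \<eta> bE that] by simp
  \<comment> \<open>At the zeros of \<open>G\<close> the value is 0, since \<open>sgn 0 = 0\<close>.
    \<open>W\<close> is merely measurable; its mollification \<open>S\<close> below is continuously
    differentiable and still has norm at most 1.\<close>
  define W where "W = (\<lambda>x. - sgn (G x))"
  have Wm: "W \<in> borel_measurable borel" unfolding W_def sgn_div_norm using Gm by measurable
  have W1: "norm (W x) \<le> 1" for x by (simp add: W_def norm_sgn)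
  have W0: "W x = 0" if "norm x > R + \<eta>" for x using G0[OF that] by (simp add: W_def)
  define h where "h = (\<lambda>b x. W x \<bullet> b)"
  have bh: "bdd_test (R + \<eta>) (h b)" if b: "b \<in> Basis" for b
    unfolding bdd_test_def h_def
  proof (intro conjI allI impI)
    show "(\<lambda>x. W x \<bullet> b) \<in> borel_measurable borel" using Wm by measurable
    show "\<bar>W x \<bullet> b\<bar> \<le> 1" for x using Basis_le_norm[OF b, of "W x"] W1[of x] by linarith
  qed (simp add: W0)
  define S where "S = (\<lambda>x. \<Sum>b\<in>Basis. conv \<eta> (h b) x *\<^sub>R b)"
  define S' where "S' = (\<lambda>x. Blinfun (\<lambda>v. \<Sum>b\<in>Basis. (gconv \<eta> (h b) x \<bullet> v) *\<^sub>R b))"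
  have blin: "bounded_linear (\<lambda>v. \<Sum>b\<in>Basis. (gconv \<eta> (h b) x \<bullet> v) *\<^sub>R b)" for x
    by (intro bounded_linear_sum bounded_linear_scaleR_left[THEN bounded_linear_compose] bounded_linear_inner_right)
  have S'app: "blinfun_apply (S' x) = (\<lambda>v. \<Sum>b\<in>Basis. (gconv \<eta> (h b) x \<bullet> v) *\<^sub>R b)" for x
    unfolding S'_def by (rule bounded_linear_Blinfun_apply[OF blin])
  have Sd: "(S has_derivative blinfun_apply (S' x)) (at x)" for x
    unfolding S'app S_def by (intro has_derivative_sum has_derivative_scaleR_left conv_has_derivative[OF \<eta> bh])
  have cS': "continuous_on UNIV S'"
    by (rule continuous_on_blinfun_componentwise)
      (auto simp: S'app intro!: continuous_intros continuous_gconv[OF \<eta> bh])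
  have S0: "S x = 0" if "norm x > R + \<eta> + \<eta>" for x
    unfolding S_def using conv_support_norm(1)[OF \<eta> bh that] by simp
  have "bounded {x. S x \<noteq> 0}"
    by (rule boundedI[of _ "R + \<eta> + \<eta>"]) (use S0 in force)
  then have SC: "C1_compact_support S"
    unfolding C1_compact_support_def compact_closure using Sd cS' by blast
  have Sint: "S x = (\<integral>y. moll \<eta> (x - y) *\<^sub>R W y \<partial>lborel)" and Si: "integrable lborel (\<lambda>y. moll \<eta> (x - y) *\<^sub>R W y)" for x
  proof -
    obtain M' where M': "M' \<ge> 0" "\<And>z::'a. \<bar>moll \<eta> z\<bar> \<le> M'" by (rule moll_bounded[OF \<eta>]) (rule that)
    show i: "integrable lborel (\<lambda>y. moll \<eta> (x - y) *\<^sub>R W y)"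
    proof (rule integrable_bounded_support_vec[of _ "R + \<eta>" M'])
      show "(\<lambda>y. moll \<eta> (x - y) *\<^sub>R W y) \<in> borel_measurable borel" using moll_measurable[OF \<eta>] Wm by measurable
      show "norm (moll \<eta> (x - y) *\<^sub>R W y) \<le> M'" for y
        using mult_mono[OF M'(2)[of "x - y"] W1[of y]] M'(1) by simp
    qed (simp add: W0)
    have "(\<integral>y. moll \<eta> (x - y) *\<^sub>R W y \<partial>lborel) = (\<Sum>b\<in>Basis. ((\<integral>y. moll \<eta> (x - y) *\<^sub>R W y \<partial>lborel) \<bullet> b) *\<^sub>R b)"
      by (rule euclidean_representation[symmetric])
    also have "\<dots> = S x"
      unfolding S_def conv_def h_def using i by (intro sum.cong refl) (simp add: integral_inner_left[symmetric] mult.commute)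
    finally show "S x = (\<integral>y. moll \<eta> (x - y) *\<^sub>R W y \<partial>lborel)" by simp
  qed
  have S1: "norm (S x) \<le> 1" for x
  proof -
    have "norm (S x) \<le> (\<integral>y. norm (moll \<eta> (x - y) *\<^sub>R W y) \<partial>lborel)" unfolding Sint by (rule integral_norm_bound)
    also have "\<dots> \<le> (\<integral>y. moll \<eta> (x - y) \<partial>lborel)"
    proof (rule integral_mono[OF integrable_norm[OF Si] integral_moll_shift(2)[OF \<eta>]])
      show "norm (moll \<eta> (x - y) *\<^sub>R W y) \<le> moll \<eta> (x - y)" for y
        using mult_left_mono[OF W1[of y] moll_nonneg[OF \<eta>, of "x - y"]] moll_nonneg[OF \<eta>, of "x - y"] by simp
    qed
    finally show ?thesis by (simp add: integral_moll_shift(1)[OF \<eta>])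
  qed
  obtain M where M: "M \<ge> 0" "\<And>z::'a. norm (dmoll \<eta> z) \<le> M" by (rule dmoll_bounded[OF \<eta>]) (rule that)
  have iWd: "integrable lborel (\<lambda>y. W y \<bullet> dmoll \<eta> (x - y))" for x
  proof (rule integrable_bounded_support[of _ "R + \<eta>" M])
    show "(\<lambda>y. W y \<bullet> dmoll \<eta> (x - y)) \<in> borel_measurable borel" using dmoll_measurable[OF \<eta>] Wm by measurable
    show "\<bar>W y \<bullet> dmoll \<eta> (x - y)\<bar> \<le> M" for y
      using order_trans[OF Cauchy_Schwarz_ineq2 mult_mono[OF W1[of y] M(2)[of "x - y"]]] by simp
  qed (simp add: W0)
  have dS: "divergence S x = (\<integral>y. W y \<bullet> dmoll \<eta> (x - y) \<partial>lborel)" for x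
  proof -
    have "divergence S x = (\<Sum>b\<in>Basis. blinfun_apply (S' x) b \<bullet> b)"
      unfolding divergence_def using frechet_derivative_at[OF Sd[of x]] by simp
    also have "\<dots> = (\<Sum>b\<in>Basis. gconv \<eta> (h b) x \<bullet> b)"
      by (intro sum.cong refl) (simp add: S'app inner_sum_left inner_Basis if_distrib cong: if_cong)
    also have "\<dots> = (\<Sum>b\<in>Basis. \<integral>y. (W y \<bullet> b) * (dmoll \<eta> (x - y) \<bullet> b) \<partial>lborel)"
      using conv_integrable(2)[OF \<eta> bh] by (intro sum.cong refl) (simp add: gconv_def h_def integral_inner_left[symmetric])
    also have "\<dots> = (\<integral>y. (\<Sum>b\<in>Basis. (W y \<bullet> b) * (dmoll \<eta> (x - y) \<bullet> b)) \<partial>lborel)"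
    proof (rule Bochner_Integration.integral_sum[symmetric])
      fix b :: 'a assume b: "b \<in> Basis"
      show "integrable lborel (\<lambda>y. (W y \<bullet> b) * (dmoll \<eta> (x - y) \<bullet> b))"
        using integrable_inner_left[OF conv_integrable(2)[OF \<eta> bh[OF b], of x], of b] by (simp add: h_def)
    qed
    finally show ?thesis by (simp add: euclidean_inner[symmetric])
  qed
  \<comment> \<open>Exchanging the integrals moves the kernel gradient from \<open>W\<close> to the
    indicator of \<open>E\<close>. As \<open>dmoll\<close> is odd, the inner integral becomes
    \<open>W y \<bullet> (- G y)\<close>, which is \<open>norm (G y)\<close> by the choice of
    \<open>W\<close>.\<close>
  define F where "F = (\<lambda>(x, y). indicator E x * (W y \<bullet> dmoll \<eta> (x - y)) :: real)"
  have iF: "integrable (lborel \<Otimes>\<^sub>M lborel) F"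
    unfolding lborel_prod
  proof (rule integrable_bounded_support[of _ "\<bar>R\<bar> + (R + \<eta>) + \<eta>" M])
    have "(\<lambda>p::'a \<times> 'a. dmoll \<eta> (fst p - snd p)) \<in> borel_measurable borel"
      by (intro borel_measurable_continuous_onI continuous_on_compose2[OF continuous_dmoll[OF \<eta>]] continuous_intros) auto
    moreover have "(\<lambda>p::'a \<times> 'a. W (snd p)) \<in> borel_measurable borel"
      by (rule measurable_compose[OF _ Wm]) (intro borel_measurable_continuous_onI continuous_intros)
    moreover have "(\<lambda>p::'a \<times> 'a. indicator E (fst p) :: real) \<in> borel_measurable borel"
      by (rule measurable_compose[of _ _ borel]) (use E(1) in \<open>auto intro!: borel_measurable_continuous_onI continuous_intros\<close>)
    ultimately show "F \<in> borel_measurable borel" unfolding F_def case_prod_beta by measurable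
    fix p :: "'a \<times> 'a"
    have c: "\<bar>W (snd p) \<bullet> dmoll \<eta> (fst p - snd p)\<bar> \<le> M"
      using order_trans[OF Cauchy_Schwarz_ineq2 mult_mono[OF W1[of "snd p"] M(2)[of "fst p - snd p"]]] by simp
    then show "\<bar>F p\<bar> \<le> M" unfolding F_def case_prod_beta using M(1) by (auto simp: indicator_def)
    show "F p = 0" if "norm p > \<bar>R\<bar> + (R + \<eta>) + \<eta>"
    proof (rule ccontr)
      assume "F p \<noteq> 0"
      then have "fst p \<in> E" "W (snd p) \<noteq> 0" by (auto simp: F_def case_prod_beta indicator_def split: if_splits)
      then have "norm (fst p) \<le> R" "norm (snd p) \<le> R + \<eta>" using E(2) W0[of "snd p"] by force+
      then have "norm p \<le> R + (R + \<eta>)" using norm_Pair_le[of "fst p" "snd p"] by simp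
      then show False using that \<eta> by simp
    qed
  qed
  have "(\<integral>x. indicator E x * divergence S x \<partial>lborel) = (\<integral>x. \<integral>y. F (x, y) \<partial>lborel \<partial>lborel)"
    unfolding dS F_def by (intro Bochner_Integration.integral_cong refl) simp
  also have "\<dots> = (\<integral>y. \<integral>x. F (x, y) \<partial>lborel \<partial>lborel)"
    using lborel_pair.Fubini_integral[of "\<lambda>x y. F (x, y)"] iF by simp
  also have "\<dots> = (\<integral>y. norm (G y) \<partial>lborel)"
  proof (intro Bochner_Integration.integral_cong refl)
    fix y
    have "(\<integral>x. F (x, y) \<partial>lborel) = (\<integral>x. W y \<bullet> (- (indicator E x *\<^sub>R dmoll \<eta> (y - x))) \<partial>lborel)"
      unfolding F_def by (intro Bochner_Integration.integral_cong refl)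
        (use moll_minus(2)[of \<eta> "y - _"] in \<open>simp add: mult.commute\<close>)
    also have "\<dots> = W y \<bullet> (\<integral>x. - (indicator E x *\<^sub>R dmoll \<eta> (y - x)) \<partial>lborel)"
      using conv_integrable(2)[OF \<eta> bE] by (intro integral_inner_right) auto
    also have "\<dots> = W y \<bullet> (- G y)" by (simp add: G_def gconv_def)
    also have "\<dots> = norm (G y)"
      by (cases "G y = 0") (auto simp: W_def sgn_div_norm dot_square_norm power2_eq_square)
    finally show "(\<integral>x. F (x, y) \<partial>lborel) = norm (G y)" .
  qed
  finally show ?thesis using perimeter_lower[OF E(1) SC S1] by (simp add: G_def)
qed

section \<open>The isoperimetric inequality\<close>

text \<open>Fubini for the region below the graph, with the levels restricted to the unit interval:
  a mollified indicator takes no values beyond it, while its enlargement in the isoperimetric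
  argument may exceed 1, whence the \<open>min\<close>.\<close>

lemma layer_cake_unit:
  fixes g :: "'a::euclidean_space \<Rightarrow> real"
  assumes g: "g \<in> borel_measurable borel" "\<And>x. g x \<ge> 0"
  shows "(\<integral>\<^sup>+t. indicator {0<..<1} t * emeasure lborel {x. g x > t} \<partial>lborel) = (\<integral>\<^sup>+x. ennreal (min 1 (g x)) \<partial>lborel)"
proof -
  have m: "(\<lambda>(t, x). indicator {0<..<min 1 (g x)} t :: ennreal) \<in> borel_measurable (lborel \<Otimes>\<^sub>M lborel)"
  proof -
    have "(\<lambda>p::real \<times> 'a. indicator {0<..<min 1 (g (snd p))} (fst p) :: ennreal) = indicator {p. 0 < fst p \<and> fst p < min 1 (g (snd p))}"
      by (auto simp: indicator_def fun_eq_iff)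
    moreover have "{p::real \<times> 'a. 0 < fst p \<and> fst p < min 1 (g (snd p))} \<in> sets (borel \<Otimes>\<^sub>M borel)"
    proof -
      have "{p \<in> space (borel \<Otimes>\<^sub>M borel). 0 < fst p \<and> fst p < min 1 (g (snd p))} \<in> sets (borel \<Otimes>\<^sub>M borel)"
        using g(1) by measurable
      then show ?thesis by (simp add: space_pair_measure)
    qed
    ultimately have "(\<lambda>p::real \<times> 'a. indicator {0<..<min 1 (g (snd p))} (fst p) :: ennreal) \<in> borel_measurable (borel \<Otimes>\<^sub>M borel)"
      by (simp only: borel_measurable_indicator)
    then show ?thesis
      unfolding case_prod_beta by (subst measurable_cong_sets[OF sets_pair_measure_cong[OF sets_lborel sets_lborel] refl])
  qed
  have "(\<integral>\<^sup>+t. indicator {0<..<1} t * emeasure lborel {x. g x > t} \<partial>lborel)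
      = (\<integral>\<^sup>+t. \<integral>\<^sup>+x. indicator {0<..<min 1 (g x)} t \<partial>lborel \<partial>lborel)"
  proof (intro nn_integral_cong)
    fix t :: real
    have s: "{x. g x > t} \<in> sets lborel" using borel_measurable_less[of "\<lambda>_. t" borel g] g(1) by simp
    have "indicator {0<..<1} t * emeasure lborel {x. g x > t} = (\<integral>\<^sup>+x. indicator {0<..<1} t * indicator {x. g x > t} x \<partial>lborel)"
      using s by (simp add: nn_integral_cmult_indicator)
    also have "\<dots> = (\<integral>\<^sup>+x. indicator {0<..<min 1 (g x)} t \<partial>lborel)"
      by (intro nn_integral_cong) (auto simp: indicator_def)
    finally show "indicator {0<..<1} t * emeasure lborel {x. g x > t} = (\<integral>\<^sup>+x. indicator {0<..<min 1 (g x)} t \<partial>lborel)" .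
  qed
  also have "\<dots> = (\<integral>\<^sup>+x. \<integral>\<^sup>+t. indicator {0<..<min 1 (g x)} t \<partial>lborel \<partial>lborel)"
    using lborel_pair.Fubini'[OF m] by simp
  also have "\<dots> = (\<integral>\<^sup>+x. ennreal (min 1 (g x)) \<partial>lborel)"
    using g(2) by (intro nn_integral_cong) simp
  finally show ?thesis .
qed

lemma power_add_ge_linear:
  fixes a x :: real
  assumes "a \<ge> 0" "x \<ge> 0"
  shows "(a + x) ^ n \<ge> a ^ n + real n * x * a ^ (n - 1)"
proof (induction n)
  case (Suc n)
  have "a ^ Suc n + real (Suc n) * x * a ^ n \<le> (a + x) * (a ^ n + real n * x * a ^ (n - 1))"
  proof (cases n)
    case (Suc k)
    have "(a + x) * (a ^ n + real n * x * a ^ (n - 1)) = a ^ Suc n + real (Suc n) * x * a ^ n + real n * x\<^sup>2 * a ^ (n - 1)"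
      using Suc by (simp add: algebra_simps power2_eq_square)
    moreover have "real n * x\<^sup>2 * a ^ (n - 1) \<ge> 0" using assms by simp
    ultimately show ?thesis by linarith
  qed (use assms in simp)
  also have "\<dots> \<le> (a + x) * (a + x) ^ n" using Suc assms by (intro mult_left_mono) auto
  finally show ?case by simp
qed simp

text \<open>Linearising the Brunn-Minkowski inequality in \<open>\<epsilon>\<close> isolates the
  volume gained by an \<open>\<epsilon>\<close>-neighbourhood. The coefficient of
  \<open>\<epsilon>\<close> is the area of the sphere that bounds a ball of the volume of
  \<open>A\<close>; this is the source of the sharp constant.\<close>

lemma brunn_minkowski_ball:
  fixes A :: "'a::euclidean_space set" and b :: real
  assumes A: "open A" "bounded A" "A \<noteq> {}" and e: "\<epsilon> > 0"
  defines "b \<equiv> root DIM('a) (measure lebesgue (ball (0::'a) 1))"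
  shows "measure lebesgue A + DIM('a) * (\<epsilon> * b) * root DIM('a) (measure lebesgue A) ^ (DIM('a) - 1)
    \<le> measure lebesgue (msum A (ball 0 \<epsilon>))"
proof -
  let ?n = "DIM('a)" and ?\<mu> = "measure lebesgue :: 'a set \<Rightarrow> real"
  define a where "a = root ?n (?\<mu> A)"
  have a: "a \<ge> 0" "a ^ ?n = ?\<mu> A" unfolding a_def by (auto simp: real_root_pow_pos2)
  have b: "b \<ge> 0" unfolding b_def by simp
  have "?\<mu> (ball 0 \<epsilon>) = \<epsilon> ^ ?n * ?\<mu> (ball (0::'a) 1)" using e by (simp add: content_ball)
  then have rb: "root ?n (?\<mu> (ball 0 \<epsilon>)) = \<epsilon> * b" using e by (simp add: real_root_mult b_def real_root_power_cancel)
  have "a + \<epsilon> * b \<le> root ?n (?\<mu> (msum A (ball 0 \<epsilon>)))"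
    using brunn_minkowski_open[OF A, of "ball 0 \<epsilon>"] e unfolding rb a_def by simp
  then have "(a + \<epsilon> * b) ^ ?n \<le> root ?n (?\<mu> (msum A (ball 0 \<epsilon>))) ^ ?n"
    using a b e by (intro power_mono) auto
  also have "\<dots> = ?\<mu> (msum A (ball 0 \<epsilon>))" by (simp add: real_root_pow_pos2)
  finally have "(a + \<epsilon> * b) ^ ?n \<le> ?\<mu> (msum A (ball 0 \<epsilon>))" .
  moreover have "a ^ ?n + ?n * (\<epsilon> * b) * a ^ (?n - 1) \<le> (a + \<epsilon> * b) ^ ?n"
    using a b e by (intro power_add_ge_linear) auto
  ultimately show ?thesis using a by (simp add: a_def)
qed

text \<open>Enlarging the superlevel sets of \<open>f\<close> by a small ball of radius \<open>\<epsilon>\<close> stays inside the superlevel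
  sets of \<open>f + \<epsilon> |\<nabla>f| + O(\<epsilon>\<^sup>2)\<close>; integrating the Brunn-Minkowski inequality over the levels gives the
  bound without the coarea formula.\<close>
lemma isoperimetric_gconv:
  fixes E :: "'a::euclidean_space set"
  assumes \<eta>: "\<eta> > 0" and E: "E \<in> sets borel" "E \<subseteq> cball 0 R"
    and D: "D \<in> sets borel" "D \<noteq> {}" "\<And>x. x \<in> D \<Longrightarrow> cball x \<eta> \<subseteq> E"
  shows "DIM('a) * root DIM('a) (measure lebesgue (ball (0::'a) 1)) * root DIM('a) (measure lebesgue D) ^ (DIM('a) - 1)
    \<le> (\<integral>x. norm (gconv \<eta> (indicator E) x) \<partial>lborel)"
proof -
  let ?n = "DIM('a)"
  define f where "f = conv \<eta> (indicator E :: 'a \<Rightarrow> real)"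
  define G where "G = gconv \<eta> (indicator E :: 'a \<Rightarrow> real)"
  define b where "b = root ?n (measure lebesgue (ball (0::'a) 1))"
  define P where "P = ?n * b * root ?n (measure lebesgue D) ^ (?n - 1)"
  have bE: "bdd_test R (indicator E)" by (rule bdd_test_indicator[OF E])
  have b0: "b \<ge> 0" by (simp add: b_def)
  have P0: "P \<ge> 0" by (simp add: P_def b0)
  have cf: "continuous_on UNIV f"
    unfolding f_def by (intro continuous_at_imp_continuous_on ballI has_derivative_continuous[OF conv_has_derivative[OF \<eta> bE]])
  have cG: "continuous_on UNIV G" unfolding G_def by (rule continuous_gconv[OF \<eta> bE])
  have f01: "0 \<le> f x" "f x \<le> 1" and f1: "x \<in> D \<Longrightarrow> f x = 1" for x
    unfolding f_def using conv_indicator_bounds[OF \<eta> E] D(3) by auto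
  have f0: "f x = 0" and G0: "G x = 0" if "norm x > R + \<eta>" for x
    unfolding f_def G_def using conv_support_norm[OF \<eta> bE that] by auto
  have fi: "integrable lborel f" by (rule integrable_continuous_support[OF cf f0])
  have Gi: "integrable lborel (\<lambda>x. norm (G x))"
    by (rule integrable_continuous_support[of _ "R + \<eta>"]) (use cG G0 in \<open>auto intro!: continuous_intros\<close>)
  \<comment> \<open>Superlevel sets at positive levels lie within \<open>R + \<eta>\<close> of the
    origin. Enlarging them by \<open>\<epsilon> \<le> 1\<close> stays in the ball of radius
    \<open>\<rho>\<close>, where the remainder is uniform.\<close>
  define \<rho> where "\<rho> = R + \<eta> + 1"
  obtain C where C: "C \<ge> 0" "\<And>x v. norm x \<le> \<rho> \<Longrightarrow> norm v \<le> 1 \<Longrightarrow> \<bar>f (x + v) - f x - G x \<bullet> v\<bar> \<le> C * (norm v)\<^sup>2"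
    by (rule conv_quadratic[OF \<eta> bE, where \<rho>=\<rho>, folded f_def G_def]) (rule that)
  define V where "V = measure lborel (cball (0::'a) \<rho>)"
  have V0: "V \<ge> 0" by (simp add: V_def)
  have step: "P \<le> (\<integral>x. norm (G x) \<partial>lborel) + \<epsilon> * (C * V)" if e: "\<epsilon> > 0" "\<epsilon> \<le> 1" for \<epsilon>
  proof -
    define g where "g = (\<lambda>x. f x + \<epsilon> * norm (G x) + C * \<epsilon>\<^sup>2 * indicator (cball 0 \<rho>) x)"
    have g0: "g x \<ge> 0" for x unfolding g_def using f01 e C(1) by (intro add_nonneg_nonneg) auto
    have gm: "g \<in> borel_measurable borel"
      unfolding g_def using borel_measurable_continuous_onI[OF cf] borel_measurable_continuous_onI[OF cG]
      by (intro borel_measurable_add borel_measurable_times borel_measurable_indicator) auto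
    have iI: "integrable lborel (indicator (cball (0::'a) \<rho>) :: 'a \<Rightarrow> real)"
      using emeasure_lborel_cball_finite[of "0::'a" \<rho>] by (intro integrable_real_indicator) auto
    have gi: "integrable lborel g" unfolding g_def using fi Gi iI by simp
    have Ig: "(\<integral>x. g x \<partial>lborel) = (\<integral>x. f x \<partial>lborel) + \<epsilon> * (\<integral>x. norm (G x) \<partial>lborel) + C * \<epsilon>\<^sup>2 * V"
      unfolding g_def V_def using fi Gi iI by simp
    have lev: "emeasure lborel {x. f x > t} + ennreal (\<epsilon> * P) \<le> emeasure lborel {x. g x > t}" if t: "0 < t" "t < 1" for t
    proof -
      let ?A = "{x. f x > t}"
      have oA: "open ?A" using cf by (simp add: open_Collect_less continuous_on_const)
      have bA: "bounded ?A"
      proof (rule boundedI)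
        fix x assume "x \<in> ?A"
        then show "norm x \<le> R + \<eta>" using f0[of x] t by force
      qed
      have DA: "D \<subseteq> ?A" using f1 t by auto
      have neA: "?A \<noteq> {}" using DA D(2) by auto
      have sub: "msum ?A (ball 0 \<epsilon>) \<subseteq> {x. g x > t}"
      proof
        fix z assume "z \<in> msum ?A (ball 0 \<epsilon>)"
        then obtain x w where xw: "z = x + w" "f x > t" "norm w < \<epsilon>" by (auto simp: msum_def)
        have "norm x \<le> R + \<eta>" using f0[of x] xw(2) t by force
        then have z: "norm z \<le> \<rho>" using xw(1,3) e norm_triangle_ineq[of x w] by (simp add: \<rho>_def)
        \<comment> \<open>The expansion is centred at the enlarged point \<open>z\<close>, so that
          the gradient occurs at the point where \<open>g\<close> is evaluated.\<close>
        have "\<bar>f (z + - w) - f z - G z \<bullet> - w\<bar> \<le> C * (norm (- w))\<^sup>2" using z xw(3) e by (intro C(2)) auto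
        then have "f x \<le> f z + G z \<bullet> (- w) + C * (norm w)\<^sup>2" using xw(1) by simp
        also have "G z \<bullet> (- w) \<le> norm (G z) * norm (- w)" by (rule norm_cauchy_schwarz)
        also have "norm (G z) * norm (- w) \<le> norm (G z) * \<epsilon>" using xw(3) by (intro mult_left_mono) auto
        also have "C * (norm w)\<^sup>2 \<le> C * \<epsilon>\<^sup>2" using xw(3) C(1) by (intro mult_left_mono power_mono) auto
        finally have "f x \<le> g z" using z by (simp add: g_def mult.commute)
        then show "z \<in> {x. g x > t}" using xw(2) by simp
      qed
      have lmA: "?A \<in> lmeasurable" using oA bA by (intro lmeasurable_open)
      have oM: "open (msum ?A (ball 0 \<epsilon>))" "bounded (msum ?A (ball 0 \<epsilon>))"
        unfolding msum_UN using oA bA by (auto intro: open_sums bounded_sums)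
      have lmM: "msum ?A (ball 0 \<epsilon>) \<in> lmeasurable" using oM by (intro lmeasurable_open)
      \<comment> \<open>\<open>f\<close> is 1 on \<open>D\<close>, so every superlevel set in
        question contains \<open>D\<close>; this makes the gain \<open>\<epsilon> * P\<close>
        independent of the level.\<close>
      have "root ?n (measure lebesgue D) \<le> root ?n (measure lebesgue ?A)"
        using DA lmA D(1) by (intro real_root_le_mono measure_mono_fmeasurable) auto
      then have "\<epsilon> * P \<le> ?n * (\<epsilon> * b) * root ?n (measure lebesgue ?A) ^ (?n - 1)"
        unfolding P_def using e b0 by (auto intro!: mult_left_mono power_mono)
      then have "measure lebesgue ?A + \<epsilon> * P \<le> measure lebesgue (msum ?A (ball 0 \<epsilon>))"
        using brunn_minkowski_ball[OF oA bA neA e(1)] unfolding b_def by linarith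
      then have "ennreal (measure lebesgue ?A) + ennreal (\<epsilon> * P) \<le> ennreal (measure lebesgue (msum ?A (ball 0 \<epsilon>)))"
        using e P0 by (simp add: ennreal_plus[symmetric] ennreal_leI del: ennreal_plus)
      moreover have "ennreal (measure lebesgue S) = emeasure lborel S" if "open S" "bounded S" for S :: "'a set"
      proof -
        have "S \<in> lmeasurable" using that by (intro lmeasurable_open)
        then have "emeasure lebesgue S = ennreal (measure lebesgue S)"
          by (rule emeasure_eq_ennreal_measure[OF fmeasurableD2])
        moreover have "emeasure lebesgue S = emeasure lborel S" using that by (simp add: borel_open)
        ultimately show ?thesis by simp
      qed
      ultimately have "emeasure lborel ?A + ennreal (\<epsilon> * P) \<le> emeasure lborel (msum ?A (ball 0 \<epsilon>))"
        using oA bA oM by simp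
      also have "\<dots> \<le> emeasure lborel {x. g x > t}" using sub borel_measurable_less[of "\<lambda>_. t" borel g] gm by (intro emeasure_mono) auto
      finally show ?thesis .
    qed
    have "(\<integral>\<^sup>+x. ennreal (min 1 (f x)) \<partial>lborel) + ennreal (\<epsilon> * P)
      = (\<integral>\<^sup>+t. indicator {0<..<1} t * emeasure lborel {x. f x > t} \<partial>lborel) + (\<integral>\<^sup>+t. ennreal (\<epsilon> * P) * indicator {0<..<1::real} t \<partial>lborel)"
      using layer_cake_unit[of f] borel_measurable_continuous_onI[OF cf] f01(1) by (simp add: nn_integral_cmult_indicator)
    also have "\<dots> = (\<integral>\<^sup>+t. indicator {0<..<1} t * emeasure lborel {x. f x > t} + ennreal (\<epsilon> * P) * indicator {0<..<1} t \<partial>lborel)"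
    proof (rule nn_integral_add[symmetric])
      have "{p \<in> space (borel \<Otimes>\<^sub>M lborel). fst p < f (snd p)} \<in> sets (borel \<Otimes>\<^sub>M lborel)"
        using borel_measurable_continuous_onI[OF cf] by measurable
      then have "{p::real \<times> 'a. fst p < f (snd p)} \<in> sets (borel \<Otimes>\<^sub>M lborel)" by (simp add: space_pair_measure)
      then have "(\<lambda>t. emeasure lborel (Pair t -` {p::real \<times> 'a. fst p < f (snd p)})) \<in> borel_measurable borel"
        by (rule lborel.measurable_emeasure_Pair)
      then have "(\<lambda>t. emeasure lborel {x. t < f x}) \<in> borel_measurable lborel" by (simp add: vimage_def)
      then show "(\<lambda>t. indicator {0<..<1} t * emeasure lborel {x. f x > t}) \<in> borel_measurable lborel"
        by (intro borel_measurable_times_ennreal borel_measurable_indicator) auto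
      show "(\<lambda>t. ennreal (\<epsilon> * P) * indicator {0<..<1::real} t) \<in> borel_measurable lborel"
        by (intro borel_measurable_times_ennreal borel_measurable_indicator) auto
    qed
    also have "\<dots> \<le> (\<integral>\<^sup>+t. indicator {0<..<1} t * emeasure lborel {x. g x > t} \<partial>lborel)"
      using lev by (intro nn_integral_mono) (auto simp: indicator_def)
    also have "\<dots> = (\<integral>\<^sup>+x. ennreal (min 1 (g x)) \<partial>lborel)" by (rule layer_cake_unit[OF gm g0])
    also have "\<dots> \<le> (\<integral>\<^sup>+x. ennreal (g x) \<partial>lborel)" by (intro nn_integral_mono ennreal_leI) auto
    also have "\<dots> = ennreal (\<integral>x. g x \<partial>lborel)" using gi g0 by (intro nn_integral_eq_integral) auto
    also have "(\<integral>\<^sup>+x. ennreal (min 1 (f x)) \<partial>lborel) = ennreal (\<integral>x. f x \<partial>lborel)"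
      using fi f01 by (subst nn_integral_eq_integral[symmetric]) (auto simp: min_absorb2)
    finally have "ennreal ((\<integral>x. f x \<partial>lborel) + \<epsilon> * P) \<le> ennreal (\<integral>x. g x \<partial>lborel)"
      using e P0 f01(1) by (simp add: ennreal_plus Bochner_Integration.integral_nonneg)
    then have "(\<integral>x. f x \<partial>lborel) + \<epsilon> * P \<le> (\<integral>x. g x \<partial>lborel)"
      using g0 by (subst (asm) ennreal_le_iff) (auto intro: Bochner_Integration.integral_nonneg)
    then have "\<epsilon> * P \<le> \<epsilon> * ((\<integral>x. norm (G x) \<partial>lborel) + \<epsilon> * (C * V))"
      unfolding Ig by (simp add: power2_eq_square algebra_simps)
    then show ?thesis using e(1) by simp
  qed
  have "P \<le> (\<integral>x. norm (G x) \<partial>lborel)"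
  proof (rule field_le_epsilon)
    fix e :: real assume e: "e > 0"
    define \<epsilon> where "\<epsilon> = min 1 (e / (C * V + 1))"
    have cv: "C * V + 1 > 0" using C(1) V0 by (simp add: add_nonneg_pos)
    have \<epsilon>: "\<epsilon> > 0" "\<epsilon> \<le> 1" using e cv by (auto simp: \<epsilon>_def)
    have "\<epsilon> * (C * V) \<le> e / (C * V + 1) * (C * V + 1)" using C(1) V0 e cv by (intro mult_mono) (auto simp: \<epsilon>_def)
    also have "\<dots> = e" using cv by simp
    finally show "P \<le> (\<integral>x. norm (G x) \<partial>lborel) + e" using step[OF \<epsilon>] by simp
  qed
  then show ?thesis by (simp add: P_def b_def G_def)
qed

section \<open>Erosions, and sets with two separated pieces\<close>

lemma closed_erosion:
  fixes E :: "'a::real_normed_vector set"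
  assumes "closed E" shows "closed {x. cball x \<eta> \<subseteq> E}"
proof -
  have "{x. cball x \<eta> \<subseteq> E} = (\<Inter>w\<in>cball 0 \<eta>. (\<lambda>x. x + w) -` E)"
  proof (intro set_eqI iffI)
    fix x assume "x \<in> {x. cball x \<eta> \<subseteq> E}"
    then show "x \<in> (\<Inter>w\<in>cball 0 \<eta>. (\<lambda>x. x + w) -` E)" by (auto simp: subset_iff dist_norm)
  next
    fix x assume x: "x \<in> (\<Inter>w\<in>cball 0 \<eta>. (\<lambda>x. x + w) -` E)"
    have "y \<in> E" if "y \<in> cball x \<eta>" for y
    proof -
      have "y - x \<in> cball 0 \<eta>" using that by (simp add: dist_norm norm_minus_commute)
      with x have "x + (y - x) \<in> E" by blast
      then show ?thesis by simp
    qed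
    then show "x \<in> {x. cball x \<eta> \<subseteq> E}" by blast
  qed
  moreover have "closed ((\<lambda>x. x + w) -` E)" for w
    using assms by (intro continuous_closed_vimage) (auto intro: continuous_intros)
  ultimately show ?thesis by auto
qed

text \<open>The erosions increase as their radius shrinks, and a point survives some erosion exactly
  when it is interior.\<close>

lemma measure_erosion_tendsto:
  fixes E :: "'a::euclidean_space set"
  assumes "compact E" and s: "s > 0"
  shows "(\<lambda>n. measure lebesgue {x. cball x (s / Suc n) \<subseteq> E}) \<longlonglongrightarrow> measure lebesgue (interior E)"
proof -
  let ?D = "\<lambda>n. {x. cball x (s / real (Suc n)) \<subseteq> E}"
  have U: "(\<Union>n. ?D n) = interior E"
  proof (intro set_eqI iffI)
    fix x assume "x \<in> (\<Union>n. ?D n)"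
    then obtain n where "cball x (s / real (Suc n)) \<subseteq> E" by blast
    moreover have "s / real (Suc n) > 0" using s by simp
    ultimately show "x \<in> interior E" unfolding mem_interior_cball by blast
  next
    fix x assume "x \<in> interior E"
    then obtain e where e: "e > 0" "cball x e \<subseteq> E" unfolding mem_interior_cball by blast
    obtain n :: nat where "s / e < real n" using reals_Archimedean2 by blast
    then have "s / e < real (Suc n)" by simp
    then have "s / real (Suc n) \<le> e" using e(1) by (simp add: field_simps)
    then have "cball x (s / real (Suc n)) \<subseteq> E" using e(2) by auto
    then show "x \<in> (\<Union>n. ?D n)" by blast
  qed
  have "(\<lambda>n. measure lebesgue (?D n)) \<longlonglongrightarrow> measure lebesgue (\<Union>n. ?D n)"
  proof (rule Lim_measure_incseq)
    show "range ?D \<subseteq> sets lebesgue" using closed_erosion[OF compact_imp_closed[OF assms(1)]] by auto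
    show "incseq ?D"
    proof (rule incseq_SucI)
      fix n
      have "s / real (Suc (Suc n)) \<le> s / real (Suc n)" using s by (intro divide_left_mono) auto
      then show "?D n \<subseteq> ?D (Suc n)" using subset_cball by blast
    qed
    have "interior E \<in> lmeasurable" using assms by (intro lmeasurable_open) (auto intro: bounded_interior compact_imp_bounded)
    then show "emeasure lebesgue (\<Union>n. ?D n) \<noteq> \<infinity>" unfolding U by (metis fmeasurableD2 infinity_ennreal_def)
  qed
  then show ?thesis unfolding U .
qed

text \<open>Disjoint compact pieces have a positive distance. Mollified at a scale of at most half
  of it, they have gradients of which one vanishes at every point, so the integrals of the norms add
  and the isoperimetric bound applies to each piece. The interiors appear because the bound is
  carried by erosions, which exhaust the interior.\<close>

lemma perimeter_two_pieces:
  fixes A B :: "'a::euclidean_space set"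
  assumes A: "compact A" "interior A \<noteq> {}" and B: "compact B" "interior B \<noteq> {}" and dis: "A \<inter> B = {}"
  shows "ennreal (DIM('a) * root DIM('a) (measure lebesgue (ball (0::'a) 1)) *
      (root DIM('a) (measure lebesgue (interior A)) ^ (DIM('a) - 1) + root DIM('a) (measure lebesgue (interior B)) ^ (DIM('a) - 1)))
    \<le> perimeter (A \<union> B)"
proof -
  let ?n = "DIM('a)"
  define c where "c = ?n * root ?n (measure lebesgue (ball (0::'a) 1))"
  have ne: "A \<noteq> {}" "B \<noteq> {}" using A B interior_subset by blast+
  obtain s0 where s0: "s0 > 0" "\<And>x y. x \<in> A \<Longrightarrow> y \<in> B \<Longrightarrow> s0 \<le> dist x y"
    using separate_compact_closed[OF A(1) compact_imp_closed[OF B(1)] dis] by blast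
  define s where "s = s0 / 2"
  have s: "s > 0" using s0 by (simp add: s_def)
  have "bounded (A \<union> B)" using A B by (auto intro: compact_imp_bounded)
  then obtain R where "\<And>x. x \<in> A \<union> B \<Longrightarrow> norm x \<le> R" by (auto simp: bounded_iff)
  then have R: "A \<union> B \<subseteq> cball 0 R" by auto
  define D where "D = (\<lambda>E n. {x::'a. cball x (s / real (Suc n)) \<subseteq> E})"
  have bor: "A \<in> sets borel" "B \<in> sets borel" using A B by (auto intro: borel_compact)
  have Dm: "D A n \<in> sets borel" "D B n \<in> sets borel" for n
    unfolding D_def using closed_erosion compact_imp_closed A B by (auto intro: borel_closed)
  have limD: "(\<lambda>n. measure lebesgue (D E n)) \<longlonglongrightarrow> measure lebesgue (interior E)" if "compact E" for E
    unfolding D_def by (rule measure_erosion_tendsto[OF that s])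
  have key: "ennreal (c * root ?n (measure lebesgue (D A n)) ^ (?n - 1) + c * root ?n (measure lebesgue (D B n)) ^ (?n - 1)) \<le> perimeter (A \<union> B)"
    if n: "D A n \<noteq> {}" "D B n \<noteq> {}" for n
  proof -
    define \<eta> where "\<eta> = s / real (Suc n)"
    have \<eta>: "\<eta> > 0" "\<eta> \<le> s" using s by (auto simp: \<eta>_def divide_le_eq mult_le_cancel_left1)
    define GA where "GA = gconv \<eta> (indicator A :: 'a \<Rightarrow> real)"
    define GB where "GB = gconv \<eta> (indicator B :: 'a \<Rightarrow> real)"
    have bA: "bdd_test R (indicator A)" and bB: "bdd_test R (indicator B)"
      using R bor by (auto intro!: bdd_test_indicator)
    have sum: "gconv \<eta> (indicator (A \<union> B)) x = GA x + GB x" for x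
    proof -
      have "gconv \<eta> (indicator (A \<union> B)) x = (\<integral>y. indicator A y *\<^sub>R dmoll \<eta> (x - y) + indicator B y *\<^sub>R dmoll \<eta> (x - y) \<partial>lborel)"
        unfolding gconv_def using dis by (intro Bochner_Integration.integral_cong refl) (auto simp: indicator_def)
      also have "\<dots> = GA x + GB x"
        unfolding GA_def GB_def gconv_def
        by (rule Bochner_Integration.integral_add[OF conv_integrable(2)[OF \<eta>(1) bA] conv_integrable(2)[OF \<eta>(1) bB]])
      finally show ?thesis .
    qed
    have "GA x = 0 \<or> GB x = 0" for x
    proof (rule ccontr)
      assume "\<not> ?thesis"
      then obtain y z where "norm (x - y) < \<eta>" "y \<in> A" "norm (x - z) < \<eta>" "z \<in> B"
        unfolding GA_def GB_def using conv_support(2)[OF \<eta>(1), of x "indicator A"] conv_support(2)[OF \<eta>(1), of x "indicator B"]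
        by (metis indicator_simps(2))
      then have "dist y z < 2 * \<eta>" "s0 \<le> dist y z"
        using s0(2) dist_triangle3[of y z x] by (auto simp: dist_norm)
      then show False using \<eta>(2) by (simp add: s_def)
    qed
    then have nsum: "norm (gconv \<eta> (indicator (A \<union> B)) x) = norm (GA x) + norm (GB x)" for x
      unfolding sum by (metis add.left_neutral add.right_neutral norm_zero)
    have iG: "integrable lborel (\<lambda>x. norm (GA x))" "integrable lborel (\<lambda>x. norm (GB x))"
      unfolding GA_def GB_def
      by (rule integrable_continuous_support[of _ "R + \<eta>"];
          auto intro!: continuous_intros continuous_gconv[OF \<eta>(1) bA] continuous_gconv[OF \<eta>(1) bB]
            simp: conv_support_norm(2)[OF \<eta>(1) bA] conv_support_norm(2)[OF \<eta>(1) bB])+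
    have "c * root ?n (measure lebesgue (D A n)) ^ (?n - 1) \<le> (\<integral>x. norm (GA x) \<partial>lborel)"
      unfolding c_def GA_def using R bor Dm n by (intro isoperimetric_gconv[OF \<eta>(1)]) (auto simp: D_def \<eta>_def)
    moreover have "c * root ?n (measure lebesgue (D B n)) ^ (?n - 1) \<le> (\<integral>x. norm (GB x) \<partial>lborel)"
      unfolding c_def GB_def using R bor Dm n by (intro isoperimetric_gconv[OF \<eta>(1)]) (auto simp: D_def \<eta>_def)
    ultimately have "c * root ?n (measure lebesgue (D A n)) ^ (?n - 1) + c * root ?n (measure lebesgue (D B n)) ^ (?n - 1)
        \<le> (\<integral>x. norm (gconv \<eta> (indicator (A \<union> B)) x) \<partial>lborel)"
      unfolding nsum using iG by simp
    then show ?thesis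
      using integral_gconv_le_perimeter[OF \<eta>(1) sets.Un[OF bor] R] by (meson ennreal_leI order_trans)
  qed
  have pos: "measure lebesgue (interior E) > 0" if "compact E" "interior E \<noteq> {}" for E :: "'a set"
  proof -
    have "interior E \<in> lmeasurable" using that by (intro lmeasurable_open) (auto intro: bounded_interior compact_imp_bounded)
    then show ?thesis using open_not_negligible[OF open_interior that(2)] by (metis negligible_iff_measure measure_nonneg less_le)
  qed
  have evD: "\<forall>\<^sub>F n in sequentially. D E n \<noteq> {}" if "compact E" "interior E \<noteq> {}" for E
    using order_tendstoD(1)[OF limD[OF that(1)] pos[OF that]] by eventually_elim auto
  have lim: "(\<lambda>n. c * root ?n (measure lebesgue (D A n)) ^ (?n - 1) + c * root ?n (measure lebesgue (D B n)) ^ (?n - 1))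
    \<longlonglongrightarrow> c * root ?n (measure lebesgue (interior A)) ^ (?n - 1) + c * root ?n (measure lebesgue (interior B)) ^ (?n - 1)"
    by (intro tendsto_intros limD A B)
  have "ennreal (c * root ?n (measure lebesgue (interior A)) ^ (?n - 1) + c * root ?n (measure lebesgue (interior B)) ^ (?n - 1)) \<le> perimeter (A \<union> B)"
  proof (rule tendsto_upperbound[OF tendsto_ennrealI[OF lim]])
    show "\<forall>\<^sub>F n in sequentially. ennreal (c * root ?n (measure lebesgue (D A n)) ^ (?n - 1) + c * root ?n (measure lebesgue (D B n)) ^ (?n - 1)) \<le> perimeter (A \<union> B)"
      using evD[OF A] evD[OF B] by eventually_elim (rule key)
  qed simp
  then show ?thesis by (simp add: c_def distrib_left mult.assoc)
qed

section \<open>Riesz energies\<close>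

definition riesz_kernel :: "real \<Rightarrow> 'a::euclidean_space \<Rightarrow> 'a \<Rightarrow> ennreal" where
  "riesz_kernel \<alpha> x y = 1 / ennreal (norm (x - y) powr \<alpha>)"

lemma riesz_energy_kernel: "riesz_energy \<alpha> \<mu> = (\<integral>\<^sup>+x. (\<integral>\<^sup>+y. riesz_kernel \<alpha> x y \<partial>\<mu>) \<partial>\<mu>)"
  by (simp add: riesz_energy_def riesz_kernel_def)

lemma riesz_kernel_measurable [measurable]:
  "(\<lambda>(x, y). riesz_kernel \<alpha> x (y::'a::euclidean_space)) \<in> borel_measurable (borel \<Otimes>\<^sub>M borel)"
  unfolding riesz_kernel_def by measurable

lemma riesz_potential_measurable:
  fixes \<nu> :: "'a::euclidean_space measure"
  assumes "finite_measure \<nu>" "sets \<nu> = sets borel"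
  shows "(\<lambda>x. \<integral>\<^sup>+y. riesz_kernel \<alpha> x y \<partial>\<nu>) \<in> borel_measurable borel"
proof -
  interpret finite_measure \<nu> by fact
  have "(\<lambda>(x, y). riesz_kernel \<alpha> x y) \<in> borel_measurable (borel \<Otimes>\<^sub>M \<nu>)"
    using riesz_kernel_measurable[of \<alpha>] by (simp add: assms(2) cong: measurable_cong_sets sets_pair_measure_cong)
  then show ?thesis by (rule borel_measurable_nn_integral)
qed

lemma riesz_kernel_measurable2 [measurable]: "riesz_kernel \<alpha> (x::'a::euclidean_space) \<in> borel_measurable borel"
  unfolding riesz_kernel_def[abs_def] by measurable

lemma riesz_kernel_expand:
  assumes "\<alpha> \<ge> 0" "c > 0" "norm (u - v) \<ge> c * norm (x - y)"
  shows "riesz_kernel \<alpha> u v \<le> ennreal (c powr - \<alpha>) * riesz_kernel \<alpha> x y"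
proof (cases "x = y")
  case True
  then show ?thesis using assms by (simp add: riesz_kernel_def ennreal_mult_top)
next
  case False
  then have p: "norm (x - y) > 0" by simp
  then have p': "c * norm (x - y) > 0" "norm (u - v) > 0"
    using assms(2) mult_pos_pos[OF assms(2) p] less_le_trans[OF mult_pos_pos[OF assms(2) p] assms(3)] by auto
  have "(c * norm (x - y)) powr \<alpha> \<le> norm (u - v) powr \<alpha>"
    using assms p' by (intro powr_mono2) auto
  then have "1 / norm (u - v) powr \<alpha> \<le> 1 / (c * norm (x - y)) powr \<alpha>"
    using p' assms(2) False by (intro divide_left_mono mult_pos_pos) auto
  also have "\<dots> = c powr - \<alpha> * (1 / norm (x - y) powr \<alpha>)"
    using p assms by (simp add: powr_mult powr_minus field_simps)
  finally show ?thesis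
    using p p' assms
    by (simp add: riesz_kernel_def divide_ennreal ennreal_mult[symmetric] ennreal_leI flip: ennreal_1)
qed

text \<open>The infimum ranges over all Borel measures with mass one on \<open>A\<close>, including
  those of infinite mass elsewhere. Restriction to \<open>A\<close> turns such a measure into a
  probability measure and cannot raise the energy; finiteness is what the measurability of the
  potential rests on.\<close>

lemma I_riesz_prob:
  fixes A :: "'a::euclidean_space set"
  assumes "I_riesz \<alpha> A < c" "A \<in> sets borel"
  obtains \<mu> where "prob_space \<mu>" "sets \<mu> = sets borel" "emeasure \<mu> A = 1" "riesz_energy \<alpha> \<mu> < c"
proof -
  obtain \<mu> :: "'a measure" where \<mu>: "sets \<mu> = sets borel" "emeasure \<mu> A = 1" "riesz_energy \<alpha> \<mu> < c"
    using assms(1) unfolding I_riesz_def INF_less_iff by auto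
  define \<nu> where "\<nu> = density \<mu> (indicator A)"
  have A: "A \<in> sets \<mu>" using assms \<mu> by simp
  have sp: "space \<mu> = UNIV" using sets_eq_imp_space_eq[OF \<mu>(1)] by simp
  have nA: "emeasure \<nu> A = 1"
    using A \<mu>(2) by (simp add: \<nu>_def emeasure_density flip: indicator_inter_arith)
  have sn: "sets \<nu> = sets borel" by (simp add: \<nu>_def \<mu>)
  have p: "prob_space \<nu>"
    by rule (use A \<mu>(2) sets.top[of \<mu>] in \<open>simp add: \<nu>_def emeasure_density sp flip: indicator_inter_arith\<close>)
  interpret prob_space \<nu> by fact
  have km: "(\<lambda>y. riesz_kernel \<alpha> x y) \<in> borel_measurable \<mu>" for x
    using riesz_kernel_measurable2[of \<alpha> x] \<mu>(1) by (simp cong: measurable_cong_sets)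
  have pm: "(\<lambda>x. \<integral>\<^sup>+y. riesz_kernel \<alpha> x y \<partial>\<nu>) \<in> borel_measurable \<mu>"
    using riesz_potential_measurable[OF _ sn, of \<alpha>] finite_measure_axioms \<mu>(1)
    by (simp cong: measurable_cong_sets)
  have "riesz_energy \<alpha> \<nu> = (\<integral>\<^sup>+x. indicator A x * (\<integral>\<^sup>+y. riesz_kernel \<alpha> x y \<partial>\<nu>) \<partial>\<mu>)"
    unfolding riesz_energy_kernel by (subst \<nu>_def, subst nn_integral_density) (use A pm in auto)
  also have "\<dots> \<le> (\<integral>\<^sup>+x. (\<integral>\<^sup>+y. riesz_kernel \<alpha> x y \<partial>\<mu>) \<partial>\<mu>)"
  proof (rule nn_integral_mono)
    fix x
    have "(\<integral>\<^sup>+y. riesz_kernel \<alpha> x y \<partial>\<nu>) = (\<integral>\<^sup>+y. indicator A y * riesz_kernel \<alpha> x y \<partial>\<mu>)"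
      unfolding \<nu>_def using A km by (intro nn_integral_density) auto
    also have "\<dots> \<le> (\<integral>\<^sup>+y. riesz_kernel \<alpha> x y \<partial>\<mu>)"
      by (intro nn_integral_mono) (auto simp: indicator_def)
    finally show "indicator A x * (\<integral>\<^sup>+y. riesz_kernel \<alpha> x y \<partial>\<nu>) \<le> (\<integral>\<^sup>+y. riesz_kernel \<alpha> x y \<partial>\<mu>)"
      by (auto simp: indicator_def)
  qed
  finally have "riesz_energy \<alpha> \<nu> < c" using \<mu>(3) by (simp add: riesz_energy_kernel)
  then show ?thesis using that p sn nA by blast
qed

lemma I_riesz_le_energy:
  "sets \<mu> = sets borel \<Longrightarrow> emeasure \<mu> A = 1 \<Longrightarrow> I_riesz \<alpha> A \<le> riesz_energy \<alpha> \<mu>"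
  unfolding I_riesz_def by (intro INF_lower) auto

text \<open>Push the charge forward along \<open>\<Phi>\<close>: distances are multiplied by at
  least \<open>c\<close>, hence the energy by at most \<open>c powr - \<alpha>\<close>. The argument
  is by contradiction because the infimum need not be attained, and a strict inequality supplies a
  measure to push. Scaling, translation and the passage from a boundary to the sphere are all
  instances.\<close>

lemma I_riesz_expand:
  fixes \<Phi> :: "'a::euclidean_space \<Rightarrow> 'b::euclidean_space"
  assumes "\<alpha> \<ge> 0" "c > 0" and A: "A \<in> sets borel" "A' \<in> sets borel" and \<Phi>: "\<Phi> \<in> borel_measurable borel"
    and sub: "\<And>x. x \<in> A \<Longrightarrow> \<Phi> x \<in> A'"
    and ex: "\<And>x y. x \<in> A \<Longrightarrow> y \<in> A \<Longrightarrow> norm (\<Phi> x - \<Phi> y) \<ge> c * norm (x - y)"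
  shows "I_riesz \<alpha> A' \<le> ennreal (c powr - \<alpha>) * I_riesz \<alpha> A"
proof (rule ccontr)
  assume "\<not> ?thesis"
  then have less: "ennreal (c powr - \<alpha>) * I_riesz \<alpha> A < I_riesz \<alpha> A'" by simp
  have cc: "ennreal (c powr \<alpha>) * ennreal (c powr - \<alpha>) = 1"
    using assms(2) by (simp add: ennreal_mult[symmetric] flip: powr_add)
  have "I_riesz \<alpha> A < ennreal (c powr \<alpha>) * I_riesz \<alpha> A'"
  proof -
    have "ennreal (c powr \<alpha>) * (ennreal (c powr - \<alpha>) * I_riesz \<alpha> A) < ennreal (c powr \<alpha>) * I_riesz \<alpha> A'"
      using less assms(2) by (intro ennreal_mult_strict_left_mono) auto
    then show ?thesis by (simp add: mult.assoc[symmetric] cc)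
  qed
  then obtain \<mu> where \<mu>: "prob_space \<mu>" "sets \<mu> = sets borel" "emeasure \<mu> A = 1"
    "riesz_energy \<alpha> \<mu> < ennreal (c powr \<alpha>) * I_riesz \<alpha> A'"
    using I_riesz_prob[OF _ A(1)] by blast
  interpret \<mu>: prob_space \<mu> by fact
  have \<Phi>': "\<Phi> \<in> measurable \<mu> borel" using \<Phi> \<mu>(2) by (simp cong: measurable_cong_sets)
  define \<nu> where "\<nu> = distr \<mu> borel \<Phi>"
  interpret \<nu>: prob_space \<nu> unfolding \<nu>_def by (rule \<mu>.prob_space_distr[OF \<Phi>'])
  have sp: "space \<mu> = UNIV" using sets_eq_imp_space_eq[OF \<mu>(2)] by simp
  have "AE x in \<mu>. x \<in> A"
    using \<mu>(3) A(1) \<mu>(2) by (subst \<mu>.AE_in_set_eq_1) (auto simp: measure_def)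
  note AE = this
  have nA: "emeasure \<nu> A' = 1"
  proof -
    have "AE x in \<mu>. \<Phi> x \<in> A'" using AE by eventually_elim (rule sub)
    then have "AE y in \<nu>. y \<in> A'" unfolding \<nu>_def using \<Phi>' A(2) by (subst AE_distr_iff) auto
    moreover have "A' \<in> sets \<nu>" using A(2) by (simp add: \<nu>_def)
    ultimately show ?thesis using \<nu>.AE_in_set_eq_1[of A'] by (simp add: \<nu>.emeasure_eq_measure)
  qed
  have pm: "(\<lambda>x. \<integral>\<^sup>+y. riesz_kernel \<alpha> x y \<partial>\<nu>) \<in> borel_measurable borel"
    using \<nu>.finite_measure_axioms by (rule riesz_potential_measurable) (simp add: \<nu>_def)
  have "riesz_energy \<alpha> \<nu> = (\<integral>\<^sup>+x. (\<integral>\<^sup>+y. riesz_kernel \<alpha> (\<Phi> x) y \<partial>\<nu>) \<partial>\<mu>)"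
    unfolding riesz_energy_kernel by (subst \<nu>_def, subst nn_integral_distr) (use \<Phi>' pm in auto)
  also have "\<dots> = (\<integral>\<^sup>+x. (\<integral>\<^sup>+y. riesz_kernel \<alpha> (\<Phi> x) (\<Phi> y) \<partial>\<mu>) \<partial>\<mu>)"
    unfolding \<nu>_def using \<Phi>' by (intro nn_integral_cong nn_integral_distr) auto
  also have "\<dots> \<le> (\<integral>\<^sup>+x. (ennreal (c powr - \<alpha>) * (\<integral>\<^sup>+y. riesz_kernel \<alpha> x y \<partial>\<mu>)) \<partial>\<mu>)"
  proof (rule nn_integral_mono_AE)
    show "AE x in \<mu>. (\<integral>\<^sup>+y. riesz_kernel \<alpha> (\<Phi> x) (\<Phi> y) \<partial>\<mu>) \<le> ennreal (c powr - \<alpha>) * (\<integral>\<^sup>+y. riesz_kernel \<alpha> x y \<partial>\<mu>)"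
      using AE
    proof eventually_elim
      case (elim x)
      have "riesz_kernel \<alpha> x \<in> borel_measurable \<mu>" 
        using riesz_kernel_measurable2[of \<alpha> x] \<mu>(2) by (simp cong: measurable_cong_sets)
      then have "ennreal (c powr - \<alpha>) * (\<integral>\<^sup>+y. riesz_kernel \<alpha> x y \<partial>\<mu>) = (\<integral>\<^sup>+y. ennreal (c powr - \<alpha>) * riesz_kernel \<alpha> x y \<partial>\<mu>)"
        by (subst nn_integral_cmult) auto
      moreover have "(\<integral>\<^sup>+y. riesz_kernel \<alpha> (\<Phi> x) (\<Phi> y) \<partial>\<mu>) \<le> (\<integral>\<^sup>+y. ennreal (c powr - \<alpha>) * riesz_kernel \<alpha> x y \<partial>\<mu>)"
        by (rule nn_integral_mono_AE, use AE in eventually_elim) (intro riesz_kernel_expand assms elim)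
      ultimately show ?case by simp
    qed
  qed
  also have "\<dots> = ennreal (c powr - \<alpha>) * riesz_energy \<alpha> \<mu>"
    using riesz_potential_measurable[of \<mu> \<alpha>] \<mu> \<mu>.finite_measure_axioms
    unfolding riesz_energy_kernel by (subst nn_integral_cmult) (simp_all cong: measurable_cong_sets)
  also have "\<dots> < ennreal (c powr - \<alpha>) * (ennreal (c powr \<alpha>) * I_riesz \<alpha> A')"
    using \<mu>(4) assms(2) by (intro ennreal_mult_strict_left_mono) auto
  also have "\<dots> = I_riesz \<alpha> A'" using cc by (metis mult.assoc mult.commute mult_1)
  also have "\<dots> \<le> riesz_energy \<alpha> \<nu>"
    using nA by (intro I_riesz_le_energy) (simp_all add: \<nu>_def)
  finally show False by simp
qed

text \<open>A charge of mass one on \<open>A\<close> cannot vanish on every member of a finite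
  cover. On a member that it charges, normalising to mass one multiplies the energy by a finite
  factor.\<close>

lemma I_riesz_localize:
  fixes A :: "'a::euclidean_space set"
  assumes "I_riesz \<alpha> A < \<infinity>" "finite S" "A \<subseteq> (\<Union>i\<in>S. B i)" and A: "A \<in> sets borel" and B: "\<And>i. i \<in> S \<Longrightarrow> B i \<in> sets borel"
  obtains i where "i \<in> S" "I_riesz \<alpha> (A \<inter> B i) < \<infinity>"
proof -
  obtain \<mu> where \<mu>: "prob_space \<mu>" "sets \<mu> = sets borel" "emeasure \<mu> A = 1" "riesz_energy \<alpha> \<mu> < \<infinity>"
    using I_riesz_prob[OF assms(1) A] by blast
  interpret \<mu>: prob_space \<mu> by fact
  have "\<exists>i\<in>S. emeasure \<mu> (A \<inter> B i) \<noteq> 0"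
  proof (rule ccontr)
    assume "\<not> ?thesis"
    then have "(\<Sum>i\<in>S. emeasure \<mu> (A \<inter> B i)) = 0" by simp
    moreover have "emeasure \<mu> (\<Union>i\<in>S. A \<inter> B i) \<le> (\<Sum>i\<in>S. emeasure \<mu> (A \<inter> B i))"
      using A B \<mu>(2) assms(2) by (intro emeasure_subadditive_finite) auto
    moreover have "(\<Union>i\<in>S. A \<inter> B i) = A" using assms(3) by auto
    ultimately show False using \<mu>(3) by simp
  qed
  then obtain i where i: "i \<in> S" "emeasure \<mu> (A \<inter> B i) \<noteq> 0" by blast
  define p where "p = measure \<mu> (A \<inter> B i)"
  have p: "p > 0" "emeasure \<mu> (A \<inter> B i) = ennreal p"
    using i(2) by (auto simp: p_def \<mu>.emeasure_eq_measure zero_less_measure_iff)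
  \<comment> \<open>The charge is rescaled but not restricted, as \<open>I_riesz\<close> only asks
    for mass one on the piece.\<close>
  define \<nu> where "\<nu> = scale_measure (ennreal (1 / p)) \<mu>"
  have sn: "sets \<nu> = sets borel" by (simp add: \<nu>_def \<mu>)
  have "emeasure \<nu> (A \<inter> B i) = 1"
    using p by (simp add: \<nu>_def ennreal_mult[symmetric])
  then have "I_riesz \<alpha> (A \<inter> B i) \<le> riesz_energy \<alpha> \<nu>" using sn by (intro I_riesz_le_energy)
  also have "riesz_energy \<alpha> \<nu> = ennreal (1 / p) * (ennreal (1 / p) * riesz_energy \<alpha> \<mu>)"
  proof -
    let ?c = "ennreal (1 / p)"
    have km: "riesz_kernel \<alpha> x \<in> borel_measurable \<mu>" for x
      using riesz_kernel_measurable2[of \<alpha> x] \<mu>(2) by (simp cong: measurable_cong_sets)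
    have pm: "(\<lambda>x. \<integral>\<^sup>+y. riesz_kernel \<alpha> x y \<partial>\<mu>) \<in> borel_measurable \<mu>"
      using riesz_potential_measurable[of \<mu> \<alpha>] \<mu> \<mu>.finite_measure_axioms by (simp cong: measurable_cong_sets)
    have "riesz_energy \<alpha> \<nu> = (\<integral>\<^sup>+x. (?c * (\<integral>\<^sup>+y. riesz_kernel \<alpha> x y \<partial>\<mu>)) \<partial>\<nu>)"
      unfolding riesz_energy_kernel \<nu>_def by (intro nn_integral_cong nn_integral_scale_measure km)
    also have "\<dots> = ?c * (\<integral>\<^sup>+x. (?c * (\<integral>\<^sup>+y. riesz_kernel \<alpha> x y \<partial>\<mu>)) \<partial>\<mu>)"
      unfolding \<nu>_def by (rule nn_integral_scale_measure[OF borel_measurable_times_ennreal[OF borel_measurable_const pm]])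
    also have "(\<integral>\<^sup>+x. (?c * (\<integral>\<^sup>+y. riesz_kernel \<alpha> x y \<partial>\<mu>)) \<partial>\<mu>) = ?c * riesz_energy \<alpha> \<mu>"
      unfolding riesz_energy_kernel using pm by (rule nn_integral_cmult)
    finally show ?thesis .
  qed
  also have "\<dots> < \<infinity>" using \<mu>(4) by (simp add: ennreal_mult_less_top)
  finally show ?thesis using that i by blast
qed

text \<open>Dyadic decomposition: for \<open>z\<close> between the radii \<open>r (Suc k)\<close>
  and \<open>r k\<close> the kernel is at most \<open>2 powr (k * \<alpha>)\<close>, while the
  volume of the ball of radius \<open>r k\<close> decays with the power \<open>DIM('a)\<close> of
  its radius. The resulting geometric series has ratio \<open>q\<close>, which is below 1 because
  \<open>\<alpha>\<close> is below the dimension.\<close>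

lemma nn_integral_norm_powr_cball:
  fixes \<alpha> :: real
  assumes "0 \<le> \<alpha>" "\<alpha> < DIM('a::euclidean_space)"
  shows "(\<integral>\<^sup>+z. indicator (cball (0::'a) 2) z * (1 / ennreal (norm z powr \<alpha>)) \<partial>lborel) < \<infinity>"
proof -
  let ?d = "DIM('a)"
  define q where "q = 2 powr (\<alpha> - ?d)"
  have q: "0 < q" "q < 1" using assms powr_less_mono[of "\<alpha> - ?d" 0 2] by (auto simp: q_def)
  define w where "w = unit_ball_vol (real ?d)"
  have w: "w \<ge> 0" by (simp add: w_def)
  define r where "r = (\<lambda>k::nat. 2 * (1/2) ^ k :: real)"
  define g where "g = (\<lambda>k (z::'a). ennreal (2 powr (k * \<alpha>)) * indicator (cball 0 (r k)) z)"
  have gm: "g k \<in> borel_measurable lborel" for k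
    unfolding g_def by (intro borel_measurable_times_ennreal borel_measurable_indicator) simp_all
  have r2: "r k = 2 * 2 powr (- real k)" for k
    by (simp add: r_def powr_minus_divide powr_realpow power_one_over)
  have r3: "r (Suc k) = 2 powr (- real k)" for k
    by (simp add: r_def powr_minus_divide powr_realpow power_one_over)
  have pt: "indicator (cball (0::'a) 2) z * (1 / ennreal (norm z powr \<alpha>)) \<le> (\<Sum>k. g k z)" if "z \<noteq> 0" for z
  proof (cases "norm z \<le> 2")
    case True
    have "\<exists>k. r (Suc k) < norm z"
      using real_arch_pow_inv[of "norm z" "1/2"] that unfolding r_def by simp
    \<comment> \<open>The least such \<open>k\<close> selects the dyadic shell that contains
      \<open>z\<close>.\<close>
    define k where "k = (LEAST k. r (Suc k) < norm z)"
    have k1: "r (Suc k) < norm z" unfolding k_def using \<open>\<exists>k. _\<close> by (rule LeastI_ex)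
    have k2: "norm z \<le> r k"
    proof (cases k)
      case 0 then show ?thesis using True by (simp add: r_def)
    next
      case (Suc j)
      then have "\<not> r (Suc j) < norm z" using not_less_Least[of j "\<lambda>k. r (Suc k) < norm z"] by (simp add: k_def)
      then show ?thesis using Suc by simp
    qed
    note rS = r3[of k]
    have "2 powr (- real k * \<alpha>) \<le> norm z powr \<alpha>"
      using k1 assms powr_mono2[of \<alpha> "2 powr (- real k)" "norm z"] by (simp add: rS powr_powr)
    then have "1 / (norm z powr \<alpha>) \<le> 1 / (2 powr (- real k * \<alpha>))"
      using that by (intro divide_left_mono) auto
    also have "\<dots> = 2 powr (k * \<alpha>)" by (simp add: powr_minus field_simps)
    finally have "1 / ennreal (norm z powr \<alpha>) \<le> g k z"
      using that k2 divide_ennreal[of 1 "norm z powr \<alpha>"] by (simp add: g_def ennreal_leI)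
    also have "\<dots> \<le> (\<Sum>k. g k z)"
      using sum_le_suminf[of "\<lambda>k. g k z" "{k}"] by simp
    finally show ?thesis using True by simp
  qed simp
  have "(\<integral>\<^sup>+z. indicator (cball (0::'a) 2) z * (1 / ennreal (norm z powr \<alpha>)) \<partial>lborel) \<le> (\<integral>\<^sup>+z. (\<Sum>k. g k z) \<partial>lborel)"
  proof (rule nn_integral_mono_AE)
    have "AE z in lborel. z \<noteq> (0::'a)" by (rule AE_lborel_singleton)
    then show "AE z in lborel. indicator (cball (0::'a) 2) z * (1 / ennreal (norm z powr \<alpha>)) \<le> (\<Sum>k. g k z)"
      by eventually_elim (rule pt)
  qed
  also have "\<dots> = (\<Sum>k. \<integral>\<^sup>+z. g k z \<partial>lborel)" by (rule nn_integral_suminf[OF gm])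
  also have "\<dots> = (\<Sum>k. ennreal (w * 2 ^ ?d * q ^ k))"
  proof (rule suminf_cong)
    fix k
    have "(\<integral>\<^sup>+z. g k z \<partial>lborel) = ennreal (2 powr (k * \<alpha>)) * emeasure lborel (cball (0::'a) (r k))"
      unfolding g_def by (rule nn_integral_cmult_indicator) simp
    also have "\<dots> = ennreal (2 powr (k * \<alpha>) * (w * r k ^ ?d))"
      by (subst emeasure_cball) (auto simp: r_def w_def ennreal_mult)
    also have "r k ^ ?d = 2 ^ ?d * 2 powr (- real k * ?d)"
      by (simp add: r2 power_mult_distrib powr_power mult.commute)
    also have "2 powr (k * \<alpha>) * (w * (2 ^ ?d * 2 powr (- real k * ?d))) = w * 2 ^ ?d * (2 powr (k * \<alpha>) * 2 powr (- real k * ?d))"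
      by simp
    also have "2 powr (k * \<alpha>) * 2 powr (- real k * ?d) = 2 powr ((\<alpha> - ?d) * k)"
      by (subst powr_add[symmetric]) (simp add: algebra_simps)
    also have "2 powr ((\<alpha> - ?d) * k) = q ^ k" by (simp add: q_def powr_power mult.commute)
    finally show "(\<integral>\<^sup>+z. g k z \<partial>lborel) = ennreal (w * 2 ^ ?d * q ^ k)" .
  qed
  also have "\<dots> = ennreal (\<Sum>k. w * 2 ^ ?d * q ^ k)"
  proof (rule suminf_ennreal2)
    show "summable (\<lambda>k. w * 2 ^ ?d * q ^ k)" using q by (simp add: summable_mult summable_geometric)
    show "0 \<le> w * 2 ^ ?d * q ^ k" for k using q w by simp
  qed
  finally have "(\<integral>\<^sup>+z. indicator (cball (0::'a) 2) z * (1 / ennreal (norm z powr \<alpha>)) \<partial>lborel)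
      \<le> ennreal (\<Sum>k. w * 2 ^ ?d * q ^ k)" .
  then show ?thesis by (rule le_less_trans) simp
qed

text \<open>The uniform charge has finite energy: its potential at a point of the unit ball is
  bounded by the integral of the kernel over the ball of radius 2 about that point, up to the
  normalising factor, and this integral is the same for all points.\<close>

lemma I_riesz_cball_finite:
  fixes \<alpha> :: real
  assumes "0 < \<alpha>" "\<alpha> < DIM('a::euclidean_space)"
  shows "I_riesz \<alpha> (cball (0::'a) 1) < \<infinity>"
proof -
  define w where "w = measure lborel (cball (0::'a) 1)"
  have w: "w > 0" "emeasure lborel (cball (0::'a) 1) = ennreal w"
    using content_cball_gt_0_iff[of 0 1] emeasure_eq_ennreal_measure[of lborel "cball (0::'a) 1"] emeasure_lborel_cball_finite[of "0::'a" 1]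
    by (auto simp: w_def)
  define \<mu> where "\<mu> = density lborel (\<lambda>x. ennreal (1 / w) * indicator (cball (0::'a) 1) x)"
  define C where "C = (\<integral>\<^sup>+z. indicator (cball (0::'a) 2) z * (1 / ennreal (norm z powr \<alpha>)) \<partial>lborel)"
  have C: "C < \<infinity>" unfolding C_def using assms by (intro nn_integral_norm_powr_cball) auto
  have sm: "sets \<mu> = sets borel" by (simp add: \<mu>_def)
  define h where "h = (\<lambda>x. \<integral>\<^sup>+y. riesz_kernel \<alpha> x y \<partial>\<mu>)"
  have dm: "(\<lambda>x. ennreal (1 / w) * indicator (cball (0::'a) 1) x) \<in> borel_measurable lborel"
    by (intro borel_measurable_times_ennreal borel_measurable_indicator) simp_all
  have "emeasure \<mu> (cball 0 1) = 1"
  proof -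
    have "emeasure \<mu> (cball 0 1) = (\<integral>\<^sup>+x. ennreal (1 / w) * indicator (cball (0::'a) 1) x \<partial>lborel)"
      unfolding \<mu>_def by (subst emeasure_density) (auto intro!: nn_integral_cong simp: indicator_def)
    then show ?thesis using w by (simp add: nn_integral_cmult_indicator ennreal_mult[symmetric])
  qed
  then have "I_riesz \<alpha> (cball (0::'a) 1) \<le> riesz_energy \<alpha> \<mu>" by (rule I_riesz_le_energy[OF sm])
  also have "riesz_energy \<alpha> \<mu> = (\<integral>\<^sup>+x. ennreal (1 / w) * indicator (cball 0 1) x * (\<integral>\<^sup>+y. riesz_kernel \<alpha> x y \<partial>\<mu>) \<partial>lborel)"
  proof -
    have "emeasure \<mu> UNIV = 1"
    proof -
      have "emeasure \<mu> UNIV = (\<integral>\<^sup>+x. ennreal (1 / w) * indicator (cball (0::'a) 1) x \<partial>lborel)"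
        unfolding \<mu>_def by (subst emeasure_density) (auto intro!: borel_measurable_times_ennreal borel_measurable_indicator)
      then show ?thesis using w by (simp add: nn_integral_cmult_indicator ennreal_mult[symmetric])
    qed
    then have "finite_measure \<mu>" by (intro finite_measureI) (simp add: \<mu>_def)
    from riesz_potential_measurable[OF this sm, of \<alpha>]
    have hm: "h \<in> borel_measurable lborel" by (simp add: h_def)
    have "integral\<^sup>N \<mu> h = (\<integral>\<^sup>+x. ennreal (1 / w) * indicator (cball 0 1) x * h x \<partial>lborel)"
      unfolding \<mu>_def by (rule nn_integral_density[OF dm hm])
    then show ?thesis by (simp add: riesz_energy_kernel h_def)
  qed
  also have "\<dots> \<le> (\<integral>\<^sup>+x. ennreal (1 / w) * indicator (cball (0::'a) 1) x * (ennreal (1 / w) * C) \<partial>lborel)"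
  proof (rule nn_integral_mono)
    fix x :: 'a
    show "ennreal (1 / w) * indicator (cball 0 1) x * (\<integral>\<^sup>+y. riesz_kernel \<alpha> x y \<partial>\<mu>) \<le> ennreal (1 / w) * indicator (cball (0::'a) 1) x * (ennreal (1 / w) * C)"
    proof (cases "norm x \<le> 1")
      case True
      have "(\<integral>\<^sup>+y. riesz_kernel \<alpha> x y \<partial>\<mu>) = (\<integral>\<^sup>+y. ennreal (1 / w) * (indicator (cball 0 1) y * riesz_kernel \<alpha> x y) \<partial>lborel)"
        unfolding \<mu>_def by (subst nn_integral_density[OF dm]) (auto simp: mult.assoc)
      also have "\<dots> = ennreal (1 / w) * (\<integral>\<^sup>+y. indicator (cball 0 1) y * riesz_kernel \<alpha> x y \<partial>lborel)"
        by (rule nn_integral_cmult, intro borel_measurable_times_ennreal borel_measurable_indicator) simp_all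
      finally have e1: "(\<integral>\<^sup>+y. riesz_kernel \<alpha> x y \<partial>\<mu>)
          = ennreal (1 / w) * (\<integral>\<^sup>+y. indicator (cball 0 1) y * riesz_kernel \<alpha> x y \<partial>lborel)" .
      have "(\<integral>\<^sup>+y. indicator (cball 0 1) y * riesz_kernel \<alpha> x y \<partial>lborel) \<le>
          (\<integral>\<^sup>+y. indicator (cball (0::'a) 2) (-x + y) * (1 / ennreal (norm (-x + y) powr \<alpha>)) \<partial>lborel)"
      proof (rule nn_integral_mono)
        fix y :: 'a
        have "norm (-x + y) \<le> 2" if "norm y \<le> 1" using that True norm_triangle_ineq[of "-x" y] by simp
        then show "indicator (cball 0 1) y * riesz_kernel \<alpha> x y \<le> indicator (cball (0::'a) 2) (-x + y) * (1 / ennreal (norm (-x + y) powr \<alpha>))"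
          by (auto simp: indicator_def riesz_kernel_def norm_minus_commute)
      qed
      also have "\<dots> = (\<integral>\<^sup>+z. indicator (cball (0::'a) 2) z * (1 / ennreal (norm z powr \<alpha>)) \<partial>distr lborel borel ((+) (-x)))"
      proof (rule nn_integral_distr[symmetric])
        have "(\<lambda>z::'a. 1 / ennreal (norm z powr \<alpha>)) \<in> borel_measurable borel" by measurable
        then have "(\<lambda>z. indicator (cball (0::'a) 2) z * (1 / ennreal (norm z powr \<alpha>))) \<in> borel_measurable borel"
          by (intro borel_measurable_times_ennreal borel_measurable_indicator) simp_all
        then show "(\<lambda>z. indicator (cball (0::'a) 2) z * (1 / ennreal (norm z powr \<alpha>))) \<in> borel_measurable (distr lborel borel ((+) (- x)))"
          by simp
      qed simp
      also have "\<dots> = C" by (simp add: lborel_distr_plus C_def)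
      finally show ?thesis unfolding e1 by (intro mult_left_mono) auto
    qed simp
  qed
  also have "\<dots> = (\<integral>\<^sup>+x. ennreal (1 / w) * (ennreal (1 / w) * C) * indicator (cball (0::'a) 1) x \<partial>lborel)"
    by (simp add: mult.assoc mult.commute mult.left_commute)
  also have "\<dots> = ennreal (1 / w) * (ennreal (1 / w) * C) * ennreal w"
    using w(2) by (subst nn_integral_cmult_indicator) simp_all
  finally show ?thesis using C by (elim le_less_trans) (simp add: ennreal_mult_less_top)
qed

section \<open>Weak compactness of probability measures\<close>

text \<open>Schoenberg's space-filling curve: its coordinates are binary expansions whose digits are values
  \<open>tri (3 ^ j * t)\<close>, and on the Cantor set \<open>tri (3 ^ j * t)\<close> is half the \<open>j\<close>-th ternary digit of \<open>t\<close>.\<close>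
definition tri :: "real \<Rightarrow> real" where
  "tri t = min 1 (max 0 (3 * infdist t (range (\<lambda>k::int. 2 * of_int k)) - 1))"

lemma continuous_tri: "continuous_on UNIV tri"
  unfolding tri_def[abs_def] by (intro continuous_intros)

lemma tri_bounds: "0 \<le> tri t" "tri t \<le> 1"
  by (auto simp: tri_def)

text \<open>\<open>tri\<close> is 0 within distance 1/3 of an even integer and 1 at distance at
  least 2/3, so it reads off the leading ternary digit \<open>2 * a\<close>; the later digits are
  collected in \<open>r\<close>.\<close>

lemma tri_digit:
  assumes "a \<in> {0, 1::nat}" "0 \<le> r" "r \<le> 1"
  shows "tri (2 * of_int N + (2 * real a + r) / 3) = real a"
proof -
  let ?Z = "range (\<lambda>k::int. 2 * of_int k) :: real set"
  consider "a = 0" | "a = 1" using assms by blast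
  then show ?thesis
  proof cases
    case 1
    have "infdist (2 * of_int N + r / 3) ?Z \<le> dist (2 * of_int N + r / 3) (2 * of_int N)"
      by (intro infdist_le) auto
    then show ?thesis using 1 assms by (auto simp: tri_def dist_real_def)
  next
    case 2
    have "2 / 3 \<le> infdist (2 * of_int N + (2 + r) / 3) ?Z"
    proof (subst infdist_notempty)
      show "?Z \<noteq> {}" by simp
      show "2 / 3 \<le> (INF a\<in>?Z. dist (2 * of_int N + (2 + r) / 3) a)"
      proof (rule cINF_greatest)
        fix z assume "z \<in> ?Z"
        then obtain k :: int where k: "z = 2 * of_int k" by blast
        have "k \<le> N \<or> k \<ge> N + 1" by linarith
        then show "2 / 3 \<le> dist (2 * of_int N + (2 + r) / 3) z"
        proof
          assume "k \<le> N"
          then have "real_of_int k \<le> of_int N" by simp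
          then show ?thesis using assms unfolding k dist_real_def by argo
        next
          assume "k \<ge> N + 1"
          then have "real_of_int k \<ge> of_int N + 1" by linarith
          then show ?thesis using assms unfolding k dist_real_def by argo
        qed
      qed simp
    qed
    then show ?thesis using 2 by (auto simp: tri_def)
  qed
qed

text \<open>The point of the Cantor set with ternary digits \<open>2 * a j\<close>.\<close>

definition cantor_sum :: "(nat \<Rightarrow> nat) \<Rightarrow> real" where
  "cantor_sum a = (\<Sum>j. 2 * real (a j) * (1/3) ^ Suc j)"

lemma cantor_summable:
  assumes "\<And>j. a j \<in> {0, 1::nat}"
  shows "summable (\<lambda>j. 2 * real (a j) * (1/3) ^ Suc j)"
proof (rule summable_comparison_test')
  show "summable (\<lambda>j. 2 * (1/3) ^ Suc j :: real)" by (intro summable_mult summable_Suc_iff[THEN iffD2] summable_geometric) simp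
  show "norm (2 * real (a j) * (1/3) ^ Suc j) \<le> 2 * (1/3) ^ Suc j" if "j \<ge> 0" for j
    using assms[of j] by auto
qed

lemma cantor_sum_bounds:
  assumes "\<And>j. a j \<in> {0, 1::nat}"
  shows "0 \<le> cantor_sum a" "cantor_sum a \<le> 1"
proof -
  show "0 \<le> cantor_sum a" unfolding cantor_sum_def by (intro suminf_nonneg cantor_summable assms) simp
  have s: "(\<lambda>j. 2 * (1/3) ^ Suc j :: real) sums 1"
    using sums_mult[OF geometric_sums[of "1/3::real"], of "2/3"] by simp
  have "cantor_sum a \<le> (\<Sum>j. 2 * (1/3) ^ Suc j)"
    unfolding cantor_sum_def
  proof (intro suminf_le cantor_summable assms)
    show "2 * real (a j) * (1/3) ^ Suc j \<le> 2 * (1/3) ^ Suc j" for j using assms[of j] by auto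
    show "summable (\<lambda>j. 2 * (1/3) ^ Suc j :: real)" using s by (rule sums_summable)
  qed
  then show "cantor_sum a \<le> 1" using sums_unique[OF s] by simp
qed

lemma cantor_sum_step:
  assumes "\<And>j. a j \<in> {0, 1::nat}"
  shows "3 * cantor_sum a = 2 * real (a 0) + cantor_sum (\<lambda>j. a (Suc j))"
proof -
  have "cantor_sum a = 2 * real (a 0) * (1/3) + (\<Sum>j. 2 * real (a (Suc j)) * (1/3) ^ Suc (Suc j))"
    unfolding cantor_sum_def by (subst suminf_split_head[OF cantor_summable]) (use assms in auto)
  also have "(\<Sum>j. 2 * real (a (Suc j)) * (1/3) ^ Suc (Suc j)) = (\<Sum>j. (1/3) * (2 * real (a (Suc j)) * (1/3) ^ Suc j))"
    by (simp add: algebra_simps)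
  also have "\<dots> = (1/3) * cantor_sum (\<lambda>j. a (Suc j))"
    unfolding cantor_sum_def by (rule suminf_mult[OF cantor_summable]) (use assms in auto)
  finally show ?thesis by simp
qed

text \<open>Multiplication by \<open>3 ^ j\<close> turns the digits before place \<open>j\<close>
  into an even integer, which \<open>tri\<close> ignores, and moves digit \<open>j\<close> to the
  leading place.\<close>

lemma tri_cantor_sum:
  assumes a: "\<And>j. a j \<in> {0, 1::nat}"
  shows "tri (3 ^ j * cantor_sum a) = real (a j)"
proof -
  have "\<exists>N::int. 3 ^ j * cantor_sum a = 2 * of_int N + cantor_sum (\<lambda>i. a (j + i))"
  proof (induction j)
    case 0 show ?case by (intro exI[of _ 0]) simp
  next
    case (Suc j)
    then obtain N :: int where N: "3 ^ j * cantor_sum a = 2 * of_int N + cantor_sum (\<lambda>i. a (j + i))" by blast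
    have "3 ^ Suc j * cantor_sum a = 3 * (3 ^ j * cantor_sum a)" by simp
    also have "\<dots> = 6 * of_int N + 3 * cantor_sum (\<lambda>i. a (j + i))" unfolding N by simp
    also have "\<dots> = 2 * of_int (3 * N + int (a j)) + cantor_sum (\<lambda>i. a (Suc j + i))"
      using cantor_sum_step[of "\<lambda>i. a (j + i)"] a by simp
    finally show ?case by blast
  qed
  then obtain N :: int where N: "3 ^ j * cantor_sum a = 2 * of_int N + cantor_sum (\<lambda>i. a (j + i))" by blast
  have c3: "cantor_sum (\<lambda>i. a (j + i)) = (2 * real (a j) + cantor_sum (\<lambda>i. a (Suc j + i))) / 3"
    using cantor_sum_step[of "\<lambda>i. a (j + i)"] a by simp
  show ?thesis
    unfolding N c3 by (intro tri_digit a cantor_sum_bounds)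
qed

definition bit_digit :: "nat \<Rightarrow> real \<Rightarrow> nat" where
  "bit_digit k x = nat (\<lfloor>2 ^ Suc k * x\<rfloor> mod 2)"

lemma bit_digit_01: "bit_digit k x \<in> {0, 1}"
  unfolding bit_digit_def by auto

text \<open>The partial sums are the dyadic truncations of \<open>x\<close>. At \<open>x = 1\<close>
  every \<open>bit_digit\<close> is 0, so the upper bound has to be strict.\<close>

lemma binary_expansion:
  assumes "0 \<le> x" "x < 1"
  shows "(\<lambda>k. real (bit_digit k x) * (1/2) ^ Suc k) sums x"
proof -
  have part: "(\<Sum>k<n. real (bit_digit k x) * (1/2) ^ Suc k) = of_int \<lfloor>2 ^ n * x\<rfloor> / 2 ^ n" for n
  proof (induction n)
    case 0
    have "\<lfloor>x\<rfloor> = 0" using assms by (simp add: floor_eq_iff)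
    then show ?case by simp
  next
    case (Suc n)
    have "\<lfloor>2 ^ n * x\<rfloor> = \<lfloor>2 ^ Suc n * x\<rfloor> div 2"
      using floor_divide_real_eq_div[of 2 "2 ^ Suc n * x"] by simp
    then have "\<lfloor>2 ^ Suc n * x\<rfloor> = 2 * \<lfloor>2 ^ n * x\<rfloor> + int (bit_digit n x)"
      unfolding bit_digit_def by simp
    then have "real_of_int \<lfloor>2 ^ Suc n * x\<rfloor> = 2 * of_int \<lfloor>2 ^ n * x\<rfloor> + real (bit_digit n x)" by simp
    then show ?case using Suc by (simp add: field_simps)
  qed
  have "(\<lambda>n. of_int \<lfloor>2 ^ n * x\<rfloor> / 2 ^ n) \<longlonglongrightarrow> x"
  proof (rule tendsto_sandwich)
    have "(\<lambda>n. (1/2) ^ n :: real) \<longlonglongrightarrow> 0" by (rule LIMSEQ_power_zero) simp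
    from tendsto_diff[OF tendsto_const this, of x] show "(\<lambda>n. x - (1/2) ^ n) \<longlonglongrightarrow> x" by simp
    show "(\<lambda>n. x) \<longlonglongrightarrow> x" by simp
    have "x - (1/2) ^ n \<le> of_int \<lfloor>2 ^ n * x\<rfloor> / 2 ^ n" for n
    proof -
      have "2 ^ n * x - 1 \<le> of_int \<lfloor>2 ^ n * x\<rfloor>" by linarith
      then have "(2 ^ n * x - 1) / 2 ^ n \<le> of_int \<lfloor>2 ^ n * x\<rfloor> / 2 ^ n" by (intro divide_right_mono) auto
      then show ?thesis by (simp add: diff_divide_distrib power_one_over)
    qed
    then show "\<forall>\<^sub>F n in sequentially. x - (1/2) ^ n \<le> of_int \<lfloor>2 ^ n * x\<rfloor> / 2 ^ n" by simp
    have "of_int \<lfloor>2 ^ n * x\<rfloor> / 2 ^ n \<le> x" for n :: nat by (simp add: divide_le_eq mult.commute)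
    then show "\<forall>\<^sub>F n in sequentially. of_int \<lfloor>2 ^ n * x\<rfloor> / 2 ^ n \<le> x" by simp
  qed
  then show ?thesis unfolding sums_def part .
qed

text \<open>Measures travel to the line along the right inverse \<open>s\<close>, which only has to
  be measurable, and their weak limit travels back along \<open>g\<close>, which has to be
  continuous.\<close>

lemma space_filling_curve:
  fixes R :: real
  assumes "R > 0"
  obtains g :: "real \<Rightarrow> 'a::euclidean_space" and s where
    "continuous_on UNIV g" "s \<in> borel_measurable borel" "\<And>x. 0 \<le> s x \<and> s x \<le> 1"
    "\<And>x. norm x \<le> R \<Longrightarrow> g (s x) = x"
proof -
  let ?d = "DIM('a)"
  obtain e :: "nat \<Rightarrow> 'a" where e: "bij_betw e {0..<?d} Basis"
    using ex_bij_betw_nat_finite[OF finite_Basis] by blast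
  define ix where "ix = inv_into {0..<?d} e"
  have ix: "ix b < ?d" "e (ix b) = b" if "b \<in> Basis" for b
    using that e bij_betw_inv_into_right[OF e that] inv_into_into[of b e "{0..<?d}"]
    by (auto simp: ix_def bij_betw_def)
  \<comment> \<open>The denominator \<open>2 * R + 1\<close> instead of \<open>2 * R\<close> keeps
    the rescaled coordinates strictly below 1, as the binary expansion requires.\<close>
  define n where "n = (\<lambda>b x. ((x::'a) \<bullet> b + R) / (2 * R + 1))"
  have n01: "0 \<le> n b x" "n b x < 1" if "norm x \<le> R" "b \<in> Basis" for b x
  proof -
    have "\<bar>x \<bullet> b\<bar> \<le> R" using that Basis_le_norm[of b x] by linarith
    then show "0 \<le> n b x" "n b x < 1" using assms by (auto simp: n_def field_simps)
  qed
  \<comment> \<open>The binary digits of the coordinates are interleaved: place \<open>j\<close>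
    holds digit \<open>j div ?d\<close> of coordinate \<open>j mod ?d\<close>.\<close>
  define a where "a = (\<lambda>x j. bit_digit (j div ?d) (n (e (j mod ?d)) x))"
  have a: "a x j \<in> {0, 1}" for x j unfolding a_def by (rule bit_digit_01)
  define s where "s = (\<lambda>x. cantor_sum (a x))"
  define G where "G = (\<lambda>b t. \<Sum>k. tri (3 ^ (?d * k + ix b) * t) * (1/2) ^ Suc k)"
  define g where "g = (\<lambda>t. \<Sum>b\<in>Basis. ((2 * R + 1) * G b t - R) *\<^sub>R b :: 'a)"
  have smble: "s \<in> borel_measurable borel"
    unfolding s_def cantor_sum_def a_def bit_digit_def n_def by measurable
  have contG: "continuous_on UNIV (G b)" for b
  proof -
    have "uniform_limit UNIV (\<lambda>N t. \<Sum>k<N. tri (3 ^ (?d * k + ix b) * t) * (1/2) ^ Suc k) (G b) sequentially"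
      unfolding G_def
    proof (rule Weierstrass_m_test)
      show "norm (tri (3 ^ (?d * k + ix b) * t) * (1/2) ^ Suc k) \<le> (1/2) ^ Suc k" for k t
        using tri_bounds[of "3 ^ (?d * k + ix b) * t"] by (simp add: abs_mult mult_left_le_one_le)
      show "summable (\<lambda>k. (1/2) ^ Suc k :: real)" by (intro summable_Suc_iff[THEN iffD2] summable_geometric) simp
    qed
    moreover have "continuous_on UNIV (\<lambda>t. \<Sum>k<N. tri (3 ^ (?d * k + ix b) * t) * (1/2) ^ Suc k)" for N
      by (intro continuous_intros continuous_on_compose2[OF continuous_tri]) auto
    ultimately show ?thesis
      by (intro uniform_limit_theorem[of _ _ _ "G b"]) auto
  qed
  have cont: "continuous_on UNIV g" unfolding g_def by (intro continuous_intros contG)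
  have gs: "g (s x) = x" if x: "norm x \<le> R" for x
  proof -
    have "G b (s x) = n b x" if b: "b \<in> Basis" for b
    proof -
      have "tri (3 ^ (?d * k + ix b) * s x) = real (bit_digit k (n b x))" for k
      proof -
        have "tri (3 ^ (?d * k + ix b) * s x) = real (a x (?d * k + ix b))"
          unfolding s_def by (rule tri_cantor_sum[OF a])
        also have "a x (?d * k + ix b) = bit_digit k (n b x)" unfolding a_def using ix[OF b] by simp
        finally show ?thesis .
      qed
      then show ?thesis unfolding G_def using sums_unique[OF binary_expansion[OF n01[OF x b]]] by simp
    qed
    then have "g (s x) = (\<Sum>b\<in>Basis. ((2 * R + 1) * n b x - R) *\<^sub>R b)" unfolding g_def by simp
    also have "\<dots> = (\<Sum>b\<in>Basis. (x \<bullet> b) *\<^sub>R b)"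
      using assms by (intro sum.cong) (auto simp: n_def)
    finally show ?thesis by (simp add: euclidean_representation)
  qed
  show ?thesis
    by (rule that[OF cont smble _ gs]) (auto simp: s_def intro!: cantor_sum_bounds a)
qed

text \<open>The measures are transported to the real line along the space-filling curve, where Helly's
  theorem applies.\<close>
lemma weak_convergent_subsequence:
  fixes \<mu> :: "nat \<Rightarrow> 'a::euclidean_space measure"
  assumes p: "\<And>n. prob_space (\<mu> n)" and s: "\<And>n. sets (\<mu> n) = sets borel"
    and R: "\<And>n. AE x in \<mu> n. norm x \<le> R"
  obtains r \<nu> where "strict_mono r" "prob_space \<nu>" "sets \<nu> = sets borel"
    "\<forall>f :: 'a \<Rightarrow> real. \<forall>B. continuous_on UNIV f \<longrightarrow> (\<forall>x. \<bar>f x\<bar> \<le> B) \<longrightarrow>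
      (\<lambda>n. integral\<^sup>L (\<mu> (r n)) f) \<longlonglongrightarrow> integral\<^sup>L \<nu> f"
proof -
  have "0 < max R 1" by simp
  then obtain g :: "real \<Rightarrow> 'a" and e where ge: "continuous_on UNIV g" "e \<in> borel_measurable borel"
    "\<And>x. 0 \<le> e x \<and> e x \<le> 1" "\<And>x. norm x \<le> max R 1 \<Longrightarrow> g (e x) = x"
    using space_filling_curve by blast
  have em: "e \<in> borel_measurable (\<mu> n)" for n using ge(2) s[of n] by (simp cong: measurable_cong_sets)
  have gm: "g \<in> borel_measurable borel" using ge(1) by (rule borel_measurable_continuous_onI)
  define N where "N = (\<lambda>n. distr (\<mu> n) borel e)"
  have rd: "real_distribution (N n)" for n
    unfolding N_def using p[of n] em[of n]
    by (intro real_distribution.intro real_distribution_axioms.intro prob_space.prob_space_distr) auto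
  have tight: "tight N"
    unfolding tight_def
  proof (intro conjI allI impI rd)
    fix \<epsilon> :: real assume "\<epsilon> > 0"
    \<comment> \<open>The transported measures live on the closed unit interval, which gives
      tightness. The interval starts at -1 because it is open on the left, while the point 0 may
      carry mass.\<close>
    have "measure (N n) {-1<..1} = 1" for n
    proof -
      have "-1 < e x \<and> e x \<le> 1" for x using ge(3)[of x] by auto
      then have "e -` {-1<..1} \<inter> space (\<mu> n) = space (\<mu> n)" by auto
      then show ?thesis unfolding N_def using em[of n] prob_space.prob_space[OF p[of n]]
        by (subst measure_distr) auto
    qed
    then show "\<exists>a b. a < b \<and> (\<forall>n. measure (N n) {a<..b} > 1 - \<epsilon>)"
      using \<open>\<epsilon> > 0\<close> by (intro exI[of _ "-1"] exI[of _ 1]) auto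
  qed
  obtain r M where r: "strict_mono (r :: nat \<Rightarrow> nat)" "real_distribution M" "weak_conv_m (N \<circ> id \<circ> r) M"
    using tight_imp_convergent_subsubsequence[OF tight, of id] by (auto simp: strict_mono_def)
  interpret M: real_distribution M by fact
  define \<nu> where "\<nu> = distr M borel g"
  have gM: "g \<in> borel_measurable M" using gm by (simp cong: measurable_cong_sets)
  show ?thesis
  proof (rule that[OF r(1)])
    show "prob_space \<nu>" unfolding \<nu>_def by (rule M.prob_space_distr[OF gM])
    show "sets \<nu> = sets borel" by (simp add: \<nu>_def)
    show "\<forall>f :: 'a \<Rightarrow> real. \<forall>B. continuous_on UNIV f \<longrightarrow> (\<forall>x. \<bar>f x\<bar> \<le> B) \<longrightarrow>
      (\<lambda>n. integral\<^sup>L (\<mu> (r n)) f) \<longlonglongrightarrow> integral\<^sup>L \<nu> f"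
    proof (intro allI impI)
      fix f :: "'a \<Rightarrow> real" and B assume f: "continuous_on UNIV f" "\<forall>x. \<bar>f x\<bar> \<le> B"
      have fm: "f \<in> borel_measurable borel" using f(1) by (rule borel_measurable_continuous_onI)
      have cfg: "continuous_on UNIV (\<lambda>t. f (g t))"
        using continuous_on_compose2[OF f(1) ge(1)] by simp
      have "(\<lambda>n. integral\<^sup>L ((N \<circ> id \<circ> r) n) (\<lambda>t. f (g t))) \<longlonglongrightarrow> integral\<^sup>L M (\<lambda>t. f (g t))"
      proof (rule weak_conv_imp_integral_bdd_continuous_conv[OF _ r(2,3)])
        show "real_distribution ((N \<circ> id \<circ> r) n)" for n using rd by simp
        show "isCont (\<lambda>t. f (g t)) x" for x using cfg by (simp add: continuous_on_eq_continuous_at)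
        show "norm (f (g x)) \<le> B" for x using f(2) by simp
      qed
      moreover have "integral\<^sup>L M (\<lambda>t. f (g t)) = integral\<^sup>L \<nu> f"
        unfolding \<nu>_def by (rule integral_distr[OF gM fm, symmetric])
      moreover have "integral\<^sup>L ((N \<circ> id \<circ> r) n) (\<lambda>t. f (g t)) = integral\<^sup>L (\<mu> (r n)) f" for n
      proof -
        have "integral\<^sup>L (N (r n)) (\<lambda>t. f (g t)) = integral\<^sup>L (\<mu> (r n)) (\<lambda>x. f (g (e x)))"
          unfolding N_def by (rule integral_distr[OF em measurable_compose[OF gm fm]])
        also have "\<dots> = integral\<^sup>L (\<mu> (r n)) f"
        proof (rule integral_cong_AE)
          show "(\<lambda>x. f (g (e x))) \<in> borel_measurable (\<mu> (r n))" 
            using measurable_compose[OF measurable_compose[OF em gm] fm] .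
          show "f \<in> borel_measurable (\<mu> (r n))" using fm s by (simp cong: measurable_cong_sets)
          \<comment> \<open>The round trip through the line is the identity on the ball that carries
            the measures.\<close>
          show "AE x in \<mu> (r n). f (g (e x)) = f x" using R[of "r n"]
            by eventually_elim (simp add: ge(4) max.coboundedI1)
        qed
        finally show ?thesis by simp
      qed
      ultimately show "(\<lambda>n. integral\<^sup>L (\<mu> (r n)) f) \<longlonglongrightarrow> integral\<^sup>L \<nu> f" by simp
    qed
  qed
qed

text \<open>Around each point outside \<open>A'\<close> there is a ball that the sets
  \<open>A n\<close> eventually avoid. A tent function on this ball has limit integral 0, so the
  limit measure does not charge the ball. By Lindelof, countably many such balls cover the
  complement of \<open>A'\<close>.\<close>

lemma weak_limit_support:
  fixes \<mu> :: "nat \<Rightarrow> 'a::euclidean_space measure"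
  assumes p: "prob_space \<nu>" and s: "sets \<nu> = sets borel"
    and lim: "\<And>f :: 'a \<Rightarrow> real. \<And>B. continuous_on UNIV f \<Longrightarrow> (\<And>x. \<bar>f x\<bar> \<le> B) \<Longrightarrow>
      (\<lambda>n. integral\<^sup>L (\<mu> n) f) \<longlonglongrightarrow> integral\<^sup>L \<nu> f"
    and supp: "\<And>n. AE x in \<mu> n. x \<in> A n"
    and A: "\<And>p. p \<notin> A' \<Longrightarrow> \<exists>\<epsilon>>0. \<forall>\<^sub>F n in sequentially. A n \<inter> ball p \<epsilon> = {}"
  shows "AE x in \<nu>. x \<in> A'"
proof -
  interpret prob_space \<nu> by fact
  obtain \<epsilon> where \<epsilon>: "\<And>p. p \<notin> A' \<Longrightarrow> \<epsilon> p > 0" "\<And>p. p \<notin> A' \<Longrightarrow> \<forall>\<^sub>F n in sequentially. A n \<inter> ball p (\<epsilon> p) = {}"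
    using A by metis
  have null: "AE x in \<nu>. x \<notin> ball p (\<epsilon> p)" if pA: "p \<notin> A'" for p
  proof -
    define f where "f = (\<lambda>x. max 0 (\<epsilon> p - dist p x))"
    have cf: "continuous_on UNIV f" unfolding f_def by (intro continuous_intros)
    have bf: "\<bar>f x\<bar> \<le> \<epsilon> p" for x using \<epsilon>(1)[OF pA] by (auto simp: f_def)
    have "\<forall>\<^sub>F n in sequentially. integral\<^sup>L (\<mu> n) f = 0"
      using \<epsilon>(2)[OF pA]
    proof eventually_elim
      case (elim n)
      have "AE x in \<mu> n. f x = 0" using supp[of n]
      proof eventually_elim
        case (elim x)
        with \<open>A n \<inter> ball p (\<epsilon> p) = {}\<close> have "x \<notin> ball p (\<epsilon> p)" by blast
        then show ?case by (simp add: f_def)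
      qed
      then show ?case by (rule integral_eq_zero_AE)
    qed
    then have "(\<lambda>n. integral\<^sup>L (\<mu> n) f) \<longlonglongrightarrow> 0" by (rule tendsto_eventually)
    then have z: "integral\<^sup>L \<nu> f = 0" using lim[OF cf bf] LIMSEQ_unique by blast
    have fm: "f \<in> borel_measurable \<nu>"
      using borel_measurable_continuous_onI[OF cf] s by (simp cong: measurable_cong_sets)
    have "integrable \<nu> f" by (rule integrable_const_bound[of f "\<epsilon> p"]) (use bf fm in auto)
    then have "AE x in \<nu>. f x = 0"
      using z by (subst (asm) integral_nonneg_eq_0_iff_AE) (auto simp: f_def)
    then show ?thesis by eventually_elim (auto simp: f_def)
  qed
  obtain F where F: "F \<subseteq> (\<lambda>p. ball p (\<epsilon> p)) ` (- A')" "countable F" "\<Union>F = \<Union>((\<lambda>p. ball p (\<epsilon> p)) ` (- A'))"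
    using Lindelof[of "(\<lambda>p. ball p (\<epsilon> p)) ` (- A')"] by auto
  have "AE x in \<nu>. \<forall>U\<in>F. x \<notin> U"
    using F(1) null by (subst AE_ball_countable[OF F(2)]) auto
  then show ?thesis
  proof eventually_elim
    case (elim x)
    show ?case
    proof (rule ccontr)
      assume "x \<notin> A'"
      then have "x \<in> \<Union>((\<lambda>p. ball p (\<epsilon> p)) ` (- A'))" using \<epsilon>(1) by force
      then show False using F(3) elim by blast
    qed
  qed
qed

section \<open>Lower semicontinuity of the Riesz energy\<close>

text \<open>Distances below \<open>1 / Suc j\<close> are replaced by this value, which gives bounded
  continuous kernels increasing to the Riesz kernel. Bounded continuous functions are what weak
  convergence can be tested with.\<close>

definition trunc_kernel :: "real \<Rightarrow> nat \<Rightarrow> 'a::euclidean_space \<Rightarrow> 'a \<Rightarrow> real" where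
  "trunc_kernel \<alpha> j x y = max (norm (x - y)) (1 / Suc j) powr - \<alpha>"

lemma trunc_kernel_bounds:
  assumes "\<alpha> \<ge> 0"
  shows "0 \<le> trunc_kernel \<alpha> j x y" "trunc_kernel \<alpha> j x y \<le> (1 / Suc j) powr - \<alpha>"
proof -
  show "0 \<le> trunc_kernel \<alpha> j x y" by (simp add: trunc_kernel_def)
  have "1 / real (Suc j) \<le> max (norm (x - y)) (1 / Suc j)" by simp
  then show "trunc_kernel \<alpha> j x y \<le> (1 / Suc j) powr - \<alpha>"
    unfolding trunc_kernel_def using assms by (intro powr_mono2') auto
qed

lemma trunc_kernel_commute: "trunc_kernel \<alpha> j x y = trunc_kernel \<alpha> j y x"
  by (simp add: trunc_kernel_def norm_minus_commute)

lemma continuous_trunc_kernel: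
  "continuous_on UNIV (\<lambda>(x, y). trunc_kernel \<alpha> j x y)"
proof -
  have "max (norm (x - y)) (1 / real (Suc j)) > 0" for x y :: 'a
    by (rule less_le_trans[of _ "1 / real (Suc j)"]) auto
  then show ?thesis
    unfolding trunc_kernel_def case_prod_beta by (intro continuous_intros) (auto simp: less_le)
qed

lemma continuous_trunc_kernel2: "continuous_on UNIV (trunc_kernel \<alpha> j x)"
proof -
  have "continuous_on UNIV (\<lambda>y. (x, y))" by (intro continuous_intros)
  from continuous_on_compose2[OF continuous_trunc_kernel[of \<alpha> j] this] show ?thesis by simp
qed

lemma trunc_kernel_incseq:
  assumes "\<alpha> \<ge> 0" "i \<le> j"
  shows "trunc_kernel \<alpha> i x y \<le> trunc_kernel \<alpha> j x y"
proof -
  have "1 / real (Suc j) \<le> 1 / real (Suc i)" using assms(2) by (simp add: frac_le)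
  then have "max (norm (x - y)) (1 / Suc j) \<le> max (norm (x - y)) (1 / Suc i)" by (rule max.mono[OF order_refl])
  moreover have "0 < max (norm (x - y)) (1 / real (Suc j))"
    by (rule less_le_trans[of _ "1 / real (Suc j)"]) auto
  ultimately show ?thesis unfolding trunc_kernel_def using assms(1) by (intro powr_mono2') auto
qed

text \<open>Off the diagonal the supremum is attained as soon as \<open>1 / Suc j\<close> drops
  below the distance. On the diagonal the truncated kernels grow without bound, in accordance with
  the value infinity there.\<close>

lemma riesz_kernel_SUP:
  assumes "\<alpha> > 0"
  shows "riesz_kernel \<alpha> x y = (SUP j. ennreal (trunc_kernel \<alpha> j x y))"
proof (cases "x = y")
  case True
  have "(SUP j. ennreal (trunc_kernel \<alpha> j x y)) = top"
  proof (rule ennreal_SUP_eq_top)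
    fix n :: nat
    obtain j :: nat where j: "real n powr (1 / \<alpha>) < real j" using reals_Archimedean2 by blast
    have "real n \<le> trunc_kernel \<alpha> j x y"
    proof (cases "n = 0")
      case False
      have "real n = (real n powr (1 / \<alpha>)) powr \<alpha>" using assms False by (simp add: powr_powr)
      also have "\<dots> \<le> real (Suc j) powr \<alpha>" using j assms by (intro powr_mono2) auto
      also have "\<dots> = trunc_kernel \<alpha> j x y" using True by (simp add: trunc_kernel_def powr_minus_divide powr_divide)
      finally show ?thesis .
    qed (simp add: trunc_kernel_def)
    then show "\<exists>i\<in>UNIV. of_nat n \<le> ennreal (trunc_kernel \<alpha> i x y)"
      by (intro bexI[of _ j]) (auto simp: ennreal_of_nat_eq_real_of_nat intro: ennreal_leI)
  qed
  moreover have "riesz_kernel \<alpha> x y = top" using True by (simp add: riesz_kernel_def)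
  ultimately show ?thesis by (simp only:)
next
  case False
  then have p: "norm (x - y) > 0" by simp
  have k: "riesz_kernel \<alpha> x y = ennreal (norm (x - y) powr - \<alpha>)"
    using p divide_ennreal[of 1 "norm (x - y) powr \<alpha>"] by (simp add: riesz_kernel_def powr_minus_divide)
  show ?thesis
  proof (rule antisym)
    obtain j :: nat where j: "1 / real (Suc j) < norm (x - y)" using reals_Archimedean[OF p] by (auto simp: inverse_eq_divide)
    then have "riesz_kernel \<alpha> x y = ennreal (trunc_kernel \<alpha> j x y)" by (simp add: k trunc_kernel_def max_def)
    then show "riesz_kernel \<alpha> x y \<le> (SUP j. ennreal (trunc_kernel \<alpha> j x y))"
      by (simp only:) (rule SUP_upper, simp)
    have "trunc_kernel \<alpha> j x y \<le> norm (x - y) powr - \<alpha>" for j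
      unfolding trunc_kernel_def using p assms by (intro powr_mono2') auto
    then show "(SUP j. ennreal (trunc_kernel \<alpha> j x y)) \<le> riesz_kernel \<alpha> x y"
      unfolding k by (intro SUP_least ennreal_leI)
  qed
qed

lemma
  fixes \<mu> :: "'a::euclidean_space measure"
  assumes \<alpha>: "\<alpha> > 0" and p: "prob_space \<mu>" and s: "sets \<mu> = sets borel"
  shows trunc_kernel_integrable: "integrable \<mu> (trunc_kernel \<alpha> j x)"
    and continuous_trunc_potential: "continuous_on UNIV (\<lambda>x. \<integral>y. trunc_kernel \<alpha> j x y \<partial>\<mu>)"
    and trunc_potential_bounds: "0 \<le> (\<integral>y. trunc_kernel \<alpha> j x y \<partial>\<mu>)" "(\<integral>y. trunc_kernel \<alpha> j x y \<partial>\<mu>) \<le> (1 / Suc j) powr - \<alpha>"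
    and trunc_potential_nn: "(\<integral>\<^sup>+y. ennreal (trunc_kernel \<alpha> j x y) \<partial>\<mu>) = ennreal (\<integral>y. trunc_kernel \<alpha> j x y \<partial>\<mu>)"
    and trunc_energy_nn: "(\<integral>\<^sup>+x. \<integral>\<^sup>+y. ennreal (trunc_kernel \<alpha> j x y) \<partial>\<mu> \<partial>\<mu>) = ennreal (\<integral>x. \<integral>y. trunc_kernel \<alpha> j x y \<partial>\<mu> \<partial>\<mu>)"
    and trunc_potential_integrable: "integrable \<mu> (\<lambda>x. \<integral>y. trunc_kernel \<alpha> j x y \<partial>\<mu>)"
proof -
  interpret prob_space \<mu> by fact
  have b: "0 \<le> trunc_kernel \<alpha> j x y" "trunc_kernel \<alpha> j x y \<le> (1 / Suc j) powr - \<alpha>" for x y :: 'a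
    using trunc_kernel_bounds[OF less_imp_le[OF \<alpha>]] by blast+
  have km: "trunc_kernel \<alpha> j x \<in> borel_measurable \<mu>" for x
    using borel_measurable_continuous_onI[OF continuous_trunc_kernel2[of \<alpha> j x]] s by (simp cong: measurable_cong_sets)
  have int: "integrable \<mu> (trunc_kernel \<alpha> j x)" for x
    by (rule integrable_const_bound[of _ "(1 / Suc j) powr - \<alpha>"]) (use b km in auto)
  show "integrable \<mu> (trunc_kernel \<alpha> j x)" by (rule int)
  have nn: "0 \<le> (\<integral>y. trunc_kernel \<alpha> j x y \<partial>\<mu>)" for x using b by (intro Bochner_Integration.integral_nonneg)
  show "0 \<le> (\<integral>y. trunc_kernel \<alpha> j x y \<partial>\<mu>)" by (rule nn)
  have ub: "(\<integral>y. trunc_kernel \<alpha> j x y \<partial>\<mu>) \<le> (1 / Suc j) powr - \<alpha>" for x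
    by (rule integral_le_const[OF int]) (use b in auto)
  show "(\<integral>y. trunc_kernel \<alpha> j x y \<partial>\<mu>) \<le> (1 / Suc j) powr - \<alpha>" by (rule ub)
  have pn: "(\<integral>\<^sup>+y. ennreal (trunc_kernel \<alpha> j x y) \<partial>\<mu>) = ennreal (\<integral>y. trunc_kernel \<alpha> j x y \<partial>\<mu>)" for x
    by (rule nn_integral_eq_integral[OF int]) (use b in auto)
  show "(\<integral>\<^sup>+y. ennreal (trunc_kernel \<alpha> j x y) \<partial>\<mu>) = ennreal (\<integral>y. trunc_kernel \<alpha> j x y \<partial>\<mu>)" by (rule pn)
  show c: "continuous_on UNIV (\<lambda>x. \<integral>y. trunc_kernel \<alpha> j x y \<partial>\<mu>)"
  proof (rule continuous_at_imp_continuous_on, intro ballI)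
    fix x :: 'a
    show "isCont (\<lambda>x. \<integral>y. trunc_kernel \<alpha> j x y \<partial>\<mu>) x"
      unfolding continuous_at_sequentially o_def
    proof (intro allI impI)
      fix u assume u: "u \<longlonglongrightarrow> x"
      show "(\<lambda>n. \<integral>y. trunc_kernel \<alpha> j (u n) y \<partial>\<mu>) \<longlonglongrightarrow> (\<integral>y. trunc_kernel \<alpha> j x y \<partial>\<mu>)"
      proof (rule integral_dominated_convergence[where w = "\<lambda>_. (1 / Suc j) powr - \<alpha>"])
        show "AE y in \<mu>. (\<lambda>n. trunc_kernel \<alpha> j (u n) y) \<longlonglongrightarrow> trunc_kernel \<alpha> j x y"
        proof (rule AE_I2)
          fix y
          have "isCont (trunc_kernel \<alpha> j y) x"
            using continuous_trunc_kernel2[of \<alpha> j y] by (simp add: continuous_on_eq_continuous_at)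
          then have "(\<lambda>n. trunc_kernel \<alpha> j y (u n)) \<longlonglongrightarrow> trunc_kernel \<alpha> j y x"
            using u by (rule isCont_tendsto_compose)
          then show "(\<lambda>n. trunc_kernel \<alpha> j (u n) y) \<longlonglongrightarrow> trunc_kernel \<alpha> j x y"
            by (simp add: trunc_kernel_commute[of \<alpha> j y])
        qed
      qed (use b km in auto)
    qed
  qed
  have pm: "(\<lambda>x. \<integral>y. trunc_kernel \<alpha> j x y \<partial>\<mu>) \<in> borel_measurable \<mu>"
    using borel_measurable_continuous_onI[OF c] s by (simp cong: measurable_cong_sets)
  show pint: "integrable \<mu> (\<lambda>x. \<integral>y. trunc_kernel \<alpha> j x y \<partial>\<mu>)"
    by (rule integrable_const_bound[of _ "(1 / Suc j) powr - \<alpha>"]) (use nn ub pm in auto)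
  show "(\<integral>\<^sup>+x. \<integral>\<^sup>+y. ennreal (trunc_kernel \<alpha> j x y) \<partial>\<mu> \<partial>\<mu>) = ennreal (\<integral>x. \<integral>y. trunc_kernel \<alpha> j x y \<partial>\<mu> \<partial>\<mu>)"
    unfolding pn by (rule nn_integral_eq_integral[OF pint]) (use nn in auto)
qed

text \<open>Monotone convergence in each variable. The energy becomes a supremum of energies with
  bounded continuous kernels, each of which passes to weak limits.\<close>

lemma riesz_energy_SUP:
  fixes \<mu> :: "'a::euclidean_space measure"
  assumes \<alpha>: "\<alpha> > 0" and p: "prob_space \<mu>" and s: "sets \<mu> = sets borel"
  shows "riesz_energy \<alpha> \<mu> = (SUP j. ennreal (\<integral>x. \<integral>y. trunc_kernel \<alpha> j x y \<partial>\<mu> \<partial>\<mu>))"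
proof -
  have inc: "incseq (\<lambda>j. ennreal (trunc_kernel \<alpha> j x y))" for x y :: 'a
    using \<alpha> by (intro incseq_SucI ennreal_leI trunc_kernel_incseq) auto
  have km: "(\<lambda>y. ennreal (trunc_kernel \<alpha> j x y)) \<in> borel_measurable \<mu>" for x j
    using borel_measurable_integrable[OF trunc_kernel_integrable[OF assms, of j x]] by simp
  have "riesz_energy \<alpha> \<mu> = (\<integral>\<^sup>+x. \<integral>\<^sup>+y. (SUP j. ennreal (trunc_kernel \<alpha> j x y)) \<partial>\<mu> \<partial>\<mu>)"
    unfolding riesz_energy_kernel riesz_kernel_SUP[OF \<alpha>] ..
  also have "\<dots> = (\<integral>\<^sup>+x. (SUP j. \<integral>\<^sup>+y. ennreal (trunc_kernel \<alpha> j x y) \<partial>\<mu>) \<partial>\<mu>)"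
    using inc km by (intro nn_integral_cong nn_integral_monotone_convergence_SUP) (auto simp: incseq_def le_fun_def)
  also have "\<dots> = (SUP j. \<integral>\<^sup>+x. \<integral>\<^sup>+y. ennreal (trunc_kernel \<alpha> j x y) \<partial>\<mu> \<partial>\<mu>)"
  proof (rule nn_integral_monotone_convergence_SUP)
    show "incseq (\<lambda>j x. \<integral>\<^sup>+y. ennreal (trunc_kernel \<alpha> j x y) \<partial>\<mu>)"
      using inc by (auto simp: incseq_def le_fun_def intro!: nn_integral_mono)
    show "(\<lambda>x. \<integral>\<^sup>+y. ennreal (trunc_kernel \<alpha> j x y) \<partial>\<mu>) \<in> borel_measurable \<mu>" for j
      unfolding trunc_potential_nn[OF assms] using trunc_potential_integrable[OF assms, of j] by simp
  qed
  finally show ?thesis unfolding trunc_energy_nn[OF assms] .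
qed

text \<open>The truncated energies are passed to the limit without product measures. By uniform
  continuity of the kernel on a compact set, the potentials of all these measures share one modulus
  of continuity. They converge on a finite net, hence are close everywhere on the ball, and what
  remains is a single integral of a fixed continuous function.\<close>

lemma riesz_energy_lsc:
  fixes \<mu> :: "nat \<Rightarrow> 'a::euclidean_space measure"
  assumes \<alpha>: "\<alpha> > 0" and p: "\<And>n. prob_space (\<mu> n)" "prob_space \<nu>"
    and s: "\<And>n. sets (\<mu> n) = sets borel" "sets \<nu> = sets borel"
    and R: "\<And>n. AE x in \<mu> n. norm x \<le> R" "AE x in \<nu>. norm x \<le> R"
    and lim: "\<And>f :: 'a \<Rightarrow> real. \<And>B. continuous_on UNIV f \<Longrightarrow> (\<And>x. \<bar>f x\<bar> \<le> B) \<Longrightarrow>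
      (\<lambda>n. integral\<^sup>L (\<mu> n) f) \<longlonglongrightarrow> integral\<^sup>L \<nu> f"
    and c: "\<And>n. riesz_energy \<alpha> (\<mu> n) \<le> ennreal c" "c \<ge> 0"
  shows "riesz_energy \<alpha> \<nu> \<le> ennreal c"
  unfolding riesz_energy_SUP[OF \<alpha> p(2) s(2)]
proof (intro SUP_least ennreal_leI)
  fix j
  define P where "P = (\<lambda>\<mu>::'a measure. \<lambda>x. \<integral>y. trunc_kernel \<alpha> j x y \<partial>\<mu>)"
  have Pb: "\<bar>P \<mu> x\<bar> \<le> (1 / Suc j) powr - \<alpha>" if "prob_space \<mu>" "sets \<mu> = sets borel" for \<mu> x
    unfolding P_def using trunc_potential_bounds[OF \<alpha> that, of j x] by simp
  have en: "integral\<^sup>L (\<mu> n) (P (\<mu> n)) \<le> c" for n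
  proof -
    have "ennreal (integral\<^sup>L (\<mu> n) (P (\<mu> n))) \<le> riesz_energy \<alpha> (\<mu> n)"
      unfolding riesz_energy_SUP[OF \<alpha> p(1) s(1)] P_def by (intro SUP_upper) auto
    also have "\<dots> \<le> ennreal c" by (rule c(1))
    finally show ?thesis using c(2) by simp
  qed
  have main: "integral\<^sup>L \<nu> (P \<nu>) \<le> c + 3 * e" if e: "e > 0" for e
  proof -
    let ?K = "cball (0::'a) R"
    have "uniformly_continuous_on (?K \<times> ?K) (\<lambda>(x, y). trunc_kernel \<alpha> j x y)"
      by (intro compact_uniformly_continuous compact_Times continuous_on_subset[OF continuous_trunc_kernel]) auto
    then obtain d where d: "d > 0" "\<And>z z'. z \<in> ?K \<times> ?K \<Longrightarrow> z' \<in> ?K \<times> ?K \<Longrightarrow> dist z' z < d \<Longrightarrow>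
        dist ((\<lambda>(x, y). trunc_kernel \<alpha> j x y) z') ((\<lambda>(x, y). trunc_kernel \<alpha> j x y) z) < e"
      unfolding uniformly_continuous_on_def using e by metis
    have mod: "\<bar>P \<mu> x - P \<mu> x'\<bar> \<le> e" if "x \<in> ?K" "x' \<in> ?K" "dist x x' < d" and \<mu>: "prob_space \<mu>" "sets \<mu> = sets borel" "AE x in \<mu>. norm x \<le> R" for \<mu> x x'
    proof -
      interpret prob_space \<mu> by fact
      note int = trunc_kernel_integrable[OF \<alpha> \<mu>(1,2), of j]
      have "P \<mu> x - P \<mu> x' = (\<integral>y. trunc_kernel \<alpha> j x y - trunc_kernel \<alpha> j x' y \<partial>\<mu>)"
        unfolding P_def using int by simp
      also have "\<bar>\<dots>\<bar> \<le> (\<integral>y. \<bar>trunc_kernel \<alpha> j x y - trunc_kernel \<alpha> j x' y\<bar> \<partial>\<mu>)" by (rule integral_abs_bound)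
      also have "\<dots> \<le> e"
      proof (rule integral_le_const)
        show "integrable \<mu> (\<lambda>y. \<bar>trunc_kernel \<alpha> j x y - trunc_kernel \<alpha> j x' y\<bar>)" using int by simp
        show "AE y in \<mu>. \<bar>trunc_kernel \<alpha> j x y - trunc_kernel \<alpha> j x' y\<bar> \<le> e"
          using \<mu>(3)
        proof eventually_elim
          case (elim y)
          have "dist (x, y) (x', y) < d" using that(3) by (simp add: dist_Pair_Pair)
          then show ?case using d(2)[of "(x', y)" "(x, y)"] that(1,2) elim by (auto simp: dist_real_def)
        qed
      qed
      finally show ?thesis .
    qed
    obtain S where S: "finite S" "S \<subseteq> ?K" "?K \<subseteq> (\<Union>x\<in>S. ball x d)"
      using seq_compact_imp_totally_bounded[OF compact_imp_seq_compact[OF compact_cball[of "0::'a" R]]] d(1) by metis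
    have "\<forall>\<^sub>F n in sequentially. \<bar>P (\<mu> n) z - P \<nu> z\<bar> < e" for z
    proof -
      have "(\<lambda>n. integral\<^sup>L (\<mu> n) (trunc_kernel \<alpha> j z)) \<longlonglongrightarrow> integral\<^sup>L \<nu> (trunc_kernel \<alpha> j z)"
        using trunc_kernel_bounds[OF less_imp_le[OF \<alpha>], of j z]
        by (intro lim[OF continuous_trunc_kernel2, of _ _ _ "(1 / Suc j) powr - \<alpha>"]) auto
      from tendstoD[OF this e] show ?thesis unfolding P_def dist_real_def .
    qed
    then have "\<forall>\<^sub>F n in sequentially. \<forall>z\<in>S. \<bar>P (\<mu> n) z - P \<nu> z\<bar> < e"
      using S(1) by (intro eventually_ball_finite) auto
    then have "\<forall>\<^sub>F n in sequentially. integral\<^sup>L (\<mu> n) (P \<nu>) \<le> c + 3 * e"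
    proof eventually_elim
      case (elim n)
      interpret mn: prob_space "\<mu> n" by (rule p)
      \<comment> \<open>One \<open>e\<close> for moving to the net point, one for comparing the two
        measures there, one for moving back.\<close>
      have close: "P \<nu> x \<le> P (\<mu> n) x + 3 * e" if x: "x \<in> ?K" for x
      proof -
        obtain z where z: "z \<in> S" "dist z x < d" using S(3) x by auto
        have "\<bar>P \<nu> x - P \<nu> z\<bar> \<le> e" "\<bar>P (\<mu> n) x - P (\<mu> n) z\<bar> \<le> e"
          using z S(2) x by (auto intro!: mod p s R simp: dist_commute)
        then show ?thesis using elim z(1) by fastforce
      qed
      have iP: "integrable (\<mu> n) (P (\<mu> n))" unfolding P_def by (rule trunc_potential_integrable[OF \<alpha> p(1) s(1)])
      have cP: "continuous_on UNIV (P \<nu>)" unfolding P_def by (rule continuous_trunc_potential[OF \<alpha> p(2) s(2)])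
      have "integral\<^sup>L (\<mu> n) (P \<nu>) \<le> integral\<^sup>L (\<mu> n) (\<lambda>x. P (\<mu> n) x + 3 * e)"
      proof (rule integral_mono_AE)
        have m: "P \<nu> \<in> borel_measurable (\<mu> n)"
          using borel_measurable_continuous_onI[OF cP] s(1)[of n] by (simp cong: measurable_cong_sets)
        show "integrable (\<mu> n) (P \<nu>)"
          by (rule mn.integrable_const_bound[of _ "(1 / Suc j) powr - \<alpha>"]) (use Pb[OF p(2) s(2)] m in auto)
        show "integrable (\<mu> n) (\<lambda>x. P (\<mu> n) x + 3 * e)" using iP by simp
        show "AE x in \<mu> n. P \<nu> x \<le> P (\<mu> n) x + 3 * e"
          using R(1)[of n] by eventually_elim (rule close, simp)
      qed
      also have "\<dots> = integral\<^sup>L (\<mu> n) (P (\<mu> n)) + 3 * e" using iP by (simp add: mn.prob_space)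
      finally show ?case using en[of n] by simp
    qed
    moreover have "(\<lambda>n. integral\<^sup>L (\<mu> n) (P \<nu>)) \<longlonglongrightarrow> integral\<^sup>L \<nu> (P \<nu>)"
      using Pb[OF p(2) s(2)] continuous_trunc_potential[OF \<alpha> p(2) s(2), of j]
      by (intro lim[of _ "(1 / Suc j) powr - \<alpha>"]) (auto simp: P_def)
    ultimately show ?thesis
      by (intro tendsto_upperbound[of "\<lambda>n. integral\<^sup>L (\<mu> n) (P \<nu>)" _ sequentially]) auto
  qed
  have "integral\<^sup>L \<nu> (P \<nu>) \<le> c + e" if "e > 0" for e
    using main[of "e / 3"] that by simp
  then have "integral\<^sup>L \<nu> (P \<nu>) \<le> c" by (rule field_le_epsilon)
  then show "(\<integral>x. \<integral>y. trunc_kernel \<alpha> j x y \<partial>\<nu> \<partial>\<nu>) \<le> c" by (simp add: P_def)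
qed

text \<open>Take a weak limit of almost optimal charges. By \<open>conv\<close> no point outside
  \<open>A'\<close> is approached by the sets, so the limit charge sits on \<open>A'\<close>. The
  strict bound by \<open>c\<close> provides the charges; in the limit only the weak one
  remains.\<close>

lemma I_riesz_lsc:
  fixes A :: "nat \<Rightarrow> 'a::euclidean_space set"
  assumes \<alpha>: "\<alpha> > 0" and m: "\<And>n. A n \<in> sets borel" "A' \<in> sets borel"
    and R: "\<And>n. A n \<subseteq> cball 0 R" "A' \<subseteq> cball 0 R"
    and conv: "\<And>p. p \<notin> A' \<Longrightarrow> \<exists>\<epsilon>>0. \<forall>\<^sub>F n in sequentially. A n \<inter> ball p \<epsilon> = {}"
    and c: "\<And>n. I_riesz \<alpha> (A n) < ennreal c"
  shows "I_riesz \<alpha> A' \<le> ennreal c"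
proof -
  have c0: "c > 0" using c[of 0] by (cases "c \<le> 0") (auto simp: ennreal_neg not_le)
  have "\<exists>\<mu>. prob_space \<mu> \<and> sets \<mu> = sets borel \<and> emeasure \<mu> (A n) = 1 \<and> riesz_energy \<alpha> \<mu> < ennreal c" for n
    using I_riesz_prob[OF c m(1)] by blast
  then obtain \<mu> where \<mu>: "\<And>n. prob_space (\<mu> n)" "\<And>n. sets (\<mu> n) = sets borel"
    "\<And>n. emeasure (\<mu> n) (A n) = 1" "\<And>n. riesz_energy \<alpha> (\<mu> n) < ennreal c" by metis
  have AE: "AE x in \<mu> n. x \<in> A n" for n
    using \<mu>(3)[of n] m(1)[of n] \<mu>(2)[of n] by (subst prob_space.AE_in_set_eq_1[OF \<mu>(1)]) (auto simp: measure_def)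
  have AER: "AE x in \<mu> n. norm x \<le> R" for n
    using AE[of n] by eventually_elim (use R(1)[of n] in auto)
  obtain r \<nu> where r: "strict_mono r" "prob_space \<nu>" "sets \<nu> = sets borel"
    "\<forall>f :: 'a \<Rightarrow> real. \<forall>B. continuous_on UNIV f \<longrightarrow> (\<forall>x. \<bar>f x\<bar> \<le> B) \<longrightarrow>
      (\<lambda>n. integral\<^sup>L (\<mu> (r n)) f) \<longlonglongrightarrow> integral\<^sup>L \<nu> f"
    by (rule weak_convergent_subsequence[of \<mu> R, OF \<mu>(1,2) AER]) (rule that)
  have AEn: "AE x in \<nu>. x \<in> A'"
  proof (rule weak_limit_support[OF r(2,3)])
    show "(\<lambda>n. integral\<^sup>L (\<mu> (r n)) f) \<longlonglongrightarrow> integral\<^sup>L \<nu> f"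
      if "continuous_on UNIV f" "\<And>x. \<bar>f x\<bar> \<le> B" for f :: "'a \<Rightarrow> real" and B using that r(4) by blast
    show "AE x in \<mu> (r n). x \<in> A (r n)" for n by (rule AE)
    fix p assume "p \<notin> A'"
    then obtain \<epsilon> where "\<epsilon> > 0" "\<forall>\<^sub>F n in sequentially. A n \<inter> ball p \<epsilon> = {}" using conv by blast
    then show "\<exists>\<epsilon>>0. \<forall>\<^sub>F n in sequentially. A (r n) \<inter> ball p \<epsilon> = {}"
      using eventually_subseq[OF r(1)] by blast
  qed
  have "riesz_energy \<alpha> \<nu> \<le> ennreal c"
  proof (rule riesz_energy_lsc[OF \<alpha> \<mu>(1) r(2) \<mu>(2) r(3) AER])
    show "(\<lambda>n. integral\<^sup>L (\<mu> (r n)) f) \<longlonglongrightarrow> integral\<^sup>L \<nu> f"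
      if "continuous_on UNIV f" "\<And>x. \<bar>f x\<bar> \<le> B" for f :: "'a \<Rightarrow> real" and B using that r(4) by blast
    show "AE x in \<nu>. norm x \<le> R" using AEn by eventually_elim (use R(2) in auto)
  qed (use \<mu>(4) c0 in \<open>auto intro: less_imp_le\<close>)
  moreover have "emeasure \<nu> A' = 1"
    using AEn prob_space.AE_in_set_eq_1[OF r(2), of A'] m(2) r(3)
    by (simp add: finite_measure.emeasure_eq_measure[OF prob_space.finite_measure[OF r(2)]])
  ultimately show ?thesis using I_riesz_le_energy[OF r(3)] order_trans by blast
qed

text \<open>Along a subsequence with convergent energies the bound holds only from some index on, so
  the sequence is shifted.\<close>

lemma I_riesz_lsc_eventually:
  fixes A :: "nat \<Rightarrow> 'a::euclidean_space set"
  assumes \<alpha>: "\<alpha> > 0" and m: "\<And>n. A n \<in> sets borel" "A' \<in> sets borel"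
    and R: "\<And>n. A n \<subseteq> cball 0 R" "A' \<subseteq> cball 0 R"
    and conv: "\<And>p. p \<notin> A' \<Longrightarrow> \<exists>\<epsilon>>0. \<forall>\<^sub>F n in sequentially. A n \<inter> ball p \<epsilon> = {}"
    and c: "\<forall>\<^sub>F n in sequentially. I_riesz \<alpha> (A n) < ennreal c"
  shows "I_riesz \<alpha> A' \<le> ennreal c"
proof -
  obtain N where N: "\<And>n. n \<ge> N \<Longrightarrow> I_riesz \<alpha> (A n) < ennreal c"
    using c unfolding eventually_sequentially by blast
  show ?thesis
  proof (rule I_riesz_lsc[OF \<alpha>, of "\<lambda>n. A (n + N)"])
    fix p assume "p \<notin> A'"
    then obtain \<epsilon> where "\<epsilon> > 0" "\<forall>\<^sub>F n in sequentially. A n \<inter> ball p \<epsilon> = {}" using conv by blast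
    then show "\<exists>\<epsilon>>0. \<forall>\<^sub>F n in sequentially. A (n + N) \<inter> ball p \<epsilon> = {}"
      using eventually_sequentially_seg[of "\<lambda>n. A n \<inter> ball p \<epsilon> = {}" N] by blast
  qed (use m R N in auto)
qed

section \<open>Geometry of the \<open>\<delta>\<close>-ball condition\<close>

lemma K_class_closed: "E \<in> K_class \<delta> \<Longrightarrow> closed E"
  by (simp add: K_class_def)

lemma disjoint_balls_dist:
  fixes y z :: "'a::euclidean_space"
  assumes "ball y r \<inter> ball z r = {}" "r > 0"
  shows "dist y z \<ge> 2 * r"
proof (rule ccontr)
  assume "\<not> ?thesis"
  then have "midpoint y z \<in> ball y r \<inter> ball z r"
    by (auto simp: dist_midpoint)
  then show False using assms by auto
qed

text \<open>The two tangent balls are disjoint, so their centres are at least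
  \<open>2 * \<delta>\<close> apart, while both have distance \<open>\<delta>\<close> from
  \<open>x\<close>. By the parallelogram law \<open>x\<close> is their midpoint, which defines an
  outer unit normal.\<close>

lemma K_class_normal:
  fixes E :: "'a::euclidean_space set"
  assumes "E \<in> K_class \<delta>" "\<delta> > 0" "x \<in> frontier E"
  obtains \<nu> where "norm \<nu> = 1" "ball (x - \<delta> *\<^sub>R \<nu>) \<delta> \<subseteq> E" "ball (x + \<delta> *\<^sub>R \<nu>) \<delta> \<subseteq> - E"
proof -
  obtain y z where y: "ball y \<delta> \<subseteq> E" "dist x y = \<delta>" and z: "ball z \<delta> \<subseteq> - E" "dist x z = \<delta>"
    using assms unfolding K_class_def ball_condition_def by blast
  have "ball y \<delta> \<inter> ball z \<delta> = {}" using y z by blast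
  then have d: "dist y z \<ge> 2 * \<delta>"
    using assms(2) by (rule disjoint_balls_dist)
  define u v where "u = y - x" and "v = z - x"
  have n: "norm u = \<delta>" "norm v = \<delta>" "norm (u - v) \<ge> 2 * \<delta>"
    using y z d by (auto simp: u_def v_def dist_norm norm_minus_commute)
  have "(norm (u + v))\<^sup>2 + (norm (u - v))\<^sup>2 = 2 * (norm u)\<^sup>2 + 2 * (norm v)\<^sup>2"
    by (simp add: power2_norm_eq_inner algebra_simps inner_commute)
  moreover have "(norm (u - v))\<^sup>2 \<ge> (2 * \<delta>)\<^sup>2" using n assms(2) by (intro power_mono) auto
  ultimately have "(norm (u + v))\<^sup>2 \<le> 0" using n by (simp add: power2_eq_square)
  then have uv: "u = - v" by (simp add: eq_neg_iff_add_eq_0)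
  show ?thesis
  proof (rule that[of "v /\<^sub>R \<delta>"])
    show "norm (v /\<^sub>R \<delta>) = 1" using n assms(2) by simp
    have "x - \<delta> *\<^sub>R (v /\<^sub>R \<delta>) = y" "x + \<delta> *\<^sub>R (v /\<^sub>R \<delta>) = z"
      using assms(2) uv by (auto simp: u_def v_def algebra_simps)
    then show "ball (x - \<delta> *\<^sub>R (v /\<^sub>R \<delta>)) \<delta> \<subseteq> E" "ball (x + \<delta> *\<^sub>R (v /\<^sub>R \<delta>)) \<delta> \<subseteq> - E"
      using y z by auto
  qed
qed

lemma frontier_notin_balls:
  assumes "x \<in> frontier E"
  shows "ball y r \<subseteq> E \<Longrightarrow> dist x y \<ge> r" "ball y r \<subseteq> - E \<Longrightarrow> dist x y \<ge> r"
proof -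
  have "x \<notin> interior E" "x \<notin> interior (- E)"
    using assms by (auto simp: frontier_def interior_complement)
  moreover have "x \<in> interior S" if "ball y r \<subseteq> S" "\<not> dist x y \<ge> r" for S
    using that by (intro interiorI[of "ball y r"]) (auto simp: dist_commute)
  ultimately show "ball y r \<subseteq> E \<Longrightarrow> dist x y \<ge> r" "ball y r \<subseteq> - E \<Longrightarrow> dist x y \<ge> r"
    by blast+
qed

text \<open>A boundary point lies in neither tangent ball at \<open>x\<close>. Expanding the two
  squared distances to the centres bounds its height over the tangent plane quadratically.\<close>

lemma K_class_inner_normal_le:
  fixes E :: "'a::euclidean_space set"
  assumes "\<delta> > 0" "norm \<nu> = 1" "ball (x - \<delta> *\<^sub>R \<nu>) \<delta> \<subseteq> E" "ball (x + \<delta> *\<^sub>R \<nu>) \<delta> \<subseteq> - E"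
    and y: "y \<in> frontier E"
  shows "\<bar>(y - x) \<bullet> \<nu>\<bar> \<le> (norm (y - x))\<^sup>2 / (2 * \<delta>)"
proof -
  have "dist y (x - \<delta> *\<^sub>R \<nu>) \<ge> \<delta>" "dist y (x + \<delta> *\<^sub>R \<nu>) \<ge> \<delta>"
    using frontier_notin_balls[OF y] assms by auto
  then have "\<delta>\<^sup>2 \<le> (norm ((y - x) + \<delta> *\<^sub>R \<nu>))\<^sup>2" "\<delta>\<^sup>2 \<le> (norm ((y - x) - \<delta> *\<^sub>R \<nu>))\<^sup>2"
    using assms(1) by (auto simp: dist_norm algebra_simps intro!: power_mono)
  moreover have "(norm (v + \<delta> *\<^sub>R \<nu>))\<^sup>2 = (norm v)\<^sup>2 + 2 * \<delta> * (v \<bullet> \<nu>) + \<delta>\<^sup>2"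
    "(norm (v - \<delta> *\<^sub>R \<nu>))\<^sup>2 = (norm v)\<^sup>2 - 2 * \<delta> * (v \<bullet> \<nu>) + \<delta>\<^sup>2" for v
  proof -
    have "\<nu> \<bullet> \<nu> = 1" using dot_square_norm[of \<nu>] assms(2) by simp
    then show "(norm (v + \<delta> *\<^sub>R \<nu>))\<^sup>2 = (norm v)\<^sup>2 + 2 * \<delta> * (v \<bullet> \<nu>) + \<delta>\<^sup>2"
      "(norm (v - \<delta> *\<^sub>R \<nu>))\<^sup>2 = (norm v)\<^sup>2 - 2 * \<delta> * (v \<bullet> \<nu>) + \<delta>\<^sup>2"
      unfolding power2_norm_eq_inner
      by (simp_all add: inner_add_left inner_add_right inner_diff_left inner_diff_right inner_commute power2_eq_square algebra_simps)
  qed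
  ultimately have "\<bar>2 * \<delta> * ((y - x) \<bullet> \<nu>)\<bar> \<le> (norm (y - x))\<^sup>2" by (simp add: abs_le_iff)
  then show ?thesis using assms(1) by (simp add: abs_mult field_simps)
qed

text \<open>The exterior ball at one point and the interior ball at the other are disjoint.\<close>
lemma K_class_normal_lipschitz:
  fixes E :: "'a::euclidean_space set"
  assumes "\<delta> > 0" and \<nu>: "norm \<nu> = 1" "ball (x - \<delta> *\<^sub>R \<nu>) \<delta> \<subseteq> E" "ball (x + \<delta> *\<^sub>R \<nu>) \<delta> \<subseteq> - E"
    and \<nu>': "norm \<nu>' = 1" "ball (y - \<delta> *\<^sub>R \<nu>') \<delta> \<subseteq> E" "ball (y + \<delta> *\<^sub>R \<nu>') \<delta> \<subseteq> - E"
  shows "norm (\<nu> - \<nu>') \<le> norm (x - y) / \<delta>"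
proof -
  define s where "s = \<delta> *\<^sub>R (\<nu> + \<nu>')"
  have "dist (x - \<delta> *\<^sub>R \<nu>) (y + \<delta> *\<^sub>R \<nu>') \<ge> 2 * \<delta>" "dist (x + \<delta> *\<^sub>R \<nu>) (y - \<delta> *\<^sub>R \<nu>') \<ge> 2 * \<delta>"
    using \<nu> \<nu>' assms(1) by (auto intro!: disjoint_balls_dist)
  then have "norm ((x - y) - s) \<ge> 2 * \<delta>" "norm ((x - y) + s) \<ge> 2 * \<delta>"
    by (auto simp: dist_norm s_def algebra_simps)
  then have "(2 * \<delta>)\<^sup>2 \<le> (norm ((x - y) - s))\<^sup>2" "(2 * \<delta>)\<^sup>2 \<le> (norm ((x - y) + s))\<^sup>2"
    using assms(1) power_mono[of "2 * \<delta>" _ 2] by (auto simp del: power_mult_distrib)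
  \<comment> \<open>Adding the two distance bounds cancels the mixed terms; a second parallelogram
    identity, for the unit normals, trades \<open>norm s\<close> for
    \<open>norm (\<nu> - \<nu>')\<close>.\<close>
  moreover have "(norm ((x - y) - s))\<^sup>2 + (norm ((x - y) + s))\<^sup>2 = 2 * (norm (x - y))\<^sup>2 + 2 * (norm s)\<^sup>2"
    by (simp add: power2_norm_eq_inner algebra_simps inner_commute)
  moreover have "(norm s)\<^sup>2 = \<delta>\<^sup>2 * (norm (\<nu> + \<nu>'))\<^sup>2" by (simp add: s_def power_mult_distrib)
  moreover have "(norm (\<nu> + \<nu>'))\<^sup>2 + (norm (\<nu> - \<nu>'))\<^sup>2 = 4"
    using dot_square_norm[of \<nu>] dot_square_norm[of \<nu>'] \<nu>(1) \<nu>'(1)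
    by (simp add: power2_norm_eq_inner algebra_simps inner_commute)
  moreover from this have "\<delta>\<^sup>2 * (norm (\<nu> - \<nu>'))\<^sup>2 = 4 * \<delta>\<^sup>2 - \<delta>\<^sup>2 * (norm (\<nu> + \<nu>'))\<^sup>2"
    by (simp add: algebra_simps flip: distrib_left)
  moreover have "(2 * \<delta>)\<^sup>2 = 4 * \<delta>\<^sup>2" by simp
  ultimately have "\<delta>\<^sup>2 * (norm (\<nu> - \<nu>'))\<^sup>2 \<le> (norm (x - y))\<^sup>2"
    by linarith
  then have "(\<delta> * norm (\<nu> - \<nu>'))\<^sup>2 \<le> (norm (x - y))\<^sup>2" by (simp add: power_mult_distrib)
  then have "\<delta> * norm (\<nu> - \<nu>') \<le> norm (x - y)" by (rule power2_le_imp_le) simp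
  then show ?thesis using assms(1) by (simp add: field_simps)
qed

text \<open>The height of \<open>x\<close> over the tangent plane at \<open>y\<close> is at most a
  quarter of their distance, as both are \<open>\<delta> / 4\<close>-close to \<open>p\<close>, and
  turning the normal from \<open>y\<close> to \<open>p\<close> costs another quarter. Hence the
  boundary near \<open>p\<close> is a Lipschitz graph over the tangent plane at
  \<open>p\<close>.\<close>

lemma K_class_frontier_graph:
  fixes E :: "'a::euclidean_space set"
  assumes E: "E \<in> K_class \<delta>" and \<delta>: "\<delta> > 0"
    and \<nu>: "norm \<nu> = 1" "ball (p - \<delta> *\<^sub>R \<nu>) \<delta> \<subseteq> E" "ball (p + \<delta> *\<^sub>R \<nu>) \<delta> \<subseteq> - E"
    and x: "x \<in> frontier E" "dist x p \<le> \<delta> / 4" and y: "y \<in> frontier E" "dist y p \<le> \<delta> / 4"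
  shows "\<bar>(x - y) \<bullet> \<nu>\<bar> \<le> norm (x - y) / 2"
proof -
  obtain \<nu>' where \<nu>': "norm \<nu>' = 1" "ball (y - \<delta> *\<^sub>R \<nu>') \<delta> \<subseteq> E" "ball (y + \<delta> *\<^sub>R \<nu>') \<delta> \<subseteq> - E"
    using K_class_normal[OF E \<delta> y(1)] by blast
  have d: "norm (x - y) \<le> \<delta> / 2"
    using x(2) y(2) dist_triangle2[of x y p] by (simp add: dist_norm)
  have "\<bar>(x - y) \<bullet> \<nu>'\<bar> \<le> (norm (x - y))\<^sup>2 / (2 * \<delta>)"
    by (rule K_class_inner_normal_le[OF \<delta> \<nu>' x(1)])
  also have "\<dots> \<le> norm (x - y) * (\<delta> / 2) / (2 * \<delta>)"
    using d \<delta> unfolding power2_eq_square by (intro divide_right_mono mult_left_mono) auto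
  also have "\<dots> = norm (x - y) / 4" using \<delta> by simp
  finally have 1: "\<bar>(x - y) \<bullet> \<nu>'\<bar> \<le> norm (x - y) / 4" .
  have "\<bar>(x - y) \<bullet> (\<nu> - \<nu>')\<bar> \<le> norm (x - y) * norm (\<nu> - \<nu>')" by (rule Cauchy_Schwarz_ineq2)
  also have "norm (\<nu> - \<nu>') \<le> norm (p - y) / \<delta>" by (rule K_class_normal_lipschitz[OF \<delta> \<nu> \<nu>'])
  also have "\<dots> \<le> 1 / 4" using y(2) \<delta> by (simp add: dist_norm norm_minus_commute field_simps)
  finally have "\<bar>(x - y) \<bullet> (\<nu> - \<nu>')\<bar> \<le> norm (x - y) / 4" by (simp add: mult_left_mono)
  with 1 show ?thesis unfolding inner_diff_right by linarith
qed

text \<open>Arbitrarily many disjoint translates of equal measure fit into one ball.\<close>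

lemma negligible_if_translates_disjoint:
  fixes S :: "'a::euclidean_space set"
  assumes "compact S" and dis: "\<And>s t::real. s \<noteq> t \<Longrightarrow> (+) (s *\<^sub>R v) ` S \<inter> (+) (t *\<^sub>R v) ` S = {}"
  shows "negligible S"
proof -
  let ?T = "\<lambda>k::nat. (+) ((1 / Suc k) *\<^sub>R v) ` S"
  have cT: "compact (?T k)" for k using assms(1) by (rule compact_translation)
  have mT: "measure lebesgue (?T k) = measure lebesgue S" for k by (rule measure_translation)
  obtain B where B: "\<And>x. x \<in> S \<Longrightarrow> norm x \<le> B"
    using compact_imp_bounded[OF assms(1)] by (auto simp: bounded_iff)
  have sub: "?T k \<subseteq> cball 0 (norm v + B)" for k
  proof
    fix y assume "y \<in> ?T k"
    then obtain x where x: "x \<in> S" "y = (1 / Suc k) *\<^sub>R v + x" by blast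
    have "norm y \<le> norm ((1 / Suc k) *\<^sub>R v) + norm x" unfolding x(2) by (rule norm_triangle_ineq)
    also have "norm ((1 / Suc k) *\<^sub>R v) = (1 / Suc k) * norm v" by simp
    also have "\<dots> \<le> norm v" by (rule mult_left_le_one_le) auto
    finally show "y \<in> cball 0 (norm v + B)" using B[OF x(1)] by simp
  qed
  have bnd: "real N * measure lebesgue S \<le> measure lebesgue (cball (0::'a) (norm v + B))" for N
  proof -
    have "measure lebesgue (\<Union>k<N. ?T k) = (\<Sum>k<N. measure lebesgue (?T k))"
    proof (rule measure_negligible_finite_Union_image)
      show "?T k \<in> lmeasurable" for k using cT by (rule lmeasurable_compact)
      have "?T i \<inter> ?T j = {}" if "i \<noteq> j" for i j using that by (intro dis) simp
      then show "pairwise (\<lambda>i j. negligible (?T i \<inter> ?T j)) {..<N}"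
        by (simp add: pairwise_def)
    qed simp
    also have "\<dots> = real N * measure lebesgue S" unfolding mT by simp
    finally have "real N * measure lebesgue S = measure lebesgue (\<Union>k<N. ?T k)" by (rule sym)
    also have "\<dots> \<le> measure lebesgue (cball (0::'a) (norm v + B))"
    proof (rule measure_mono_fmeasurable)
      show "(\<Union>k<N. ?T k) \<subseteq> cball 0 (norm v + B)" using sub by blast
      show "(\<Union>k<N. ?T k) \<in> sets lebesgue" using cT by (intro sets.finite_UN fmeasurableD lmeasurable_compact) auto
      show "cball (0::'a) (norm v + B) \<in> lmeasurable" by simp
    qed
    finally show ?thesis .
  qed
  have "measure lebesgue S = 0"
  proof (rule ccontr)
    assume "measure lebesgue S \<noteq> 0"
    then have p: "measure lebesgue S > 0" by (simp add: less_le)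
    obtain N :: nat where "measure lebesgue (cball (0::'a) (norm v + B)) < real N * measure lebesgue S"
      using reals_Archimedean3[OF p] by blast
    with bnd[of N] show False by simp
  qed
  then show ?thesis using lmeasurable_compact[OF assms(1)] by (simp add: negligible_iff_measure)
qed

text \<open>Near \<open>p\<close> no chord of the boundary is parallel to the normal at
  \<open>p\<close>, so the translates of this piece of boundary along the normal are
  disjoint.\<close>

lemma K_class_frontier_negligible:
  fixes E :: "'a::euclidean_space set"
  assumes E: "E \<in> K_class \<delta>" and \<delta>: "\<delta> > 0"
  shows "negligible (frontier E)"
proof (subst locally_negligible_alt, intro ballI)
  fix p assume p: "p \<in> frontier E"
  obtain \<nu> where \<nu>: "norm \<nu> = 1" "ball (p - \<delta> *\<^sub>R \<nu>) \<delta> \<subseteq> E" "ball (p + \<delta> *\<^sub>R \<nu>) \<delta> \<subseteq> - E"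
    using K_class_normal[OF E \<delta> p] by blast
  let ?S = "frontier E \<inter> cball p (\<delta> / 4)"
  have "negligible ?S"
  proof (rule negligible_if_translates_disjoint[of _ \<nu>])
    show "compact ?S" by (simp add: closed_Int_compact)
    fix s t :: real assume st: "s \<noteq> t"
    show "(+) (s *\<^sub>R \<nu>) ` ?S \<inter> (+) (t *\<^sub>R \<nu>) ` ?S = {}"
    proof (rule ccontr)
      assume "\<not> ?thesis"
      then obtain x y where xy: "x \<in> ?S" "y \<in> ?S" "s *\<^sub>R \<nu> + x = t *\<^sub>R \<nu> + y" by blast
      then have e: "x - y = (t - s) *\<^sub>R \<nu>" by (simp add: algebra_simps)
      have "\<bar>(x - y) \<bullet> \<nu>\<bar> \<le> norm (x - y) / 2"
        using xy by (intro K_class_frontier_graph[OF E \<delta> \<nu>]) (auto simp: dist_commute)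
      then have "\<bar>t - s\<bar> \<le> \<bar>t - s\<bar> / 2"
        using \<nu>(1) dot_square_norm[of \<nu>] by (simp add: e)
      then show False using st by simp
    qed
  qed
  then have "negligible (frontier E \<inter> ball p (\<delta> / 4))"
    by (rule negligible_subset) auto
  moreover have "openin (top_of_set (frontier E)) (frontier E \<inter> ball p (\<delta> / 4))" by (simp add: openin_open_Int)
  ultimately show "\<exists>U. openin (top_of_set (frontier E)) U \<and> p \<in> U \<and> negligible U"
    using p \<delta> by (intro exI[of _ "frontier E \<inter> ball p (\<delta> / 4)"]) auto
qed

text \<open>If the ball of radius \<open>\<delta>\<close> about \<open>p\<close> leaves
  \<open>E\<close>, the nearest boundary point \<open>x\<close> is within \<open>\<delta>\<close>;
  the ball about \<open>p\<close> that reaches to \<open>x\<close> and the interior tangent ball at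
  \<open>x\<close> then meet in \<open>x\<close>. The connected link \<open>C\<close> is recorded
  because it cannot cross a hyperplane that misses \<open>E\<close>, so \<open>p\<close> and its
  ball lie on the same side.\<close>

lemma K_class_inner_ball:
  fixes E :: "'a::euclidean_space set"
  assumes E: "E \<in> K_class \<delta>" and \<delta>: "\<delta> > 0" and p: "p \<in> E"
  obtains y C where "ball y \<delta> \<subseteq> C" "dist p y \<le> 2 * \<delta>" "connected C" "p \<in> C" "C \<subseteq> E"
proof (cases "cball p \<delta> \<subseteq> E")
  case True
  show ?thesis
    by (rule that[of p "cball p \<delta>"]) (use True \<delta> in auto)
next
  case False
  then have "cball p \<delta> \<inter> frontier E \<noteq> {}"
  proof (intro connected_Int_frontier connected_cball)
    have "p \<in> cball p \<delta>" using \<delta> by simp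
    then show "cball p \<delta> \<inter> E \<noteq> {}" using p by blast
    show "cball p \<delta> - E \<noteq> {}" using False by blast
  qed
  then obtain q where "q \<in> cball p \<delta> \<inter> frontier E" by blast
  then have q: "q \<in> frontier E" "dist p q \<le> \<delta>" by simp_all
  have "frontier E \<noteq> {}" using q by blast
  define x where "x = closest_point (frontier E) p"
  have x: "x \<in> frontier E" "\<And>z. z \<in> frontier E \<Longrightarrow> dist p x \<le> dist p z"
    unfolding x_def using closest_point_exists[OF frontier_closed \<open>frontier E \<noteq> {}\<close>] by blast+
  obtain \<nu> where \<nu>: "norm \<nu> = 1" "ball (x - \<delta> *\<^sub>R \<nu>) \<delta> \<subseteq> E"
    by (rule K_class_normal[OF E \<delta> x(1)]) (rule that)
  let ?y = "x - \<delta> *\<^sub>R \<nu>"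
  have dx: "dist p x \<le> \<delta>" using x(2)[OF q(1)] q(2) by simp
  have 1: "cball ?y \<delta> \<subseteq> E"
    using \<nu>(2) K_class_closed[OF E] \<delta> closure_minimal[of "ball ?y \<delta>" E] by (simp add: closure_ball)
  have 2: "cball p (dist p x) \<subseteq> E"
  proof (cases "dist p x = 0")
    case True then show ?thesis using p by simp
  next
    case False
    then have pos: "dist p x > 0" by (simp add: less_le)
    have "ball p (dist p x) \<subseteq> E"
    proof (rule ccontr)
      assume "\<not> ?thesis"
      then have "ball p (dist p x) \<inter> frontier E \<noteq> {}"
        using p pos connected_Int_frontier[OF connected_ball, of p "dist p x" E] centre_in_ball[of p "dist p x"] by blast
      then show False using x(2) by fastforce
    qed
    then show ?thesis
      using K_class_closed[OF E] pos closure_minimal[of "ball p (dist p x)" E] by (simp add: closure_ball)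
  qed
  have x1: "x \<in> cball ?y \<delta>" using \<nu>(1) \<delta> by (simp add: dist_norm)
  show ?thesis
  proof (rule that[of ?y "cball p (dist p x) \<union> cball ?y \<delta>"])
    show "dist p ?y \<le> 2 * \<delta>"
      using dx x1 dist_triangle[of p ?y x] by (simp add: dist_commute)
    show "connected (cball p (dist p x) \<union> cball ?y \<delta>)"
      using x1 by (intro connected_Un) auto
  qed (use 1 2 in auto)
qed

text \<open>Each point owns a ball of radius \<open>\<delta>\<close> with centre within
  \<open>2 * \<delta>\<close>. The separation \<open>6 * \<delta>\<close> leaves the centres
  \<open>2 * \<delta>\<close> apart, so these balls are disjoint.\<close>

lemma K_class_separated_card:
  fixes E :: "'a::euclidean_space set"
  assumes E: "E \<in> K_class \<delta>" and \<delta>: "\<delta> > 0" and lm: "E \<in> lmeasurable"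
    and P: "finite P" "P \<subseteq> E" "\<And>p q. p \<in> P \<Longrightarrow> q \<in> P \<Longrightarrow> p \<noteq> q \<Longrightarrow> dist p q \<ge> 6 * \<delta>"
  shows "real (card P) * measure lebesgue (ball (0::'a) \<delta>) \<le> measure lebesgue E"
proof -
  have "\<forall>p\<in>P. \<exists>y. ball y \<delta> \<subseteq> E \<and> dist p y \<le> 2 * \<delta>"
    using K_class_inner_ball[OF E \<delta>] P(2) by (metis order_trans subsetD)
  then obtain y where y: "\<And>p. p \<in> P \<Longrightarrow> ball (y p) \<delta> \<subseteq> E" "\<And>p. p \<in> P \<Longrightarrow> dist p (y p) \<le> 2 * \<delta>" by metis
  have "measure lebesgue (\<Union>p\<in>P. ball (y p) \<delta>) = (\<Sum>p\<in>P. measure lebesgue (ball (y p) \<delta>))"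
  proof (rule measure_negligible_finite_Union_image[OF P(1)])
    show "pairwise (\<lambda>p q. negligible (ball (y p) \<delta> \<inter> ball (y q) \<delta>)) P"
    proof (rule pairwiseI)
      fix p q assume pq: "p \<in> P" "q \<in> P" "p \<noteq> q"
      have "dist (y p) (y q) \<ge> 2 * \<delta>"
        using P(3)[OF pq] y(2)[OF pq(1)] y(2)[OF pq(2)] dist_triangle[of p q "y p"] dist_triangle[of "y p" q "y q"]
        by (simp add: dist_commute)
      then have "ball (y p) \<delta> \<inter> ball (y q) \<delta> = {}" by (intro disjoint_ballI) auto
      then show "negligible (ball (y p) \<delta> \<inter> ball (y q) \<delta>)" by simp
    qed
  qed simp
  also have "\<dots> = real (card P) * measure lebesgue (ball (0::'a) \<delta>)"
    using \<delta> by (simp add: content_ball)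
  finally have "measure lebesgue (\<Union>p\<in>P. ball (y p) \<delta>) = real (card P) * measure lebesgue (ball (0::'a) \<delta>)" .
  moreover have "measure lebesgue (\<Union>p\<in>P. ball (y p) \<delta>) \<le> measure lebesgue E"
    using y P(1) lm by (intro measure_mono_fmeasurable) (auto intro!: sets.finite_UN)
  ultimately show ?thesis by simp
qed

text \<open>The volume bounds the number of \<open>6 * \<delta>\<close>-separated points, so a
  largest separated set exists, and the finitely many balls of radius \<open>6 * \<delta>\<close>
  about its points cover \<open>E\<close>.\<close>

lemma K_class_bounded:
  fixes E :: "'a::euclidean_space set"
  assumes E: "E \<in> K_class \<delta>" and \<delta>: "\<delta> > 0" and lm: "E \<in> lmeasurable"
  shows "bounded E"
proof -
  let ?sep = "\<lambda>P. finite P \<and> P \<subseteq> E \<and> (\<forall>p\<in>P. \<forall>q\<in>P. p \<noteq> q \<longrightarrow> dist p q \<ge> 6 * \<delta>)"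
  let ?k = "measure lebesgue (ball (0::'a) \<delta>)"
  have k: "?k > 0" using \<delta> content_ball_gt_0_iff[of 0 \<delta>] by simp
  have bound: "card P \<le> nat \<lceil>measure lebesgue E / ?k\<rceil>" if "?sep P" for P
  proof -
    have "real (card P) * ?k \<le> measure lebesgue E"
      using that by (intro K_class_separated_card[OF E \<delta> lm]) auto
    then have "real (card P) \<le> measure lebesgue E / ?k" using k by (simp add: field_simps)
    then show ?thesis by linarith
  qed
  have "\<exists>P. ?sep P \<and> (\<forall>P'. ?sep P' \<longrightarrow> card P' \<le> card P)"
  proof (rule ex_has_greatest_nat)
    show "?sep {}" by simp
    show "\<forall>P. ?sep P \<longrightarrow> card P < Suc (nat \<lceil>measure lebesgue E / ?k\<rceil>)"
      using bound less_Suc_eq_le by blast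
  qed
  then obtain P where P: "?sep P" and max: "\<And>P'. ?sep P' \<Longrightarrow> card P' \<le> card P"
    by blast
  have "E \<subseteq> (\<Union>p\<in>P. ball p (6 * \<delta>))"
  proof (rule ccontr)
    assume "\<not> ?thesis"
    then obtain x where xE: "x \<in> E" "x \<notin> (\<Union>p\<in>P. ball p (6 * \<delta>))" by blast
    have x: "x \<in> E" "\<And>p. p \<in> P \<Longrightarrow> dist p x \<ge> 6 * \<delta>" using xE by (auto simp: not_less)
    then have "x \<notin> P" using \<delta> by fastforce
    moreover have "?sep (insert x P)" using P x by (auto simp: dist_commute)
    ultimately show False using max[of "insert x P"] P by simp
  qed
  moreover have "bounded (\<Union>p\<in>P. ball p (6 * \<delta>))" using P by (intro bounded_UN) auto
  ultimately show ?thesis using bounded_subset by blast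
qed

text \<open>By \<open>nogap\<close> every hyperplane between \<open>x\<close> and \<open>y\<close>
  meets \<open>E\<close>, so points can be picked at heights \<open>6 * \<delta>\<close> apart. They
  are separated, and the volume limits their number.\<close>

lemma K_class_width:
  fixes E :: "'a::euclidean_space set"
  assumes E: "E \<in> K_class \<delta>" and \<delta>: "\<delta> > 0" and lm: "E \<in> lmeasurable" and b: "b \<in> Basis"
    and nogap: "\<And>s x y. x \<in> E \<Longrightarrow> y \<in> E \<Longrightarrow> x \<bullet> b < s \<Longrightarrow> s < y \<bullet> b \<Longrightarrow> \<exists>p\<in>E. p \<bullet> b = s"
    and xy: "x \<in> E" "y \<in> E"
  shows "y \<bullet> b - x \<bullet> b \<le> 6 * \<delta> * (measure lebesgue E / measure lebesgue (ball (0::'a) \<delta>) + 1)"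
proof (rule ccontr)
  let ?k = "measure lebesgue (ball (0::'a) \<delta>)"
  have k: "?k > 0" using \<delta> content_ball_gt_0_iff[of 0 \<delta>] by simp
  \<comment> \<open>The heights are indexed from 0 to \<open>N\<close>, which makes one point more
    than the volume permits.\<close>
  define N where "N = nat \<lfloor>measure lebesgue E / ?k\<rfloor>"
  have N: "real N \<le> measure lebesgue E / ?k" "measure lebesgue E / ?k < real N + 1"
    using k by (auto simp: N_def)
  assume "\<not> ?thesis"
  then have big: "6 * \<delta> * (measure lebesgue E / ?k + 1) < y \<bullet> b - x \<bullet> b" by simp
  have "\<exists>p\<in>E. p \<bullet> b = x \<bullet> b + 6 * \<delta> * real j" if "j \<le> N" for j
  proof (cases "j = 0")
    case True then show ?thesis using xy by auto
  next
    case False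
    have "6 * \<delta> * real j < 6 * \<delta> * (measure lebesgue E / ?k + 1)"
      using that N(1) \<delta> by (intro mult_strict_left_mono) auto
    then have "x \<bullet> b + 6 * \<delta> * real j < y \<bullet> b" using big by linarith
    moreover have "0 < 6 * \<delta> * real j" using False \<delta> by simp
    ultimately show ?thesis by (intro nogap[OF xy]) auto
  qed
  then obtain p where p: "\<And>j. j \<le> N \<Longrightarrow> p j \<in> E" "\<And>j. j \<le> N \<Longrightarrow> p j \<bullet> b = x \<bullet> b + 6 * \<delta> * real j"
    by metis
  have far: "dist (p i) (p j) \<ge> 6 * \<delta>" if "i \<le> N" "j \<le> N" "i \<noteq> j" for i j
  proof -
    have "6 * \<delta> \<le> 6 * \<delta> * \<bar>real i - real j\<bar>" using that \<delta> by (simp add: mult_le_cancel_left1)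
    also have "\<dots> = \<bar>(p i - p j) \<bullet> b\<bar>"
      using p(2)[OF that(1)] p(2)[OF that(2)] \<delta> by (simp add: inner_diff_left abs_mult flip: right_diff_distrib)
    also have "\<dots> \<le> dist (p i) (p j)" using b by (simp add: dist_norm Basis_le_norm)
    finally show ?thesis .
  qed
  have "inj_on p {..N}" using far \<delta> by (force simp: inj_on_def)
  then have "card (p ` {..N}) = N + 1" by (simp add: card_image)
  moreover have "real (card (p ` {..N})) * ?k \<le> measure lebesgue E"
    using p(1) far by (intro K_class_separated_card[OF E \<delta> lm]) auto
  ultimately have "real N + 1 \<le> measure lebesgue E / ?k" using k by (simp add: field_simps)
  then show False using N(2) by simp
qed

text \<open>A piece of the boundary is projected to the tangent plane and lifted to the unit sphere.\<close>
lemma K_class_frontier_energy: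
  fixes E :: "'a::euclidean_space set"
  assumes E: "E \<in> K_class \<delta>" "\<delta> > 0" "compact E" and \<alpha>: "\<alpha> > 0"
    and fin: "I_riesz \<alpha> (frontier E) < \<infinity>"
  shows "I_riesz \<alpha> (sphere (0::'a) 1) < \<infinity>"
proof -
  have cF: "compact (frontier E)" using E(3) by (rule compact_frontier)
  \<comment> \<open>On this radius the boundary is a Lipschitz graph. Division by
    \<open>\<sigma>\<close> in \<open>w\<close> brings the projected patch into the unit
    disc.\<close>
  define \<sigma> where "\<sigma> = \<delta> / 4"
  have \<sigma>: "\<sigma> > 0" using E(2) by (simp add: \<sigma>_def)
  obtain S where S: "finite S" "S \<subseteq> frontier E" "frontier E \<subseteq> (\<Union>x\<in>S. ball x \<sigma>)"
    using seq_compact_imp_totally_bounded[OF compact_imp_seq_compact[OF cF]] \<sigma> by metis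
  obtain p where p: "p \<in> S" "I_riesz \<alpha> (frontier E \<inter> ball p \<sigma>) < \<infinity>"
    by (rule I_riesz_localize[OF fin S(1,3)]) (auto intro: that)
  obtain \<nu> where \<nu>: "norm \<nu> = 1" "ball (p - \<delta> *\<^sub>R \<nu>) \<delta> \<subseteq> E" "ball (p + \<delta> *\<^sub>R \<nu>) \<delta> \<subseteq> - E"
    by (rule K_class_normal[OF E(1,2), of p]) (use S(2) p(1) in blast, rule that)
  have \<nu>\<nu>: "\<nu> \<bullet> \<nu> = 1" using \<nu>(1) dot_square_norm[of \<nu>] by simp
  define w where "w = (\<lambda>x. (1 / \<sigma>) *\<^sub>R ((x - p) - ((x - p) \<bullet> \<nu>) *\<^sub>R \<nu>))"
  \<comment> \<open>The vertical lift from the disc to the upper half of the sphere. It cannot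
    shorten distances, being orthogonal to the plane of \<open>w\<close>; the \<open>max 0\<close>
    keeps it continuous on the whole space.\<close>
  define \<Phi> where "\<Phi> = (\<lambda>x. w x + sqrt (max 0 (1 - (norm (w x))\<^sup>2)) *\<^sub>R \<nu>)"
  have wd: "w x - w y = (1 / \<sigma>) *\<^sub>R ((x - y) - ((x - y) \<bullet> \<nu>) *\<^sub>R \<nu>)" for x y
    by (simp add: w_def inner_diff_left algebra_simps)
  have w\<nu>: "w x \<bullet> \<nu> = 0" for x by (simp add: w_def inner_diff_left \<nu>\<nu>)
  have proj: "(norm (v - (v \<bullet> \<nu>) *\<^sub>R \<nu>))\<^sup>2 = (norm v)\<^sup>2 - (v \<bullet> \<nu>)\<^sup>2" for v
    unfolding power2_norm_eq_inner
    by (simp add: inner_diff_left inner_diff_right inner_commute \<nu>\<nu> power2_eq_square)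
  have pyth: "(norm (u + t *\<^sub>R \<nu>))\<^sup>2 = (norm u)\<^sup>2 + t\<^sup>2" if "u \<bullet> \<nu> = 0" for u t
    unfolding power2_norm_eq_inner using that
    by (simp add: inner_add_left inner_add_right inner_commute \<nu>\<nu> power2_eq_square)
  have w1: "norm (w x) \<le> 1" if "x \<in> ball p \<sigma>" for x
  proof -
    have "(norm ((x - p) - ((x - p) \<bullet> \<nu>) *\<^sub>R \<nu>))\<^sup>2 \<le> (norm (x - p))\<^sup>2" unfolding proj by simp
    then have "norm ((x - p) - ((x - p) \<bullet> \<nu>) *\<^sub>R \<nu>) \<le> norm (x - p)" by (rule power2_le_imp_le) simp
    also have "\<dots> \<le> \<sigma>" using that by (simp add: dist_norm norm_minus_commute)
    finally show ?thesis using \<sigma> by (simp add: w_def divide_le_eq)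
  qed
  have "I_riesz \<alpha> (sphere (0::'a) 1) \<le> ennreal ((1 / (2 * \<sigma>)) powr - \<alpha>) * I_riesz \<alpha> (frontier E \<inter> ball p \<sigma>)"
  proof (rule I_riesz_expand)
    show "frontier E \<inter> ball p \<sigma> \<in> sets borel" "sphere (0::'a) 1 \<in> sets borel" by auto
    show "\<Phi> \<in> borel_measurable borel"
      unfolding \<Phi>_def w_def by (intro borel_measurable_continuous_onI continuous_intros)
    fix x assume x: "x \<in> frontier E \<inter> ball p \<sigma>"
    have "(norm (w x))\<^sup>2 \<le> 1" using w1[of x] x by (simp add: power_le_one)
    then have "(norm (\<Phi> x))\<^sup>2 = 1" unfolding \<Phi>_def pyth[OF w\<nu>] by simp
    then have "norm (\<Phi> x) = 1" using power2_eq_iff_nonneg[of "norm (\<Phi> x)" 1] by simp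
    then show "\<Phi> x \<in> sphere 0 1" by simp
    fix y assume y: "y \<in> frontier E \<inter> ball p \<sigma>"
    \<comment> \<open>At most half of a chord points along the normal, so its projection keeps at
      least half its length. Together with the division by \<open>\<sigma>\<close> this is the
      factor \<open>1 / (2 * \<sigma>)\<close>.\<close>
    have "\<bar>(x - y) \<bullet> \<nu>\<bar> \<le> norm (x - y) / 2"
      using x y by (intro K_class_frontier_graph[OF E(1,2) \<nu>]) (auto simp: \<sigma>_def dist_commute)
    then have "\<bar>(x - y) \<bullet> \<nu>\<bar> \<le> \<bar>norm (x - y) / 2\<bar>" by simp
    then have "((x - y) \<bullet> \<nu>)\<^sup>2 \<le> (norm (x - y) / 2)\<^sup>2" by (simp only: abs_le_square_iff)
    then have "(norm (x - y) / 2)\<^sup>2 \<le> (norm ((x - y) - ((x - y) \<bullet> \<nu>) *\<^sub>R \<nu>))\<^sup>2"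
    proof -
      have "(norm (x - y) / 2)\<^sup>2 = (norm (x - y))\<^sup>2 / 4" by (simp add: power_divide)
      with \<open>((x - y) \<bullet> \<nu>)\<^sup>2 \<le> (norm (x - y) / 2)\<^sup>2\<close> show ?thesis
        unfolding proj using zero_le_power2[of "norm (x - y)"] by linarith
    qed
    then have "norm (x - y) / 2 \<le> norm ((x - y) - ((x - y) \<bullet> \<nu>) *\<^sub>R \<nu>)" by (rule power2_le_imp_le) simp
    moreover have "norm (w x - w y) = norm ((x - y) - ((x - y) \<bullet> \<nu>) *\<^sub>R \<nu>) / \<sigma>"
      unfolding wd norm_scaleR using \<sigma> by simp
    ultimately have "norm (x - y) / 2 / \<sigma> \<le> norm (w x - w y)" using \<sigma> by (simp only: divide_right_mono less_imp_le)
    then have 1: "1 / (2 * \<sigma>) * norm (x - y) \<le> norm (w x - w y)" by simp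
    define t where "t = sqrt (max 0 (1 - (norm (w x))\<^sup>2)) - sqrt (max 0 (1 - (norm (w y))\<^sup>2))"
    have "\<Phi> x - \<Phi> y = (w x - w y) + t *\<^sub>R \<nu>" by (simp add: \<Phi>_def t_def algebra_simps)
    moreover have "(w x - w y) \<bullet> \<nu> = 0" by (simp add: inner_diff_left w\<nu>)
    ultimately have "(norm (\<Phi> x - \<Phi> y))\<^sup>2 = (norm (w x - w y))\<^sup>2 + t\<^sup>2" using pyth by simp
    then have "(norm (w x - w y))\<^sup>2 \<le> (norm (\<Phi> x - \<Phi> y))\<^sup>2" by simp
    then have "norm (w x - w y) \<le> norm (\<Phi> x - \<Phi> y)" by (rule power2_le_imp_le) simp
    with 1 show "1 / (2 * \<sigma>) * norm (x - y) \<le> norm (\<Phi> x - \<Phi> y)" by simp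
  qed (use \<alpha> \<sigma> in auto)
  also have "\<dots> < \<infinity>" using p(2) by (simp add: ennreal_mult_less_top)
  finally show ?thesis .
qed

section \<open>Scaling, translation, and balls as members of the class\<close>

lemma I_riesz_scale_le:
  fixes A A' :: "'a::euclidean_space set"
  assumes "\<alpha> \<ge> 0" "r > 0" "A \<in> sets borel" "A' \<in> sets borel" "\<And>x. x \<in> A \<Longrightarrow> r *\<^sub>R x \<in> A'"
  shows "I_riesz \<alpha> A' \<le> ennreal (r powr - \<alpha>) * I_riesz \<alpha> A"
proof (rule I_riesz_expand)
  show "r * norm (x - y) \<le> norm (r *\<^sub>R x - r *\<^sub>R y)" for x y :: 'a
    using assms(2) by (simp flip: scaleR_diff_right)
qed (use assms in auto)

lemma I_riesz_translation_le:
  fixes A :: "'a::euclidean_space set"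
  assumes "\<alpha> \<ge> 0" "closed A"
  shows "I_riesz \<alpha> ((+) a ` A) \<le> I_riesz \<alpha> A"
proof -
  have "I_riesz \<alpha> ((+) a ` A) \<le> ennreal (1 powr - \<alpha>) * I_riesz \<alpha> A"
    using assms by (intro I_riesz_expand[where \<Phi> = "(+) a"]) (auto simp: closed_translation borel_closed)
  then show ?thesis by simp
qed

lemma K_class_translation:
  fixes E :: "'a::euclidean_space set"
  assumes "E \<in> K_class \<delta>" shows "(+) a ` E \<in> K_class \<delta>"
proof -
  have cl: "closed ((+) a ` E)" using assms by (simp add: K_class_def closed_translation)
  have fr: "frontier ((+) a ` E) = (+) a ` frontier E" by (rule frontier_translation)
  have "ball_condition \<delta> ((+) a ` E)"
    unfolding ball_condition_def fr
  proof
    fix x assume "x \<in> (+) a ` frontier E"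
    then obtain x' where x': "x = a + x'" "x' \<in> frontier E" by blast
    have "(\<exists>y. ball y \<delta> \<subseteq> E \<and> dist x' y = \<delta>) \<and> (\<exists>z. ball z \<delta> \<subseteq> - E \<and> dist x' z = \<delta>)"
      using assms x'(2) unfolding K_class_def ball_condition_def by simp
    then obtain y z where y: "ball y \<delta> \<subseteq> E" "dist x' y = \<delta>" and z: "ball z \<delta> \<subseteq> - E" "dist x' z = \<delta>"
      by blast
    have b: "ball (a + c) \<delta> = (+) a ` ball c \<delta>" for c :: 'a by (rule ball_translation)
    have "ball (a + y) \<delta> \<subseteq> (+) a ` E" "ball (a + z) \<delta> \<subseteq> - (+) a ` E"
      unfolding b translation_Compl[symmetric] by (rule image_mono[OF y(1)], rule image_mono[OF z(1)])
    then show "(\<exists>y. ball y \<delta> \<subseteq> (+) a ` E \<and> dist x y = \<delta>) \<and> (\<exists>z. ball z \<delta> \<subseteq> - (+) a ` E \<and> dist x z = \<delta>)"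
      using x'(1) y(2) z(2) by (intro conjI exI[of _ "a + y"] exI[of _ "a + z"]) auto
  qed
  with cl show ?thesis by (simp add: K_class_def)
qed

lemma cball_in_K_class:
  assumes "0 < \<delta>" "\<delta> \<le> r"
  shows "cball (0::'a::euclidean_space) r \<in> K_class \<delta>"
  unfolding K_class_def ball_condition_def
proof (intro CollectI conjI ballI)
  fix x :: 'a assume "x \<in> frontier (cball 0 r)"
  then have x: "norm x = r" using assms by (simp add: frontier_cball)
  define u where "u = x /\<^sub>R r"
  have u: "norm u = 1" "x = r *\<^sub>R u" using x assms by (auto simp: u_def)
  have n: "norm ((r - \<delta>) *\<^sub>R u) = r - \<delta>" "norm ((r + \<delta>) *\<^sub>R u) = r + \<delta>" using u assms by auto
  have d: "dist x ((r - \<delta>) *\<^sub>R u) = \<delta>" "dist x ((r + \<delta>) *\<^sub>R u) = \<delta>"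
    unfolding dist_norm u(2) scaleR_diff_left[symmetric] using u(1) assms by auto
  have "norm y \<le> r" if "y \<in> ball ((r - \<delta>) *\<^sub>R u) \<delta>" for y
    using that norm_triangle_ineq2[of y "(r - \<delta>) *\<^sub>R u"] n(1) by (simp add: dist_norm norm_minus_commute)
  then have "ball ((r - \<delta>) *\<^sub>R u) \<delta> \<subseteq> cball 0 r" by auto
  then show "\<exists>y. ball y \<delta> \<subseteq> cball 0 r \<and> dist x y = \<delta>" using d by blast
  have "norm y > r" if "y \<in> ball ((r + \<delta>) *\<^sub>R u) \<delta>" for y
    using that norm_triangle_ineq2[of "(r + \<delta>) *\<^sub>R u" y] n(2) by (simp add: dist_norm norm_minus_commute)
  then have "ball ((r + \<delta>) *\<^sub>R u) \<delta> \<subseteq> - cball 0 r" by force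
  then show "\<exists>z. ball z \<delta> \<subseteq> - cball 0 r \<and> dist x z = \<delta>" using d by blast
qed simp

section \<open>Compactness\<close>

lemma infdist_lipschitz: "\<bar>infdist x A - infdist y A\<bar> \<le> dist x y"
  using infdist_triangle[of x A y] infdist_triangle[of y A x] by (simp add: dist_commute)

lemma le_infdist:
  assumes "A \<noteq> {}" "\<And>a. a \<in> A \<Longrightarrow> d \<le> dist x a"
  shows "d \<le> infdist x A"
  unfolding infdist_notempty[OF assms(1)] by (rule cINF_greatest[OF assms])

text \<open>Arzela-Ascoli for distance functions: a diagonal subsequence converges on a countable
  dense set, and the common Lipschitz constant 1 extends the convergence to all points.\<close>

lemma infdist_convergent_subsequence:
  fixes E :: "nat \<Rightarrow> 'a::euclidean_space set"
  assumes ne: "\<And>n. E n \<noteq> {}" and R: "\<And>n. E n \<subseteq> cball 0 R"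
  obtains r where "strict_mono (r :: nat \<Rightarrow> nat)" "\<And>x. convergent (\<lambda>n. infdist x (E (r n)))"
proof -
  obtain D :: "'a set" where D: "countable D" "\<And>X. open X \<Longrightarrow> X \<noteq> {} \<Longrightarrow> \<exists>d\<in>D. d \<in> X"
    by (rule countable_dense_setE) (rule that)
  have "D \<noteq> {}" using D(2)[of UNIV] by auto
  define q where "q = from_nat_into D"
  have q: "\<exists>k. q k = d" if "d \<in> D" for d
    unfolding q_def using from_nat_into_surj[OF D(1) that] by blast
  have bd: "infdist x (E n) \<in> {0..norm x + R}" for x n
  proof -
    obtain e where e: "e \<in> E n" using ne by blast
    have "infdist x (E n) \<le> dist x e" by (rule infdist_le[OF e])
    also have "\<dots> \<le> norm x + norm e" unfolding dist_norm by (rule norm_triangle_ineq4)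
    finally show ?thesis using R[of n] e by (auto simp: infdist_nonneg)
  qed
  interpret subseqs "\<lambda>n s. convergent (\<lambda>k. infdist (q n) (E (s k)))"
  proof
    fix n and s :: "nat \<Rightarrow> nat" assume "strict_mono s"
    have sc: "seq_compact {0..norm (q n) + R}" by (rule compact_imp_seq_compact) simp
    have "\<exists>l\<in>{0..norm (q n) + R}. \<exists>r. strict_mono (r :: nat \<Rightarrow> nat) \<and> ((\<lambda>k. infdist (q n) (E (s k))) \<circ> r) \<longlonglongrightarrow> l"
      by (rule sc[unfolded seq_compact_def, rule_format]) (rule bd)
    then obtain l r where "strict_mono (r :: nat \<Rightarrow> nat)" "((\<lambda>k. infdist (q n) (E (s k))) \<circ> r) \<longlonglongrightarrow> l"
      by blast
    then show "\<exists>r'. strict_mono r' \<and> convergent (\<lambda>k. infdist (q n) (E ((s \<circ> r') k)))"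
      unfolding convergent_def by (auto simp: o_def)
  qed
  define d where "d = diagseq"
  have dq: "convergent (\<lambda>k. infdist (q n) (E (d k)))" for n
  proof -
    have "convergent (\<lambda>k. infdist (q n) (E ((diagseq \<circ> ((+) (Suc n))) k)))"
    proof (rule diagseq_holds)
      fix r s :: "nat \<Rightarrow> nat" and n assume "strict_mono r" "convergent (\<lambda>k. infdist (q n) (E (s k)))"
      then show "convergent (\<lambda>k. infdist (q n) (E ((s \<circ> r) k)))"
        using convergent_subseq_convergent[of "\<lambda>k. infdist (q n) (E (s k))" r] by (simp add: o_def)
    qed
    then have "convergent (\<lambda>k. infdist (q n) (E (d (k + Suc n))))" by (simp add: d_def add.commute)
    then show ?thesis using convergent_ignore_initial_segment[of "\<lambda>k. infdist (q n) (E (d k))" "Suc n"] by simp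
  qed
  have "convergent (\<lambda>n. infdist x (E (d n)))" for x
  proof (rule Cauchy_convergent, rule metric_CauchyI)
    fix e :: real assume e: "e > 0"
    obtain a where a: "a \<in> D" "a \<in> ball x (e / 3)" using D(2)[of "ball x (e / 3)"] e by auto
    obtain k where k: "q k = a" using q[OF a(1)] by blast
    have "Cauchy (\<lambda>n. infdist a (E (d n)))" using dq[of k] k convergent_Cauchy by blast
    then obtain M where M: "\<And>m n. m \<ge> M \<Longrightarrow> n \<ge> M \<Longrightarrow> dist (infdist a (E (d m))) (infdist a (E (d n))) < e / 3"
      using e metric_CauchyD[of "\<lambda>n. infdist a (E (d n))" "e / 3"] by (metis divide_pos_pos zero_less_numeral)
    show "\<exists>M. \<forall>m\<ge>M. \<forall>n\<ge>M. dist (infdist x (E (d m))) (infdist x (E (d n))) < e"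
    proof (intro exI[of _ M] allI impI)
      fix m n assume mn: "m \<ge> M" "n \<ge> M"
      show "dist (infdist x (E (d m))) (infdist x (E (d n))) < e"
        using M[OF mn] infdist_lipschitz[of x "E (d m)" a] infdist_lipschitz[of x "E (d n)" a] a(2)
        unfolding dist_real_def mem_ball by linarith
    qed
  qed
  then show ?thesis using that[of d] subseq_diagseq by (simp add: d_def)
qed

text \<open>Convergence of sets is encoded by that of their distance functions, and the limit set
  \<open>L\<close> is the zero set of \<open>u\<close>. As all sets lie in one ball, this amounts to
  Hausdorff convergence.\<close>

locale K_limit =
  fixes \<delta> R :: real and E :: "nat \<Rightarrow> 'a::euclidean_space set" and u :: "'a \<Rightarrow> real"
  assumes \<delta>: "\<delta> > 0"
    and K: "\<And>n. E n \<in> K_class \<delta>"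
    and ne: "\<And>n. E n \<noteq> {}"
    and R: "\<And>n. E n \<subseteq> cball 0 R"
    and u: "\<And>x. (\<lambda>n. infdist x (E n)) \<longlonglongrightarrow> u x"
begin

definition L :: "'a set" where "L = {x. u x = 0}"

lemma cl: "closed (E n)" using K by (rule K_class_closed)

lemma u_nonneg: "u x \<ge> 0"
  by (rule tendsto_lowerbound[OF u]) (auto simp: infdist_nonneg)

lemma u_lipschitz: "\<bar>u x - u y\<bar> \<le> dist x y"
proof (rule tendsto_upperbound)
  show "(\<lambda>n. \<bar>infdist x (E n) - infdist y (E n)\<bar>) \<longlonglongrightarrow> \<bar>u x - u y\<bar>" by (intro tendsto_intros u)
qed (auto simp: infdist_lipschitz)

lemma closed_L: "closed L"
proof -
  have "continuous_on UNIV u"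
  proof (rule lipschitz_on_continuous_on)
    show "1-lipschitz_on UNIV u" by (rule lipschitz_onI) (auto simp: dist_real_def u_lipschitz)
  qed
  then show ?thesis unfolding L_def by (intro closed_Collect_eq continuous_on_const)
qed

lemma outside:
  assumes "p \<notin> L"
  shows "\<exists>\<epsilon>>0. \<forall>\<^sub>F n in sequentially. E n \<inter> ball p \<epsilon> = {}"
proof -
  have pos: "u p > 0" using assms u_nonneg[of p] by (simp add: L_def less_le)
  then have "\<forall>\<^sub>F n in sequentially. u p / 2 < infdist p (E n)"
    by (intro order_tendstoD(1)[OF u]) simp
  then have "\<forall>\<^sub>F n in sequentially. E n \<inter> ball p (u p / 2) = {}"
  proof eventually_elim
    case (elim n)
    show ?case
    proof (rule ccontr)
      assume "E n \<inter> ball p (u p / 2) \<noteq> {}"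
      then obtain a where "a \<in> E n" "dist p a < u p / 2" by auto
      then show False using infdist_le[of a "E n" p] elim by simp
    qed
  qed
  then show ?thesis using pos by (intro exI[of _ "u p / 2"]) simp
qed

lemma L_sub: "L \<subseteq> cball 0 R"
proof
  fix x assume x: "x \<in> L"
  have "norm x - R \<le> infdist x (E n)" for n
  proof (rule le_infdist[OF ne])
    fix a assume "a \<in> E n"
    then have "norm a \<le> R" using R[of n] by auto
    then show "norm x - R \<le> dist x a" using norm_triangle_ineq2[of x a] by (simp add: dist_norm)
  qed
  then have "norm x - R \<le> u x" by (intro tendsto_lowerbound[OF u]) auto
  then show "x \<in> cball 0 R" using x by (simp add: L_def)
qed

lemma near:
  assumes "p \<in> L" "\<epsilon> > 0"
  shows "\<forall>\<^sub>F n in sequentially. E n \<inter> ball p \<epsilon> \<noteq> {}"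
proof -
  have "\<forall>\<^sub>F n in sequentially. infdist p (E n) < \<epsilon>"
    using assms by (intro order_tendstoD(2)[OF u]) (simp add: L_def)
  then show ?thesis
  proof eventually_elim
    case (elim n)
    obtain a where "a \<in> E n" "infdist p (E n) = dist p a" by (rule infdist_attains_inf[OF cl ne])
    then show ?case using elim by auto
  qed
qed

text \<open>A ball about a boundary point of \<open>L\<close> contains a point off \<open>L\<close>,
  which the sets \<open>E n\<close> eventually miss, and it eventually meets \<open>E n\<close>.
  Being connected, it meets the boundary of \<open>E n\<close>.\<close>

lemma frontier_near:
  assumes x: "x \<in> frontier L" and e: "\<epsilon> > 0"
  shows "\<forall>\<^sub>F n in sequentially. frontier (E n) \<inter> ball x \<epsilon> \<noteq> {}"
proof -
  have xL: "x \<in> L" using x closed_L by (simp add: frontier_def)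
  have "x \<notin> interior L" using x by (simp add: frontier_def)
  then have "\<not> ball x \<epsilon> \<subseteq> L" using e by (metis mem_interior)
  then obtain p where p: "p \<in> ball x \<epsilon>" "p \<notin> L" by blast
  obtain \<epsilon>' where \<epsilon>': "\<epsilon>' > 0" "\<forall>\<^sub>F n in sequentially. E n \<inter> ball p \<epsilon>' = {}" using outside[OF p(2)] by blast
  show ?thesis using near[OF xL e] \<epsilon>'(2)
  proof eventually_elim
    case (elim n)
    have "p \<in> ball p \<epsilon>'" using \<epsilon>'(1) by simp
    then have "p \<notin> E n" using elim(2) by blast
    then have "ball x \<epsilon> - E n \<noteq> {}" using p(1) by blast
    moreover have "ball x \<epsilon> \<inter> E n \<noteq> {}" using elim(1) by blast
    ultimately show ?case using connected_Int_frontier[OF connected_ball] by blast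
  qed
qed

lemma limit_ball_inside:
  assumes s: "strict_mono s" and y: "(\<lambda>n. y n) \<longlonglongrightarrow> l" "\<And>n. ball (y n) \<delta> \<subseteq> E (s n)"
  shows "ball l \<delta> \<subseteq> L"
proof
  fix q assume "q \<in> ball l \<delta>"
  moreover have "(\<lambda>n. dist (y n) q) \<longlonglongrightarrow> dist l q" by (intro tendsto_intros y)
  ultimately have "\<forall>\<^sub>F n in sequentially. dist (y n) q < \<delta>" using order_tendstoD(2) by fastforce
  then have "\<forall>\<^sub>F n in sequentially. infdist q (E (s n)) = 0"
    by eventually_elim (use y(2) in \<open>auto simp: subset_iff\<close>)
  then have "(\<lambda>n. infdist q (E (s n))) \<longlonglongrightarrow> 0" by (rule tendsto_eventually)
  moreover have "(\<lambda>n. infdist q (E (s n))) \<longlonglongrightarrow> u q" using LIMSEQ_subseq_LIMSEQ[OF u s] by (simp add: o_def)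
  ultimately show "q \<in> L" using LIMSEQ_unique by (auto simp: L_def)
qed

lemma limit_ball_outside:
  assumes s: "strict_mono s" and z: "(\<lambda>n. z n) \<longlonglongrightarrow> l" "\<And>n. ball (z n) \<delta> \<subseteq> - E (s n)"
  shows "ball l \<delta> \<subseteq> - L"
proof
  fix q assume q: "q \<in> ball l \<delta>"
  \<comment> \<open>\<open>q\<close> lies at depth \<open>2 * e\<close> in the limit ball; moving
    the centre by less than \<open>e\<close> leaves a gap of at least \<open>e\<close> to the
    sets.\<close>
  define e where "e = (\<delta> - dist l q) / 2"
  have e: "e > 0" using q by (simp add: e_def)
  have "\<forall>\<^sub>F n in sequentially. dist (z n) l < e" using tendstoD[OF z(1) e] .
  then have "\<forall>\<^sub>F n in sequentially. e \<le> infdist q (E (s n))"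
  proof eventually_elim
    case (elim n)
    show ?case
    proof (rule le_infdist[OF ne])
      fix a assume "a \<in> E (s n)"
      then have "a \<notin> ball (z n) \<delta>" using z(2)[of n] by blast
      then have "\<delta> \<le> dist (z n) a" by simp
      also have "\<dots> \<le> dist (z n) l + dist l q + dist q a"
        using dist_triangle[of "z n" a l] dist_triangle[of l a q] by linarith
      finally show "e \<le> dist q a" using elim by (simp add: e_def field_simps)
    qed
  qed
  moreover have "(\<lambda>n. infdist q (E (s n))) \<longlonglongrightarrow> u q" using LIMSEQ_subseq_LIMSEQ[OF u s] by (simp add: o_def)
  ultimately have "e \<le> u q" by (intro tendsto_lowerbound) auto
  then show "q \<in> - L" using e by (simp add: L_def)
qed

lemma frontier_ne: "frontier (E n) \<noteq> {}"
proof -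
  have "bounded (E n)" using R bounded_cball bounded_subset by blast
  then have "E n \<noteq> UNIV" using not_bounded_UNIV by metis
  then show ?thesis using ne[of n] frontier_eq_empty by blast
qed

text \<open>The nearest boundary points \<open>p n\<close> of \<open>E n\<close> converge to
  \<open>x\<close>, and the centres of their tangent balls stay bounded. Since the radius is fixed,
  limits of these centres are centres of tangent balls at \<open>x\<close>; the interior and the
  exterior balls may use different subsequences.\<close>

lemma L_in_K: "L \<in> K_class \<delta>"
  unfolding K_class_def ball_condition_def
proof (intro CollectI conjI closed_L ballI)
  fix x assume x: "x \<in> frontier L"
  define p where "p = (\<lambda>n. closest_point (frontier (E n)) x)"
  have p: "p n \<in> frontier (E n)" "\<And>w. w \<in> frontier (E n) \<Longrightarrow> dist x (p n) \<le> dist x w" for n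
    unfolding p_def using closest_point_exists[OF frontier_closed frontier_ne] by blast+
  have lim: "p \<longlonglongrightarrow> x"
  proof (rule tendstoI)
    fix e :: real assume "e > 0"
    from frontier_near[OF x this] show "\<forall>\<^sub>F n in sequentially. dist (p n) x < e"
    proof eventually_elim
      case (elim n)
      then obtain w where "w \<in> frontier (E n)" "dist x w < e" by auto
      then show ?case using p(2)[of w n] by (simp add: dist_commute)
    qed
  qed
  have "\<exists>y. ball y \<delta> \<subseteq> E n \<and> dist (p n) y = \<delta>" "\<exists>z. ball z \<delta> \<subseteq> - E n \<and> dist (p n) z = \<delta>" for n
    using K[of n] p(1)[of n] unfolding K_class_def ball_condition_def by simp_all
  then obtain y z where y: "\<And>n. ball (y n) \<delta> \<subseteq> E n" "\<And>n. dist (p n) (y n) = \<delta>"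
    and z: "\<And>n. ball (z n) \<delta> \<subseteq> - E n" "\<And>n. dist (p n) (z n) = \<delta>" by metis
  have pR: "norm (p n) \<le> R" for n
    using p(1)[of n] cl[of n] R[of n] by (auto simp: frontier_def)
  have bd: "c n \<in> cball 0 (R + \<delta>)" if "\<And>n. dist (p n) (c n) = \<delta>" for c n
    using that[of n] pR[of n] norm_triangle_ineq2[of "c n" "p n"] by (simp add: dist_norm norm_minus_commute)
  have sc: "seq_compact (cball (0::'a) (R + \<delta>))" by (intro compact_imp_seq_compact compact_cball)
  have sub: "\<exists>s l. strict_mono (s :: nat \<Rightarrow> nat) \<and> (\<lambda>n. c (s n)) \<longlonglongrightarrow> l \<and> dist x l = \<delta>"
    if c: "\<And>n. dist (p n) (c n) = \<delta>" for c
  proof -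
    have "\<exists>l\<in>cball 0 (R + \<delta>). \<exists>r. strict_mono (r :: nat \<Rightarrow> nat) \<and> (c \<circ> r) \<longlonglongrightarrow> l"
      by (rule sc[unfolded seq_compact_def, rule_format]) (rule bd[OF c])
    then obtain l s where s: "strict_mono (s :: nat \<Rightarrow> nat)" "(c \<circ> s) \<longlonglongrightarrow> l"
      by blast
    have "(\<lambda>n. dist (p (s n)) (c (s n))) \<longlonglongrightarrow> dist x l"
      using LIMSEQ_subseq_LIMSEQ[OF lim s(1)] s(2) by (intro tendsto_dist) (simp_all add: o_def)
    then have "dist x l = \<delta>" unfolding c using LIMSEQ_const_iff[of \<delta> "dist x l"] by simp
    then show ?thesis using s by (auto simp: o_def)
  qed
  obtain s l where s: "strict_mono s" "(\<lambda>n. y (s n)) \<longlonglongrightarrow> l" "dist x l = \<delta>" using sub[OF y(2)] by blast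
  obtain s' l' where s': "strict_mono s'" "(\<lambda>n. z (s' n)) \<longlonglongrightarrow> l'" "dist x l' = \<delta>" using sub[OF z(2)] by blast
  show "\<exists>y. ball y \<delta> \<subseteq> L \<and> dist x y = \<delta>" using limit_ball_inside[OF s(1,2)] y(1) s(3) by blast
  show "\<exists>z. ball z \<delta> \<subseteq> - L \<and> dist x z = \<delta>" using limit_ball_outside[OF s'(1,2)] z(1) s'(3) by blast
qed

text \<open>Inside \<open>L\<close> boundaries could persist as the sides of thin gaps that close up
  in the limit. The exterior ball rules this out: at a boundary point it contains a point at
  distance at least \<open>\<tau>\<close> from \<open>E n\<close>, whereas the distances to
  \<open>E n\<close> become uniformly small near \<open>p\<close>.\<close>

lemma frontier_outside:
  assumes "p \<notin> frontier L"
  shows "\<exists>\<epsilon>>0. \<forall>\<^sub>F n in sequentially. frontier (E n) \<inter> ball p \<epsilon> = {}"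
proof (cases "p \<in> L")
  case False
  have "frontier (E n) \<subseteq> E n" for n by (rule frontier_subset_closed[OF cl])
  moreover obtain \<epsilon> where "\<epsilon> > 0" "\<forall>\<^sub>F n in sequentially. E n \<inter> ball p \<epsilon> = {}" using outside[OF False] by blast
  ultimately show ?thesis by (intro exI[of _ \<epsilon>] conjI) (auto elim!: eventually_mono)
next
  case True
  then have "p \<in> interior L" using assms closed_L by (simp add: frontier_def)
  then obtain \<rho> where \<rho>: "\<rho> > 0" "cball p \<rho> \<subseteq> L" by (auto simp: mem_interior_cball)
  define \<tau> where "\<tau> = min \<rho> \<delta> / 4"
  have \<tau>: "\<tau> > 0" "\<tau> \<le> \<rho> / 4" "\<tau> < \<delta>" using \<rho>(1) \<delta> by (auto simp: \<tau>_def)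
  \<comment> \<open>A finite net and the Lipschitz bound turn the pointwise convergence of the
    distances into a uniform bound on the ball.\<close>
  obtain N where N: "finite N" "N \<subseteq> cball p \<rho>" "cball p \<rho> \<subseteq> (\<Union>x\<in>N. ball x (\<tau> / 2))"
    using seq_compact_imp_totally_bounded[OF compact_imp_seq_compact[OF compact_cball[of p \<rho>]]] \<tau>(1)
    by (metis half_gt_zero)
  have "\<forall>\<^sub>F n in sequentially. infdist a (E n) < \<tau> / 2" if "a \<in> N" for a
    using that N(2) \<rho>(2) \<tau>(1) by (intro order_tendstoD(2)[OF u]) (auto simp: L_def subset_iff)
  then have "\<forall>\<^sub>F n in sequentially. \<forall>a\<in>N. infdist a (E n) < \<tau> / 2"
    using N(1) by (intro eventually_ball_finite) auto
  then have "\<forall>\<^sub>F n in sequentially. frontier (E n) \<inter> ball p (\<rho> / 2) = {}"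
  proof eventually_elim
    case (elim n)
    have small: "infdist q (E n) < \<tau>" if "q \<in> cball p \<rho>" for q
    proof -
      have "q \<in> (\<Union>x\<in>N. ball x (\<tau> / 2))" using N(3) that by blast
      then obtain a where "a \<in> N" "dist a q < \<tau> / 2" by auto
      then show ?thesis using elim infdist_lipschitz[of q "E n" a] by (fastforce simp: dist_commute)
    qed
    show ?case
    proof (rule ccontr)
      assume "frontier (E n) \<inter> ball p (\<rho> / 2) \<noteq> {}"
      then obtain x where x: "x \<in> frontier (E n)" "dist p x < \<rho> / 2" by auto
      obtain \<nu> where \<nu>: "norm \<nu> = 1" "ball (x - \<delta> *\<^sub>R \<nu>) \<delta> \<subseteq> E n" "ball (x + \<delta> *\<^sub>R \<nu>) \<delta> \<subseteq> - E n"
        using K_class_normal[OF K \<delta> x(1)] by blast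
      \<comment> \<open>\<open>q\<close> lies on the outer normal, at depth \<open>\<tau>\<close> in
        the exterior ball.\<close>
      define q where "q = x + \<tau> *\<^sub>R \<nu>"
      have dxq: "dist x q = \<tau>" using \<nu>(1) \<tau>(1) by (simp add: q_def dist_norm)
      have dqz: "dist (x + \<delta> *\<^sub>R \<nu>) q = \<delta> - \<tau>"
      proof -
        have "(x + \<delta> *\<^sub>R \<nu>) - q = (\<delta> - \<tau>) *\<^sub>R \<nu>" by (simp add: q_def algebra_simps)
        then show ?thesis using \<nu>(1) \<tau>(3) by (simp add: dist_norm)
      qed
      have "q \<in> cball p \<rho>" using dist_triangle[of p q x] x(2) dxq \<tau>(2) \<rho>(1) by simp
      then have "infdist q (E n) < \<tau>" by (rule small)
      moreover have "\<tau> \<le> infdist q (E n)"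
      proof (rule le_infdist[OF ne])
        fix a assume "a \<in> E n"
        then have "a \<notin> ball (x + \<delta> *\<^sub>R \<nu>) \<delta>" using \<nu>(3) by blast
        then have "\<delta> \<le> dist (x + \<delta> *\<^sub>R \<nu>) a" by simp
        also have "\<dots> \<le> dist (x + \<delta> *\<^sub>R \<nu>) q + dist q a" by (rule dist_triangle)
        finally show "\<tau> \<le> dist q a" using dqz by simp
      qed
      ultimately show False by simp
    qed
  qed
  then show ?thesis using \<rho>(1) by (intro exI[of _ "\<rho> / 2"]) simp
qed

text \<open>Near an interior point of \<open>L\<close> the boundaries of \<open>E n\<close> have
  gone while \<open>E n\<close> still meets the small ball; being connected, the ball then lies in
  \<open>E n\<close>.\<close>

lemma inside:
  assumes "p \<in> interior L"
  shows "\<forall>\<^sub>F n in sequentially. p \<in> E n"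
proof -
  have "p \<notin> frontier L" "p \<in> L" using assms interior_subset by (auto simp: frontier_def)
  then obtain \<epsilon> where e: "\<epsilon> > 0" "\<forall>\<^sub>F n in sequentially. frontier (E n) \<inter> ball p \<epsilon> = {}"
    using frontier_outside by blast
  show ?thesis using e(2) near[OF \<open>p \<in> L\<close> e(1)]
  proof eventually_elim
    case (elim n)
    then have "ball p \<epsilon> - E n = {}" using connected_Int_frontier[OF connected_ball, of p \<epsilon> "E n"] by blast
    moreover have "p \<in> ball p \<epsilon>" using e(1) by simp
    ultimately show ?case by blast
  qed
qed

lemma borel_E: "E n \<in> sets borel" "L \<in> sets borel"
  using cl closed_L by auto

text \<open>Off the boundary of \<open>L\<close>, membership in \<open>E n\<close> eventually agrees
  with membership in \<open>L\<close>. This boundary is null because \<open>L\<close> belongs to the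
  class again.\<close>

lemma indicator_conv: "AE x in lborel. (\<lambda>n. indicator (E n) x :: real) \<longlonglongrightarrow> indicator L x"
proof -
  have "frontier L \<in> null_sets lborel"
    using K_class_frontier_negligible[OF L_in_K \<delta>] by (simp add: negligible_iff_null_sets null_sets_completion_iff)
  then have "AE x in lborel. x \<notin> frontier L" by (rule AE_not_in)
  then show ?thesis
  proof eventually_elim
    case (elim x)
    have "\<forall>\<^sub>F n in sequentially. (indicator (E n) x :: real) = indicator L x"
    proof (cases "x \<in> L")
      case True
      then have "x \<in> interior L" using elim closed_L by (simp add: frontier_def)
      from inside[OF this] show ?thesis by eventually_elim (simp add: True)
    next
      case False
      then obtain \<epsilon> where e: "\<epsilon> > 0" "\<forall>\<^sub>F n in sequentially. E n \<inter> ball x \<epsilon> = {}" using outside by blast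
      from e(2) show ?thesis
      proof eventually_elim
        case (elim n)
        have "x \<in> ball x \<epsilon>" using e(1) by simp
        then have "x \<notin> E n" using elim by blast
        then show ?case using False by simp
      qed
    qed
    then show ?case by (rule tendsto_eventually)
  qed
qed

lemma integral_conv:
  assumes f: "continuous_on UNIV f"
  shows "(\<lambda>n. \<integral>x. indicator (E n) x * f x \<partial>lborel) \<longlonglongrightarrow> (\<integral>x. indicator L x * f x \<partial>lborel :: real)"
proof -
  obtain M where M: "\<And>x. x \<in> cball 0 (max R 0) \<Longrightarrow> norm (f x) \<le> M"
  proof -
    have "compact (f ` cball 0 (max R 0))" by (intro compact_continuous_image continuous_on_subset[OF f]) auto
    then show ?thesis using that compact_imp_bounded bounded_iff by (metis imageI)
  qed
  have fm: "f \<in> borel_measurable borel" using f by (rule borel_measurable_continuous_onI)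
  have M0: "M \<ge> 0" using order_trans[OF norm_ge_zero M[of 0]] by simp
  show ?thesis
  proof (rule integral_dominated_convergence[where w = "\<lambda>x. M * indicator (cball 0 R) x"])
    show "(\<lambda>x. indicator L x * f x) \<in> borel_measurable lborel" using borel_E fm by simp
    show "(\<lambda>x. indicator (E n) x * f x) \<in> borel_measurable lborel" for n using borel_E fm by simp
    show "integrable lborel (\<lambda>x. M * indicator (cball (0::'a) R) x)"
      using emeasure_lborel_cball_finite[of "0::'a" R] by (intro integrable_mult_right integrable_real_indicator) auto
    show "AE x in lborel. (\<lambda>n. indicator (E n) x * f x) \<longlonglongrightarrow> indicator L x * f x"
      using indicator_conv by eventually_elim (intro tendsto_intros)
    show "AE x in lborel. norm (indicator (E n) x * f x) \<le> M * indicator (cball 0 R) x" for n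
    proof (rule AE_I2)
      fix x
      show "norm (indicator (E n) x * f x) \<le> M * indicator (cball 0 R) x"
        using M[of x] R[of n] M0 by (auto simp: indicator_def)
    qed
  qed
qed

lemma emeasure_L:
  assumes "\<And>n. emeasure lborel (E n) = ennreal m" "m \<ge> 0"
  shows "emeasure lborel L = ennreal m"
proof -
  have fin: "emeasure lborel S < \<infinity>" if "S \<subseteq> cball (0::'a) R" for S
    using emeasure_mono[OF that, of lborel] emeasure_lborel_cball_finite[of "0::'a" R] by (auto intro: le_less_trans)
  have meas: "(\<integral>x. indicator S x * 1 \<partial>lborel) = measure lborel S" if "S \<in> sets borel" "S \<subseteq> cball 0 R" for S :: "'a set"
    using that fin[OF that(2)] by simp
  have "(\<lambda>n. measure lborel (E n)) \<longlonglongrightarrow> measure lborel L"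
    using integral_conv[of "\<lambda>_. 1"] meas[OF borel_E(1) R] meas[OF borel_E(2) L_sub] by simp
  moreover have "measure lborel (E n) = m" for n using assms by (simp add: measure_def)
  ultimately have "measure lborel L = m" by (simp add: LIMSEQ_const_iff)
  then show ?thesis using fin[OF L_sub] emeasure_eq_ennreal_measure[of lborel L] by simp
qed

lemma perimeter_L:
  assumes "\<forall>\<^sub>F n in sequentially. perimeter (E n) \<le> c"
  shows "perimeter L \<le> c"
proof -
  have "ennreal (\<integral>x. indicator L x * divergence T x \<partial>lborel) \<le> c"
    if T: "C1_compact_support T" "\<And>x. norm (T x) \<le> 1" for T
  proof (rule tendsto_upperbound)
    have "continuous_on UNIV (divergence T)" by (rule divergence_bounds[OF T(1)])
    from integral_conv[OF this]
    show "(\<lambda>n. ennreal (\<integral>x. indicator (E n) x * divergence T x \<partial>lborel)) \<longlonglongrightarrow> ennreal (\<integral>x. indicator L x * divergence T x \<partial>lborel)"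
      by (rule tendsto_ennrealI)
    show "\<forall>\<^sub>F n in sequentially. ennreal (\<integral>x. indicator (E n) x * divergence T x \<partial>lborel) \<le> c"
      using assms by eventually_elim (use perimeter_lower[OF borel_E(1) T] order_trans in blast)
  qed simp
  then show ?thesis
    unfolding perimeter_def using borel_E(2) by (intro SUP_least) (auto simp: set_integral_divergence)
qed

lemma I_riesz_L:
  assumes "\<alpha> > 0" "\<forall>\<^sub>F n in sequentially. I_riesz \<alpha> (E n) < ennreal c"
  shows "I_riesz \<alpha> L \<le> ennreal c"
  by (rule I_riesz_lsc_eventually[OF assms(1) borel_E R L_sub outside assms(2)])

lemma I_riesz_frontier_L:
  assumes "\<alpha> > 0" "\<forall>\<^sub>F n in sequentially. I_riesz \<alpha> (frontier (E n)) < ennreal c"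
  shows "I_riesz \<alpha> (frontier L) \<le> ennreal c"
proof (rule I_riesz_lsc_eventually[OF assms(1) _ _ _ _ frontier_outside assms(2)])
  show "frontier (E n) \<subseteq> cball 0 R" for n using frontier_subset_closed[OF cl] R by blast
  show "frontier L \<subseteq> cball 0 R" using frontier_subset_closed[OF closed_L] L_sub by blast
qed auto

end

section \<open>Existence of minimizers\<close>

text \<open>If \<open>a\<close> is the smaller radius, then \<open>a ^ n\<close> is at most half of
  \<open>r ^ n\<close>, so \<open>r - a\<close> is at least \<open>r * (1 - root n (1/2))\<close>.
  The gain is read off from the identity \<open>r * (a ^ k + b ^ k - r ^ k) = a ^ k * (r - a) + b ^
  k * (r - b)\<close> with \<open>k = n - 1\<close>.\<close>

lemma split_radii_gain:
  fixes a b r \<delta> :: real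
  assumes "n > 0" "\<delta> > 0" "a \<ge> \<delta>" "b \<ge> \<delta>" "r > 0" and sum: "a ^ n + b ^ n = r ^ n"
  shows "r ^ (n - 1) + \<delta> ^ (n - 1) * (1 - root n (1/2)) \<le> a ^ (n - 1) + b ^ (n - 1)"
proof -
  have main: "r ^ (n - 1) + \<delta> ^ (n - 1) * (1 - root n (1/2)) \<le> a ^ (n - 1) + b ^ (n - 1)"
    if ab: "a \<le> b" "a \<ge> \<delta>" and sum: "a ^ n + b ^ n = r ^ n" for a b
  proof -
    have a0: "a > 0" "b > 0" using ab assms(2) by auto
    have "a ^ n \<le> b ^ n" using ab a0 by (intro power_mono) auto
    then have "a ^ n \<le> r ^ n * (1/2)" using sum by simp
    then have "root n (a ^ n) \<le> root n (r ^ n * (1/2))" using assms(1) by (intro real_root_le_mono)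
    moreover have "root n (r ^ n * (1/2)) = r * root n (1/2)"
      by (subst real_root_mult) (use assms(1,5) in \<open>simp add: real_root_power_cancel\<close>)
    ultimately have ar: "a \<le> r * root n (1/2)" using assms(1) a0 by (simp add: real_root_power_cancel)
    have "b ^ n \<le> r ^ n" using sum zero_le_power[of a n] a0 by linarith
    then have br: "b \<le> r" using assms(1,5) a0 by (simp add: power_mono_iff)
    obtain k where k: "n = Suc k" using assms(1) gr0_implies_Suc by blast
    have "r * (\<delta> ^ k * (1 - root n (1/2))) = \<delta> ^ k * (r - r * root n (1/2))" by (simp add: algebra_simps)
    also have "\<dots> \<le> a ^ k * (r - a)"
      using ar ab assms(1,2,5) by (intro mult_mono power_mono) (auto simp: mult_left_le)
    also have "\<dots> \<le> a ^ k * (r - a) + b ^ k * (r - b)" using br a0 by simp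
    also have "\<dots> = r * (a ^ k + b ^ k) - (a ^ n + b ^ n)" by (simp add: k algebra_simps)
    also have "\<dots> = r * (a ^ k + b ^ k - r ^ k)" unfolding sum by (simp add: k algebra_simps)
    finally have "\<delta> ^ k * (1 - root n (1/2)) \<le> a ^ k + b ^ k - r ^ k" using assms(5) by simp
    then show ?thesis by (simp add: k)
  qed
  show ?thesis
  proof (cases "a \<le> b")
    case True then show ?thesis using main[of a b] assms by simp
  next
    case False then show ?thesis using main[of b a] assms by (simp add: add.commute)
  qed
qed

text \<open>Each piece is measured by the radius of the ball of equal volume. In these radii, which
  are at least \<open>\<delta>\<close>, the isoperimetric bounds of the two pieces take the form to
  which \<open>split_radii_gain\<close> applies.\<close>

lemma K_class_gap_perimeter:
  fixes E :: "'a::euclidean_space set"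
  assumes E: "E \<in> K_class \<delta>" "compact E" and \<delta>: "\<delta> > 0" and b: "b \<in> Basis"
    and xy: "x \<in> E" "y \<in> E" "x \<bullet> b < s" "s < y \<bullet> b" and gap: "\<And>p. p \<in> E \<Longrightarrow> p \<bullet> b \<noteq> s"
    and r: "r > 0" "measure lebesgue E = measure lebesgue (ball (0::'a) 1) * r ^ DIM('a)"
  shows "ennreal (DIM('a) * measure lebesgue (ball (0::'a) 1) *
      (r ^ (DIM('a) - 1) + \<delta> ^ (DIM('a) - 1) * (1 - root DIM('a) (1/2)))) \<le> perimeter E"
proof -
  let ?n = "DIM('a)" and ?\<mu> = "measure lebesgue :: 'a set \<Rightarrow> real"
  define w where "w = ?\<mu> (ball (0::'a) 1)"
  have w: "w > 0" by (simp add: w_def)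
  have n: "?n > 0" by simp
  have split: "\<exists>a\<ge>\<delta>. ?\<mu> H = w * a ^ ?n \<and> ?\<mu> (interior H) = w * a ^ ?n \<and> interior H \<noteq> {}"
    if H: "H = E \<inter> {p. p \<bullet> b < s} \<or> H = E \<inter> {p. p \<bullet> b > s}" and cH: "compact H" and z: "z \<in> H" for H z
  proof -
    have "z \<in> E" using H z by blast
    then obtain c C where C: "ball c \<delta> \<subseteq> C" "connected C" "z \<in> C" "C \<subseteq> E"
      by (rule K_class_inner_ball[OF E(1) \<delta>]) (rule that)
    \<comment> \<open>A connected subset of \<open>E\<close> cannot cross the level
      \<open>s\<close>, so the ball linked to \<open>z\<close> stays in the piece of
      \<open>z\<close>.\<close>
    have "C \<subseteq> H"
    proof
      fix q assume q: "q \<in> C"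
      have "\<not> (z \<bullet> b \<le> s \<and> s \<le> q \<bullet> b)" "\<not> (q \<bullet> b \<le> s \<and> s \<le> z \<bullet> b)"
        using connected_ivt_component[OF C(2,3) q, of b s] connected_ivt_component[OF C(2) q C(3), of b s] gap C(4) by blast+
      then show "q \<in> H" using H z q C(4) by auto
    qed
    then have ball: "ball c \<delta> \<subseteq> H" using C(1) by blast
    have lmH: "H \<in> lmeasurable" using cH by (rule lmeasurable_compact)
    have "w * \<delta> ^ ?n = ?\<mu> (ball c \<delta>)" using \<delta> by (simp add: w_def content_ball)
    also have "\<dots> \<le> ?\<mu> H" using ball lmH by (intro measure_mono_fmeasurable) auto
    finally have ge: "w * \<delta> ^ ?n \<le> ?\<mu> H" .
    define a where "a = root ?n (?\<mu> H / w)"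
    have an: "?\<mu> H = w * a ^ ?n" using w by (simp add: a_def real_root_pow_pos2)
    have "\<delta> = root ?n (\<delta> ^ ?n)" using \<delta> by (simp add: real_root_power_cancel)
    also have "\<dots> \<le> a" unfolding a_def using ge w by (intro real_root_le_mono) (auto simp: field_simps)
    finally have a\<delta>: "a \<ge> \<delta>" .
    \<comment> \<open>The half-spaces are open, so the cut creates no new boundary points within the
      piece; hence its interior has the full measure.\<close>
    have sub: "H - interior H \<subseteq> frontier E"
    proof
      fix q assume q: "q \<in> H - interior H"
      have "q \<notin> interior E"
      proof
        assume qi: "q \<in> interior E"
        have "open {p. p \<bullet> b < s}" "open {p. p \<bullet> b > s}"
          using open_halfspace_component_lt open_halfspace_component_gt by auto
        then have o: "open (interior E \<inter> {p. p \<bullet> b < s})" "open (interior E \<inter> {p. p \<bullet> b > s})" by auto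
        from H show False
        proof
          assume h: "H = E \<inter> {p. p \<bullet> b < s}"
          have "interior E \<inter> {p. p \<bullet> b < s} \<subseteq> interior H" using o(1) interior_subset h by (intro interior_maximal) blast+
          then show False using q qi h by blast
        next
          assume h: "H = E \<inter> {p. p \<bullet> b > s}"
          have "interior E \<inter> {p. p \<bullet> b > s} \<subseteq> interior H" using o(2) interior_subset h by (intro interior_maximal) blast+
          then show False using q qi h by blast
        qed
      qed
      moreover have "q \<in> E" using q H by blast
      ultimately show "q \<in> frontier E" using closure_subset by (auto simp: frontier_def)
    qed
    have "?\<mu> (interior H) = ?\<mu> H"
    proof (rule measure_negligible_symdiff[OF lmH])
      have "H - interior H \<union> (interior H - H) \<subseteq> frontier E" using sub interior_subset by blast
      then show "negligible (H - interior H \<union> (interior H - H))"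
        using negligible_subset[OF K_class_frontier_negligible[OF E(1) \<delta>]] by blast
    qed
    moreover have "interior H \<noteq> {}"
      using ball \<delta> interior_maximal[OF ball open_ball] by (metis ball_eq_empty not_le subset_empty)
    ultimately show ?thesis using an a\<delta> by auto
  qed
  define A where "A = E \<inter> {p. p \<bullet> b < s}"
  define B where "B = E \<inter> {p. p \<bullet> b > s}"
  have "A = E \<inter> {p. p \<bullet> b \<le> s}" "B = E \<inter> {p. p \<bullet> b \<ge> s}" unfolding A_def B_def using gap by force+
  then have cAB: "compact A" "compact B"
    using E(2) by (auto intro!: compact_Int_closed closed_halfspace_component_le closed_halfspace_component_ge)
  obtain a where a: "a \<ge> \<delta>" "?\<mu> A = w * a ^ ?n" "?\<mu> (interior A) = w * a ^ ?n" "interior A \<noteq> {}"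
    using split[of A x] cAB xy by (auto simp: A_def)
  obtain c where c: "c \<ge> \<delta>" "?\<mu> B = w * c ^ ?n" "?\<mu> (interior B) = w * c ^ ?n" "interior B \<noteq> {}"
    using split[of B y] cAB xy by (auto simp: B_def)
  have EAB: "E = A \<union> B" "A \<inter> B = {}" unfolding A_def B_def using gap by force+
  have "?\<mu> E = ?\<mu> A + ?\<mu> B"
    using measure_Un3[of A lebesgue B] cAB EAB by (simp add: lmeasurable_compact)
  then have "w * (a ^ ?n + c ^ ?n) = w * r ^ ?n" using a(2) c(2) r(2) by (simp add: w_def algebra_simps)
  then have sum: "a ^ ?n + c ^ ?n = r ^ ?n" using w by simp
  have gain: "r ^ (?n - 1) + \<delta> ^ (?n - 1) * (1 - root ?n (1/2)) \<le> a ^ (?n - 1) + c ^ (?n - 1)"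
    by (rule split_radii_gain[OF n \<delta> a(1) c(1) r(1) sum])
  have rw: "root ?n w * root ?n (w * t ^ ?n) ^ (?n - 1) = w * t ^ (?n - 1)" if "t \<ge> \<delta>" for t
  proof -
    have "root ?n (w * t ^ ?n) = root ?n w * t" using that \<delta> by (simp add: real_root_mult real_root_power_cancel)
    then have "root ?n w * root ?n (w * t ^ ?n) ^ (?n - 1) = (root ?n w * root ?n w ^ (?n - 1)) * t ^ (?n - 1)"
      by (simp add: power_mult_distrib)
    also have "root ?n w * root ?n w ^ (?n - 1) = root ?n w ^ ?n" by (metis n power_eq_if not_gr_zero)
    also have "\<dots> = w" using w by (simp add: real_root_pow_pos2)
    finally show ?thesis .
  qed
  have "ennreal (?n * root ?n w * (root ?n (w * a ^ ?n) ^ (?n - 1) + root ?n (w * c ^ ?n) ^ (?n - 1))) \<le> perimeter E"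
    using perimeter_two_pieces[OF cAB(1) a(4) cAB(2) c(4) EAB(2)] a(3) c(3) EAB(1) by (simp add: w_def)
  also have "?n * root ?n w * (root ?n (w * a ^ ?n) ^ (?n - 1) + root ?n (w * c ^ ?n) ^ (?n - 1)) = ?n * w * (a ^ (?n - 1) + c ^ (?n - 1))"
    using rw[OF a(1)] rw[OF c(1)] by (simp add: distrib_left mult.assoc)
  finally have "ennreal (?n * w * (a ^ (?n - 1) + c ^ (?n - 1))) \<le> perimeter E" .
  moreover have "?n * w * (r ^ (?n - 1) + \<delta> ^ (?n - 1) * (1 - root ?n (1/2))) \<le> ?n * w * (a ^ (?n - 1) + c ^ (?n - 1))"
    using gain w by (intro mult_left_mono) auto
  ultimately show ?thesis unfolding w_def[symmetric] by (meson ennreal_leI order_trans)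
qed

lemma emeasure_lebesgue_translation:
  fixes E :: "'a::euclidean_space set"
  assumes "closed E"
  shows "emeasure lebesgue ((+) a ` E) = emeasure lebesgue E"
proof -
  have c: "closed ((+) a ` E)" using assms by (simp add: closed_translation)
  have "emeasure lborel ((+) a ` E) = emeasure (distr lborel borel ((+) a)) ((+) a ` E)" by (simp add: lborel_distr_plus)
  also have "\<dots> = emeasure lborel ((+) a -` ((+) a ` E))" using c by (subst emeasure_distr) auto
  also have "(+) a -` ((+) a ` E) = E" by (auto simp: inj_vimage_image_eq)
  finally show ?thesis using c assms by simp
qed

text \<open>\<open>J\<close> stands for the Riesz energy of the set or of its boundary. The width
  bound \<open>W\<close> is only asked of sets that beat \<open>E0\<close>: if there are none,
  \<open>E0\<close> itself is a minimizer, even when its energy is infinite.\<close>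

lemma direct_method:
  fixes J :: "'a::euclidean_space set \<Rightarrow> ennreal"
  defines "adm \<equiv> \<lambda>\<delta> m (E::'a set). emeasure lebesgue E = ennreal m \<and> E \<in> K_class \<delta>"
  assumes \<delta>: "\<delta> > 0" and m: "m > 0" and q: "q > 0"
    and trans: "\<And>E a. E \<in> K_class \<delta> \<Longrightarrow> J ((+) a ` E) \<le> J E"
    and lsc: "\<And>R E u c. K_limit \<delta> R E u \<Longrightarrow> \<forall>\<^sub>F n in sequentially. J (E n) < ennreal c \<Longrightarrow> J (K_limit.L u) \<le> ennreal c"
    and f: "\<And>E. f E = perimeter E + ennreal q * J E"
    and E0: "adm \<delta> m E0"
    and W: "\<And>E x y b. \<lbrakk>adm \<delta> m E; f E < f E0; x \<in> E; y \<in> E; b \<in> Basis\<rbrakk> \<Longrightarrow> y \<bullet> b - x \<bullet> b \<le> W"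
  shows "\<exists>E. is_arg_min f (adm \<delta> m) E"
proof (cases "is_arg_min f (adm \<delta> m) E0")
  case False
  define S where "S = {E. adm \<delta> m E \<and> f E < f E0}"
  obtain E1 where E1: "E1 \<in> S" using False E0 by (auto simp: is_arg_min_def S_def)
  define v where "v = (INF E\<in>S. f E)"
  have "v \<le> f E1" unfolding v_def using E1 by (rule INF_lower)
  also have "\<dots> < f E0" using E1 by (simp add: S_def)
  finally have vE0: "v < f E0" .
  then have "v < top" using le_less_trans less_top by (metis top_greatest order_less_le_trans)
  then obtain v' where v': "v = ennreal v'" "v' \<ge> 0" by (cases v) auto
  have "\<exists>E. E \<in> S \<and> f E < ennreal (v' + 1 / Suc n)" for n
  proof -
    have "v < ennreal (v' + 1 / Suc n)" unfolding v'(1) using v'(2) by (intro ennreal_lessI) (auto intro: add_nonneg_pos)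
    then show ?thesis unfolding v_def INF_less_iff by blast
  qed
  then obtain E where E: "\<And>n. E n \<in> S" "\<And>n. f (E n) < ennreal (v' + 1 / Suc n)" by metis
  have admE: "emeasure lebesgue (E n) = ennreal m" "E n \<in> K_class \<delta>" for n using E(1)[of n] by (auto simp: S_def adm_def)
  have neE: "E n \<noteq> {}" for n using admE(1)[of n] m by auto
  define x where "x = (\<lambda>n. SOME z. z \<in> E n)"
  have x: "x n \<in> E n" for n unfolding x_def by (rule some_in_eq[THEN iffD2, OF neE])
  \<comment> \<open>Translation puts a point of each set at the origin, so that the width bound in
    each coordinate confines all sets to one ball.\<close>
  define G where "G = (\<lambda>n. (+) (- x n) ` E n)"
  have clE: "closed (E n)" for n using admE(2) by (rule K_class_closed)
  have GK: "G n \<in> K_class \<delta>" for n unfolding G_def by (rule K_class_translation[OF admE(2)])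
  have Gm: "emeasure lebesgue (G n) = ennreal m" for n
    unfolding G_def emeasure_lebesgue_translation[OF clE] by (rule admE(1))
  have G0: "0 \<in> G n" for n unfolding G_def using x by force
  have fG: "f (G n) < ennreal (v' + 1 / Suc n)" for n
  proof -
    have "f (G n) \<le> f (E n)"
      unfolding f G_def by (intro add_mono mult_left_mono perimeter_translation_le borel_closed clE trans admE(2)) simp
    then show ?thesis using E(2)[of n] by simp
  qed
  define R where "R = DIM('a) * W"
  have GR: "G n \<subseteq> cball 0 R" for n
  proof
    fix z assume "z \<in> G n"
    then obtain y where y: "y \<in> E n" "z = y - x n" by (auto simp: G_def)
    have aE: "adm \<delta> m (E n)" "f (E n) < f E0" using E(1)[of n] by (auto simp: S_def)
    have zW: "\<bar>z \<bullet> b\<bar> \<le> W" if "b \<in> Basis" for b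
      using W[OF aE x[of n] y(1) that] W[OF aE y(1) x[of n] that] by (simp add: y(2) inner_diff_left abs_le_iff)
    have "norm z \<le> (\<Sum>b\<in>Basis. \<bar>z \<bullet> b\<bar>)" by (rule norm_le_l1)
    also have "\<dots> \<le> (\<Sum>b\<in>(Basis::'a set). W)" by (rule sum_mono) (rule zW)
    finally show "z \<in> cball 0 R" by (simp add: R_def)
  qed
  \<comment> \<open>Perimeter and \<open>J\<close> are made to converge separately along a
    subsequence, because lower semicontinuity is available term by term.\<close>
  define P where "P = (\<lambda>n. enn2real (perimeter (G n)))"
  define j where "j = (\<lambda>n. enn2real (J (G n)))"
  have fin: "perimeter (G n) = ennreal (P n)" "J (G n) = ennreal (j n)" for n
  proof -
    have "perimeter (G n) + ennreal q * J (G n) < top" using fG[of n] unfolding f by (metis ennreal_less_top less_trans)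
    then have "perimeter (G n) < top" "ennreal q * J (G n) < top" by (auto simp: ennreal_add_less_top)
    then show "perimeter (G n) = ennreal (P n)" "J (G n) = ennreal (j n)"
      using q by (auto simp: P_def j_def ennreal_enn2real ennreal_mult_less_top)
  qed
  have P0: "P n \<ge> 0" and j0: "j n \<ge> 0" for n by (simp_all add: P_def j_def)
  have Pj: "P n + q * j n \<le> v' + 1 / Suc n" for n
  proof -
    have "ennreal (P n + q * j n) = f (G n)" unfolding f fin using P0 j0 q by (simp add: ennreal_plus ennreal_mult)
    then have "ennreal (P n + q * j n) \<le> ennreal (v' + 1 / Suc n)" using fG[of n] by simp
    then show ?thesis by (rule ennreal_le_iff[THEN iffD1, rotated]) (use v'(2) in simp)
  qed
  have PB: "(P n, j n) \<in> {0..v' + 1} \<times> {0..(v' + 1) / q}" for n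
  proof -
    have "1 / real (Suc n) \<le> 1" by simp
    then have "P n + q * j n \<le> v' + 1" using Pj[of n] by linarith
    moreover have "q * j n \<ge> 0" using q j0 by simp
    ultimately have "P n \<le> v' + 1" "q * j n \<le> v' + 1" using P0[of n] by linarith+
    then show ?thesis using P0 j0 q by (simp add: pos_le_divide_eq mult.commute)
  qed
  have sc: "seq_compact ({0..v' + 1} \<times> {0..(v' + 1) / q})" by (intro compact_imp_seq_compact compact_Times) auto
  have "\<exists>l\<in>{0..v' + 1} \<times> {0..(v' + 1) / q}. \<exists>r. strict_mono (r :: nat \<Rightarrow> nat) \<and> ((\<lambda>n. (P n, j n)) \<circ> r) \<longlonglongrightarrow> l"
    by (rule sc[unfolded seq_compact_def, rule_format]) (rule PB)
  then obtain p i s where s: "strict_mono (s :: nat \<Rightarrow> nat)" "((\<lambda>n. (P n, j n)) \<circ> s) \<longlonglongrightarrow> (p, i)"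
    and pi0: "p \<ge> 0" "i \<ge> 0" by auto
  obtain r where r: "strict_mono (r :: nat \<Rightarrow> nat)" "\<And>y. convergent (\<lambda>n. infdist y (G (s (r n))))"
    by (rule infdist_convergent_subsequence[of "\<lambda>n. G (s n)" R]) (use G0 GR in blast, rule GR, rule that)
  define t where "t = (\<lambda>n. s (r n))"
  have t: "strict_mono t" unfolding t_def using strict_mono_o[OF s(1) r(1)] by (simp add: o_def)
  have lim2: "(\<lambda>n. (P (t n), j (t n))) \<longlonglongrightarrow> (p, i)"
    using LIMSEQ_subseq_LIMSEQ[OF s(2) r(1)] by (simp add: o_def t_def)
  have limP: "(\<lambda>n. P (t n)) \<longlonglongrightarrow> p" and limj: "(\<lambda>n. j (t n)) \<longlonglongrightarrow> i"
    using tendsto_fst[OF lim2] tendsto_snd[OF lim2] by simp_all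
  have pv: "p + q * i \<le> v'"
  proof -
    have l1: "(\<lambda>n. P (t n) + q * j (t n)) \<longlonglongrightarrow> p + q * i" by (intro tendsto_intros limP limj)
    have "(\<lambda>n. 1 / real (Suc n)) \<longlonglongrightarrow> 0" using LIMSEQ_inverse_real_of_nat by (simp add: inverse_eq_divide)
    from LIMSEQ_subseq_LIMSEQ[OF this t] have "(\<lambda>n. 1 / real (Suc (t n))) \<longlonglongrightarrow> 0" by (simp add: o_def)
    from tendsto_add[OF tendsto_const this] have l2: "(\<lambda>n. v' + 1 / real (Suc (t n))) \<longlonglongrightarrow> v'" by simp
    show ?thesis by (rule LIMSEQ_le[OF l1 l2]) (use Pj in auto)
  qed
  define u where "u = (\<lambda>y. lim (\<lambda>n. infdist y (G (t n))))"
  interpret KL: K_limit \<delta> R "\<lambda>n. G (t n)" u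
  proof
    show "(\<lambda>n. infdist y (G (t n))) \<longlonglongrightarrow> u y" for y
      using r(2)[of y] unfolding u_def t_def by (simp add: convergent_LIMSEQ_iff)
    show "G (t n) \<noteq> {}" for n using G0 by blast
  qed (use \<delta> GK GR in auto)
  have admL: "adm \<delta> m KL.L"
  proof -
    have "closed (G n)" for n using GK by (rule K_class_closed)
    then have "emeasure lborel (G n) = ennreal m" for n using Gm[of n] by simp
    then have "emeasure lborel KL.L = ennreal m" using m by (intro KL.emeasure_L) auto
    then show ?thesis unfolding adm_def using KL.L_in_K KL.closed_L by simp
  qed
  have "f KL.L \<le> v"
  proof (rule ennreal_le_epsilon)
    fix e :: real assume e: "0 < e"
    \<comment> \<open>The perimeter may use up \<open>e'\<close> and the weighted \<open>J\<close>
      another \<open>q * e'\<close>, which makes \<open>e\<close> in total.\<close>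
    define e' where "e' = e / (1 + q)"
    have e': "e' > 0" using e q by (simp add: e'_def)
    have "\<forall>\<^sub>F n in sequentially. P (t n) < p + e'" using order_tendstoD(2)[OF limP] e' by simp
    then have "\<forall>\<^sub>F n in sequentially. perimeter (G (t n)) \<le> ennreal (p + e')"
      by eventually_elim (simp add: fin ennreal_leI)
    then have 1: "perimeter KL.L \<le> ennreal (p + e')" by (rule KL.perimeter_L)
    have "\<forall>\<^sub>F n in sequentially. j (t n) < i + e'" using order_tendstoD(2)[OF limj] e' by simp
    then have "\<forall>\<^sub>F n in sequentially. J (G (t n)) < ennreal (i + e')"
      by eventually_elim (simp add: fin j0 ennreal_lessI add_nonneg_pos pi0 e')
    then have 2: "J KL.L \<le> ennreal (i + e')" by (rule lsc[OF KL.K_limit_axioms])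
    have "f KL.L \<le> ennreal (p + e') + ennreal q * ennreal (i + e')"
      unfolding f using 1 2 by (intro add_mono mult_left_mono) auto
    also have "\<dots> = ennreal ((p + e') + q * (i + e'))"
      using pi0 e' q by (simp add: ennreal_plus ennreal_mult)
    also have "(p + e') + q * (i + e') = (p + q * i) + e"
    proof -
      have "e' * (1 + q) = e" using q by (simp add: e'_def)
      then show ?thesis by (simp add: algebra_simps)
    qed
    also have "ennreal \<dots> \<le> ennreal (v' + e)" using pv by (intro ennreal_leI) simp
    also have "\<dots> = v + ennreal e" using v' e by (simp add: ennreal_plus)
    finally show "f KL.L \<le> v + ennreal e" .
  qed
  then have "\<not> f F < f KL.L" if "adm \<delta> m F" for F
  proof -
    have "v \<le> f F" if "f F < f E0"
      unfolding v_def using \<open>adm \<delta> m F\<close> that by (intro INF_lower) (simp add: S_def)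
    then show ?thesis using \<open>f KL.L \<le> v\<close> vE0 by (metis less_le_trans not_le order_less_trans)
  qed
  then show ?thesis using admL by (auto simp: is_arg_min_def)
qed blast

text \<open>Inserting \<open>m = w * r ^ n\<close> into the hypothesis on \<open>Q\<close> leaves
  powers of \<open>w\<close> and the quotient \<open>\<delta> ^ (2 * n) / r ^ (n + 1)\<close>, which
  \<open>\<delta> \<le> r\<close> bounds by \<open>\<delta> ^ (n - 1)\<close>. The exponent of
  \<open>m\<close> is the one for which \<open>r powr \<alpha>\<close> cancels against the energy of
  the ball.\<close>

lemma small_charge_bound:
  fixes \<alpha> w c C \<delta> r m Q Q\<^sub>0 :: real
  assumes n: "n > 0" and pos: "w > 0" "\<delta> > 0" "r \<ge> \<delta>" "Q > 0" "C \<ge> 0" "Q\<^sub>0 > 0" and m: "m = w * r ^ n"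
    and Q\<^sub>0: "Q\<^sub>0\<^sup>2 * (C * w powr ((real n - 1 + \<alpha>) / real n - 2)) < c"
    and Q: "Q / m powr ((real n - 1 + \<alpha>) / (2 * real n)) \<le> Q\<^sub>0 * (\<delta> ^ n / m)"
  shows "Q\<^sup>2 * (C * r powr - \<alpha>) < c * \<delta> ^ (n - 1)"
proof -
  have r: "r > 0" using pos by simp
  have mp: "m > 0" using m pos(1) r by simp
  define \<beta> where "\<beta> = (real n - 1 + \<alpha>) / real n"
  have "Q \<le> Q\<^sub>0 * (\<delta> ^ n / m) * m powr ((real n - 1 + \<alpha>) / (2 * real n))"
    using Q mp by (simp add: divide_le_eq)
  then have "Q\<^sup>2 \<le> (Q\<^sub>0 * (\<delta> ^ n / m) * m powr ((real n - 1 + \<alpha>) / (2 * real n)))\<^sup>2"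
    using pos(4) by (intro power_mono) auto
  also have "\<dots> = Q\<^sub>0\<^sup>2 * (\<delta> ^ n / m)\<^sup>2 * (m powr ((real n - 1 + \<alpha>) / (2 * real n)))\<^sup>2"
    by (simp only: power_mult_distrib)
  also have "(m powr ((real n - 1 + \<alpha>) / (2 * real n)))\<^sup>2 = m powr \<beta>"
  proof -
    have "(m powr ((real n - 1 + \<alpha>) / (2 * real n)))\<^sup>2 = m powr (of_nat 2 * ((real n - 1 + \<alpha>) / (2 * real n)))"
      using mp by (intro powr_power) simp
    also have "of_nat 2 * ((real n - 1 + \<alpha>) / (2 * real n)) = \<beta>" using n by (simp add: \<beta>_def field_simps)
    finally show ?thesis .
  qed
  also have "m powr \<beta> = w powr \<beta> * r powr (real n * \<beta>)"
    using pos(1) r by (simp add: m powr_mult powr_powr flip: powr_realpow)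
  also have "real n * \<beta> = real n - 1 + \<alpha>" using n by (simp add: \<beta>_def)
  also have "r powr (real n - 1 + \<alpha>) = r ^ (n - 1) * r powr \<alpha>"
    using r n by (simp add: powr_add of_nat_diff flip: powr_realpow)
  also have "(\<delta> ^ n / m)\<^sup>2 = (\<delta> ^ n)\<^sup>2 / (r ^ n)\<^sup>2 / w\<^sup>2" by (simp add: m power_divide power_mult_distrib)
  finally have Q2: "Q\<^sup>2 \<le> Q\<^sub>0\<^sup>2 * ((\<delta> ^ n)\<^sup>2 / (r ^ n)\<^sup>2 / w\<^sup>2) * (w powr \<beta> * (r ^ (n - 1) * r powr \<alpha>))" .
  have wb: "w powr (\<beta> - 2) = w powr \<beta> / w\<^sup>2" using pos(1) by (simp add: powr_diff)
  have rr: "r powr \<alpha> * r powr - \<alpha> = 1" using r by (simp flip: powr_add)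
  have "Q\<^sup>2 * (C * r powr - \<alpha>) \<le> Q\<^sub>0\<^sup>2 * ((\<delta> ^ n)\<^sup>2 / (r ^ n)\<^sup>2 / w\<^sup>2) * (w powr \<beta> * (r ^ (n - 1) * r powr \<alpha>)) * (C * r powr - \<alpha>)"
    using Q2 pos(5) by (intro mult_right_mono) auto
  also have "\<dots> = Q\<^sub>0\<^sup>2 * (C * (w powr \<beta> / w\<^sup>2)) * ((\<delta> ^ n)\<^sup>2 * r ^ (n - 1) / (r ^ n)\<^sup>2) * (r powr \<alpha> * r powr - \<alpha>)"
    by (simp add: field_simps)
  also have "\<dots> = Q\<^sub>0\<^sup>2 * (C * w powr (\<beta> - 2)) * ((\<delta> ^ n)\<^sup>2 * r ^ (n - 1) / (r ^ n)\<^sup>2)" unfolding rr wb by simp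
  also have "\<dots> \<le> Q\<^sub>0\<^sup>2 * (C * w powr (\<beta> - 2)) * \<delta> ^ (n - 1)"
  proof (rule mult_left_mono)
    obtain k where k: "n = Suc k" using n gr0_implies_Suc by blast
    have "\<delta> ^ Suc n \<le> r ^ Suc n" using pos(2,3) by (intro power_mono) auto
    then have "\<delta> ^ k * (\<delta> ^ Suc n * r ^ k) \<le> \<delta> ^ k * (r ^ Suc n * r ^ k)" using pos(2) r by (intro mult_left_mono mult_right_mono) auto
    then have "(\<delta> ^ n)\<^sup>2 * r ^ (n - 1) \<le> \<delta> ^ (n - 1) * (r ^ n)\<^sup>2" by (simp add: k power2_eq_square algebra_simps)
    then show "(\<delta> ^ n)\<^sup>2 * r ^ (n - 1) / (r ^ n)\<^sup>2 \<le> \<delta> ^ (n - 1)" using r by (simp add: divide_le_eq)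
    show "0 \<le> Q\<^sub>0\<^sup>2 * (C * w powr (\<beta> - 2))" using pos(5) by simp
  qed
  also have "\<dots> < c * \<delta> ^ (n - 1)" using Q\<^sub>0 pos(2) by (intro mult_strict_right_mono) (auto simp: \<beta>_def)
  finally show ?thesis .
qed

text \<open>A gap at some level would lift the perimeter to the bound excluded by \<open>P\<close>,
  so there is none and the width estimate applies.\<close>

lemma width_bound:
  fixes E :: "'a::euclidean_space set"
  assumes \<delta>: "\<delta> > 0" and r: "r > 0" and m: "m = measure lebesgue (ball (0::'a) 1) * r ^ DIM('a)"
    and E: "emeasure lebesgue E = ennreal m" "E \<in> K_class \<delta>"
    and P: "perimeter E < ennreal (DIM('a) * measure lebesgue (ball (0::'a) 1) *
      (r ^ (DIM('a) - 1) + \<delta> ^ (DIM('a) - 1) * (1 - root DIM('a) (1/2))))"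
    and xy: "x \<in> E" "y \<in> E" and b: "b \<in> Basis"
  shows "y \<bullet> b - x \<bullet> b \<le> 6 * \<delta> * (m / measure lebesgue (ball (0::'a) \<delta>) + 1)"
proof -
  have m0: "m \<ge> 0" using r by (simp add: m)
  have lm: "E \<in> lmeasurable"
    using E K_class_closed[OF E(2)] by (intro fmeasurableI) (auto simp del: emeasure_completion)
  have mE: "measure lebesgue E = m" using E(1) m0 by (simp add: measure_def del: emeasure_completion)
  have cE: "compact E"
    using K_class_bounded[OF E(2) \<delta> lm] K_class_closed[OF E(2)] by (simp add: compact_eq_bounded_closed)
  have "y \<bullet> b - x \<bullet> b \<le> 6 * \<delta> * (measure lebesgue E / measure lebesgue (ball (0::'a) \<delta>) + 1)"
  proof (rule K_class_width[OF E(2) \<delta> lm b _ xy], rule ccontr)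
    fix s x y assume xy: "x \<in> E" "y \<in> E" "x \<bullet> b < s" "s < y \<bullet> b" and "\<not> (\<exists>p\<in>E. p \<bullet> b = s)"
    then have "\<And>p. p \<in> E \<Longrightarrow> p \<bullet> b \<noteq> s" by blast
    from K_class_gap_perimeter[OF E(2) cE \<delta> b xy this r] show False
      using P mE m by simp
  qed
  then show ?thesis by (simp add: mE)
qed

theorem theorem4p3:
  fixes \<alpha> :: real
  assumes "DIM('a::euclidean_space) \<ge> 2"
    and "0 < \<alpha>" and "\<alpha> < real DIM('a)"
  shows "\<exists>Q\<^sub>0 > 0. \<forall>\<delta> > 0. \<forall>m \<ge> measure lebesgue (ball (0::'a) 1) * \<delta> ^ DIM('a). \<forall>Q > 0.
           Q / m powr ((real DIM('a) - 1 + \<alpha>) / (2 * real DIM('a))) \<le> Q\<^sub>0 * (\<delta> ^ DIM('a) / m) \<longrightarrow>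
             (\<exists>E :: 'a set. is_arg_min (F_energy \<alpha> Q)
                (\<lambda>E. emeasure lebesgue E = ennreal m \<and> E \<in> K_class \<delta>) E) \<and>
             (\<exists>E :: 'a set. is_arg_min (G_energy \<alpha> Q)
                (\<lambda>E. emeasure lebesgue E = ennreal m \<and> E \<in> K_class \<delta>) E)"
proof -
  let ?n = "DIM('a)"
  define w where "w = measure lebesgue (ball (0::'a) 1)"
  have w: "w > 0" by (simp add: w_def)
  define CF where "CF = enn2real (I_riesz \<alpha> (cball (0::'a) 1))"
  \<comment> \<open>\<open>enn2real\<close> yields 0 if the sphere has infinite energy. The value is
    relied upon as the energy of the sphere only after a competitor of finite energy has shown that
    energy to be finite.\<close>
  define CG where "CG = enn2real (I_riesz \<alpha> (sphere (0::'a) 1))"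
  define C where "C = max CF CG"
  have "CF \<ge> 0" by (simp add: CF_def)
  then have C0: "C \<ge> 0" by (simp add: C_def max.coboundedI1)
  \<comment> \<open>The constant of \<open>split_radii_gain\<close>; \<open>c\<close> converts it
    into perimeter, so that a split costs \<open>c * \<delta> ^ (?n - 1)\<close> more than the
    ball.\<close>
  define \<kappa> where "\<kappa> = 1 - root ?n (1/2)"
  have \<kappa>: "\<kappa> > 0" using real_root_strict_decreasing[of 0 ?n] real_root_less_mono[of ?n "1/2" 1] by (simp add: \<kappa>_def)
  define c where "c = ?n * w * \<kappa>"
  have c: "c > 0" using w \<kappa> by (simp add: c_def)
  define D where "D = C * w powr ((real ?n - 1 + \<alpha>) / real ?n - 2)"
  have D: "D \<ge> 0" using C0 by (simp add: D_def)
  \<comment> \<open>The summand 1 keeps the denominator positive when \<open>D = 0\<close>, and the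
    factor 1/2 makes the inequality \<open>Q\<^sub>0\<^sup>2 * D < c\<close> strict.\<close>
  define Q\<^sub>0 where "Q\<^sub>0 = sqrt (c / (D + 1) / 2)"
  have Q\<^sub>0: "Q\<^sub>0 > 0" using c D by (simp add: Q\<^sub>0_def)
  have "Q\<^sub>0\<^sup>2 * D < c"
  proof -
    have "Q\<^sub>0\<^sup>2 * D = c / 2 * (D / (D + 1))" using c D by (simp add: Q\<^sub>0_def)
    also have "\<dots> \<le> c / 2 * 1" using c D by (intro mult_left_mono) auto
    finally show ?thesis using c by simp
  qed
  note Q\<^sub>0D = this[unfolded D_def]
  have "(\<exists>E :: 'a set. is_arg_min (F_energy \<alpha> Q) (\<lambda>E. emeasure lebesgue E = ennreal m \<and> E \<in> K_class \<delta>) E) \<and>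
        (\<exists>E :: 'a set. is_arg_min (G_energy \<alpha> Q) (\<lambda>E. emeasure lebesgue E = ennreal m \<and> E \<in> K_class \<delta>) E)"
    if \<delta>: "\<delta> > 0" and m: "m \<ge> w * \<delta> ^ ?n" and Q: "Q > 0"
      "Q / m powr ((real ?n - 1 + \<alpha>) / (2 * real ?n)) \<le> Q\<^sub>0 * (\<delta> ^ ?n / m)" for \<delta> m Q
  proof -
    have m0: "m > 0" using m mult_pos_pos[OF w zero_less_power[OF \<delta>, of ?n]] by linarith
    define r where "r = root ?n (m / w)"
    have mr: "m = w * r ^ ?n" using w m0 by (simp add: r_def real_root_pow_pos2)
    have r\<delta>: "r \<ge> \<delta>"
    proof -
      have "\<delta> = root ?n (\<delta> ^ ?n)" using \<delta> by (simp add: real_root_power_cancel)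
      also have "\<dots> \<le> r" unfolding r_def using m w by (intro real_root_le_mono) (auto simp: field_simps)
      finally show ?thesis .
    qed
    have r: "r > 0" using r\<delta> \<delta> by simp
    have Q2: "Q\<^sup>2 > 0" using Q(1) by simp
    let ?B = "cball (0::'a) r"
    have B: "emeasure lebesgue ?B = ennreal m" "?B \<in> K_class \<delta>"
      using r cball_in_K_class[OF \<delta> r\<delta>] by (simp_all add: emeasure_cball mr w_def content_ball)
    have small: "Q\<^sup>2 * (C * r powr - \<alpha>) < c * \<delta> ^ (?n - 1)"
      by (rule small_charge_bound[OF _ w \<delta> r\<delta> Q(1) C0 Q\<^sub>0 mr Q\<^sub>0D Q(2)]) simp
    define W where "W = 6 * \<delta> * (m / measure lebesgue (ball (0::'a) \<delta>) + 1)"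
    \<comment> \<open>Stated for arbitrary \<open>J\<close> to serve both functionals. The charge of
      the competitor is discarded, and that of the ball has to fit into the cost of a split.\<close>
    have width: "y \<bullet> b - x \<bullet> b \<le> W"
      if E: "emeasure lebesgue E = ennreal m" "E \<in> K_class \<delta>" "perimeter E + ennreal (Q\<^sup>2) * J E < perimeter ?B + ennreal (Q\<^sup>2) * J ?B"
        and J: "J ?B \<le> ennreal (C * r powr - \<alpha>)" and xy: "x \<in> E" "y \<in> E" "b \<in> Basis" for E x y b and J :: "'a set \<Rightarrow> ennreal"
    proof -
      have "perimeter E \<le> perimeter E + ennreal (Q\<^sup>2) * J E" by simp
      also have "\<dots> < perimeter ?B + ennreal (Q\<^sup>2) * J ?B" by (rule E(3))
      also have "\<dots> \<le> ennreal (?n * w * r ^ (?n - 1)) + ennreal (Q\<^sup>2) * ennreal (C * r powr - \<alpha>)"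
        using perimeter_cball_le[OF r, where 'a='a] J by (intro add_mono mult_left_mono) (auto simp: w_def)
      also have "\<dots> = ennreal (?n * w * r ^ (?n - 1) + Q\<^sup>2 * (C * r powr - \<alpha>))"
        using w r C0 by (simp add: ennreal_plus ennreal_mult)
      also have "\<dots> \<le> ennreal (?n * w * (r ^ (?n - 1) + \<delta> ^ (?n - 1) * (1 - root ?n (1/2))))"
        using small by (intro ennreal_leI) (simp add: c_def \<kappa>_def algebra_simps)
      finally show ?thesis
        unfolding W_def w_def by (intro width_bound[OF \<delta> r mr[unfolded w_def] E(1,2) _ xy])
    qed
    have "\<exists>E. is_arg_min (F_energy \<alpha> Q) (\<lambda>E. emeasure lebesgue E = ennreal m \<and> E \<in> K_class \<delta>) (E :: 'a set)"
    proof (rule direct_method[OF \<delta> m0 Q2, where J = "I_riesz \<alpha>" and ?E0.0 = ?B and W = W])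
      show "I_riesz \<alpha> ((+) a ` E) \<le> I_riesz \<alpha> E" if "E \<in> K_class \<delta>" for E :: "'a set" and a
        using assms(2) K_class_closed[OF that] by (intro I_riesz_translation_le) auto
      show "I_riesz \<alpha> (K_limit.L u) \<le> ennreal c"
        if "K_limit \<delta> R E u" "\<forall>\<^sub>F n in sequentially. I_riesz \<alpha> (E n) < ennreal c" for R E c and u :: "'a \<Rightarrow> real"
        by (rule K_limit.I_riesz_L[OF that(1) assms(2) that(2)])
      show "F_energy \<alpha> Q E = perimeter E + ennreal (Q\<^sup>2) * I_riesz \<alpha> E" for E :: "'a set" by (simp add: F_energy_def)
      have "I_riesz \<alpha> ?B \<le> ennreal (r powr - \<alpha>) * I_riesz \<alpha> (cball (0::'a) 1)"
        using assms(2) r by (intro I_riesz_scale_le) (auto simp: mult_left_le)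
      also have "\<dots> = ennreal (CF * r powr - \<alpha>)"
        using I_riesz_cball_finite[OF assms(2,3)] by (simp add: CF_def ennreal_mult mult.commute ennreal_enn2real)
      also have "\<dots> \<le> ennreal (C * r powr - \<alpha>)" by (intro ennreal_leI mult_right_mono) (auto simp: C_def)
      finally show "y \<bullet> b - x \<bullet> b \<le> W"
        if "emeasure lebesgue E = ennreal m \<and> E \<in> K_class \<delta>" "F_energy \<alpha> Q E < F_energy \<alpha> Q ?B" "x \<in> E" "y \<in> E" "b \<in> Basis" for E :: "'a set" and x y b
        using that width[of E "I_riesz \<alpha>" x y b] by (simp add: F_energy_def)
    qed (use B in simp)
    moreover have "\<exists>E. is_arg_min (G_energy \<alpha> Q) (\<lambda>E. emeasure lebesgue E = ennreal m \<and> E \<in> K_class \<delta>) (E :: 'a set)"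
    proof (rule direct_method[OF \<delta> m0 Q2, where J = "\<lambda>E. I_riesz \<alpha> (frontier E)" and ?E0.0 = ?B and W = W])
      show "I_riesz \<alpha> (frontier ((+) a ` E)) \<le> I_riesz \<alpha> (frontier E)" if "E \<in> K_class \<delta>" for E :: "'a set" and a
        unfolding frontier_translation using assms(2) by (intro I_riesz_translation_le) auto
      show "I_riesz \<alpha> (frontier (K_limit.L u)) \<le> ennreal c"
        if "K_limit \<delta> R E u" "\<forall>\<^sub>F n in sequentially. I_riesz \<alpha> (frontier (E n)) < ennreal c" for R E c and u :: "'a \<Rightarrow> real"
        by (rule K_limit.I_riesz_frontier_L[OF that(1) assms(2) that(2)])
      show "G_energy \<alpha> Q E = perimeter E + ennreal (Q\<^sup>2) * I_riesz \<alpha> (frontier E)" for E :: "'a set" by (simp add: G_energy_def)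
      show "y \<bullet> b - x \<bullet> b \<le> W"
        if E: "emeasure lebesgue E = ennreal m \<and> E \<in> K_class \<delta>" "G_energy \<alpha> Q E < G_energy \<alpha> Q ?B" and xy: "x \<in> E" "y \<in> E" "b \<in> Basis" for E :: "'a set" and x y b
      proof -
        \<comment> \<open>A set that beats the ball has finite energy, and this forces the sphere to
          have finite energy as well. The bound on the energy of the ball is therefore derived under
          the existence of such a set.\<close>
        have "G_energy \<alpha> Q E < \<infinity>" using E(2) by (metis infinity_ennreal_def less_top order_less_le_trans top_greatest)
        then have "ennreal (Q\<^sup>2) * I_riesz \<alpha> (frontier E) < top" by (simp add: G_energy_def ennreal_add_less_top)
        then have IE: "I_riesz \<alpha> (frontier E) < \<infinity>" using Q2 by (auto simp: ennreal_mult_less_top)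
        have lm: "E \<in> lmeasurable"
          using E K_class_closed[of E \<delta>] by (intro fmeasurableI) (auto simp del: emeasure_completion)
        have cE: "compact E"
          using K_class_bounded[of E \<delta>, OF _ \<delta> lm] K_class_closed[of E \<delta>] E(1) by (simp add: compact_eq_bounded_closed)
        have IS: "I_riesz \<alpha> (sphere (0::'a) 1) < \<infinity>"
          using K_class_frontier_energy[OF _ \<delta> cE assms(2) IE] E(1) by blast
        have "I_riesz \<alpha> (frontier ?B) \<le> ennreal (r powr - \<alpha>) * I_riesz \<alpha> (sphere (0::'a) 1)"
          using assms(2) r by (intro I_riesz_scale_le) (auto simp: frontier_cball)
        also have "\<dots> = ennreal (CG * r powr - \<alpha>)"
          using IS by (simp add: CG_def ennreal_mult mult.commute ennreal_enn2real)
        also have "\<dots> \<le> ennreal (C * r powr - \<alpha>)" by (intro ennreal_leI mult_right_mono) (auto simp: C_def)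
        finally show ?thesis
          using E xy width[of E "\<lambda>E. I_riesz \<alpha> (frontier E)" x y b] by (simp add: G_energy_def)
      qed
    qed (use B in simp)
    ultimately show ?thesis by blast
  qed
  then show ?thesis using Q\<^sub>0 unfolding w_def by blast
qed

end
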